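(* Let $N\ge 2$, $\alpha\in(0,2)$, $C_1,C_2\ge 1$. There exist constants $\gamma>1$ and $\alpha_*\in(0,1)$ depending only on $C_1,C_2,N,\alpha$ such that the following holds. Let $E\subset\mathbb{R}^N$ be a bounded domain, let $\mu=(\mu(x,\cdot))_{x\in\mathbb{R}^N}$ be a family of Borel measures on $\mathbb{R}^N$ which is symmetric, satisfies the Poincaré inequality in $E$ with constant $C_1$, and satisfies the decay estimate with constant $C_2$. Let $u$ be a locally bounded, local weak solution of $\mathscr{L}u=0$ in $E$. Then $u$ is locally Hölder continuous in $E$. More precisely, for every ball $B_R(x_0)\subset E$ and every $0<\rho<R$, $$\operatorname*{osc}_{B_\rho(x_0)}u\le\gamma\,\omega\left(\frac{\rho}{R}\right)^{\alpha_*},\qquad\text{where}\quad \omega=2\sup_{B_R(x_0)}|u|+\mathrm{Tail}(|u|;x_0,\tfrac78R,R).$$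
   Context: $B_r(x_0)$ is the ball of radius $r$ centred at $x_0$ in $\mathbb{R}^N$; $E\subset\mathbb{R}^N$ is a bounded domain; $\alpha\in(0,2)$. A set is $\mu$-measurable if it is $\mu(x,dy)$-measurable for all $x\in\mathbb{R}^N$. The operator is $\mathscr{L}u(x)=\text{p.v.}\int_{\mathbb{R}^N}(u(x)-u(y))\,\mu(x,dy)$, understood weakly as below. Symmetric: for all disjoint $\mu$-measurable sets $\Omega_1,\Omega_2$, the functions $x\mapsto\int_{\Omega_i}\mu(x,dy)$, $i=1,2$, are Lebesgue measurable and $\int_{\Omega_1}\int_{\Omega_2}\mu(x,dy)dx=\int_{\Omega_2}\int_{\Omega_1}\mu(x,dy)dx$. For open $D\subseteq\mathbb{R}^N$ put $\mathcal{E}_D^\mu(u,\varphi)=\int_D\int_D(u(y)-u(x))(\varphi(y)-\varphi(x))\,\mu(x,dy)dx$ and $\mathcal{E}^\mu=\mathcal{E}^\mu_{\mathbb{R}^N}$. $H^\mu_{\rm loc}(E)$ is the set of functions $u$ such that, for every open $D$ with $\overline{D}\subseteq E$, $u\in L^2(D)$ and $\mathcal{E}_D^\mu(u,u)<\infty$. $H^\mu(\mathbb{R}^N)$ is the space of $u\in L^2(\mathbb{R}^N)$ with $\mathcal{E}^\mu(u,u)<\infty$. Poincaré inequality in $E$ with constant $C_1$: for every ball $B_\rho(x_0)\subset E$ and every $v\in H^\mu_{\rm loc}(E)$, $\int_{B_\rho(x_0)}(v-[v]_{B_\rho(x_0)})^2dx\le C_1\rho^\alpha\mathcal{E}^\mu_{B_\rho(x_0)}(v,v)$,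 where $[v]_{B}$ is the average of $v$ over $B$. Decay estimate with constant $C_2$: for every $x_0\in\mathbb{R}^N$, $r>0$, $\int_{\mathbb{R}^N\setminus B_r(x_0)}\mu(x_0,dy)\le C_2r^{-\alpha}$. Local weak sub(super)-solution of $\mathscr{L}u=0$ in $E$: a Lebesgue measurable $u:\mathbb{R}^N\to\mathbb{R}$ with $u\in H^\mu_{\rm loc}(E)$, $\sup_{x\in B_{\frac78R}(x_0)}\int_{\mathbb{R}^N\setminus B_R(x_0)}|u(y)|\,\mu(x,dy)<\infty$ for every $B_R(x_0)\subset E$, and $\mathcal{E}^\mu(u,\varphi)\le0$ (resp. $\ge0$) for every non-negative $\varphi\in H^\mu(\mathbb{R}^N)$ with $\operatorname{supp}\varphi\subseteq E$. A local weak solution is both a sub- and a super-solution. Tail: $\mathrm{Tail}(u;x_0,r_1,r_2)=r_2^\alpha\sup_{x\in B_{r_1}(x_0)}\int_{\mathbb{R}^N\setminus B_{r_2}(x_0)}u(y)\,\mu(x,dy)$. Suprema and oscillations of $u$ over balls are essential ones (with respect to Lebesgue measure); Hölder continuity is for a representative of $u$. *)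

theory Defs
  imports "HOL-Analysis.Analysis" "HOL-Probability.Essential_Supremum"
begin

text \<open>
  Functions are only Lebesgue measurable, and the kernel \<open>\<mu> x\<close> is a measure on the Borel sets,
  so inner integrals are taken with respect to the completion of \<open>\<mu> x\<close>. If the kernel is symmetric,
  a Lebesgue null set is \<open>\<mu> x\<close>-null for almost every \<open>x\<close> (in the sense that it lies in a Borel null
  set with this property), so a Lebesgue measurable function is measurable for the completion of
  \<open>\<mu> x\<close> for almost every \<open>x\<close>. For the remaining \<open>x\<close> the non-negative integral \<open>\<integral>\<^sup>+\<close> is
  the lower integral.
\<close>

definition borel_measure_family :: "('a::euclidean_space \<Rightarrow> 'a measure) \<Rightarrow> bool" where
  "borel_measure_family \<mu> \<longleftrightarrow> (\<forall>x. sets (\<mu> x) = sets borel)"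

definition kernel_measurable :: "('a::euclidean_space \<Rightarrow> 'a measure) \<Rightarrow> 'a set \<Rightarrow> bool" where
  "kernel_measurable \<mu> A \<longleftrightarrow> (\<forall>x. A \<in> sets (\<mu> x))"

definition symmetric_kernel :: "('a::euclidean_space \<Rightarrow> 'a measure) \<Rightarrow> bool" where
  "symmetric_kernel \<mu> \<longleftrightarrow>
     (\<forall>A B. kernel_measurable \<mu> A \<and> kernel_measurable \<mu> B \<and> A \<inter> B = {} \<longrightarrow>
        (\<lambda>x. emeasure (\<mu> x) A) \<in> borel_measurable lebesgue \<and>
        (\<lambda>x. emeasure (\<mu> x) B) \<in> borel_measurable lebesgue \<and>
        (\<integral>\<^sup>+x\<in>A. emeasure (\<mu> x) B \<partial>lebesgue) = (\<integral>\<^sup>+x\<in>B. emeasure (\<mu> x) A \<partial>lebesgue))"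

definition square_integrable_on :: "('a::euclidean_space \<Rightarrow> real) \<Rightarrow> 'a set \<Rightarrow> bool" where
  "square_integrable_on u D \<longleftrightarrow>
     u \<in> borel_measurable (lebesgue_on D) \<and> (\<integral>\<^sup>+x\<in>D. ennreal ((u x)\<^sup>2) \<partial>lebesgue) < \<infinity>"

text \<open>
  The form \<open>\<E>\<^sub>D\<^sup>\<mu>\<close> is used in two ways: on the diagonal as a value in \<open>[0, \<infinity>]\<close> (\<open>energy\<close>), and off the
  diagonal as a real number (\<open>energy_form\<close>). \<open>energy_form\<close> is meaningful only when the double
  integral converges absolutely. For symmetric \<open>\<mu>\<close> with the decay estimate, this is so
  whenever it is used in the definition of sub- and supersolutions below: the part near the
  support of the test function is controlled by the local energy, the rest by the finite tails.
\<close>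

definition energy :: "('a::euclidean_space \<Rightarrow> 'a measure) \<Rightarrow> 'a set \<Rightarrow> ('a \<Rightarrow> real) \<Rightarrow> ennreal" where
  "energy \<mu> D u =
     (\<integral>\<^sup>+x\<in>D. (\<integral>\<^sup>+y\<in>D. ennreal ((u y - u x)\<^sup>2) \<partial>completion (\<mu> x)) \<partial>lebesgue)"

definition energy_form ::
  "('a::euclidean_space \<Rightarrow> 'a measure) \<Rightarrow> 'a set \<Rightarrow> ('a \<Rightarrow> real) \<Rightarrow> ('a \<Rightarrow> real) \<Rightarrow> real" where
  "energy_form \<mu> D u \<phi> =
     (LINT x:D|lebesgue. (LINT y:D|completion (\<mu> x). (u y - u x) * (\<phi> y - \<phi> x)))"

definition H_loc :: "('a::euclidean_space \<Rightarrow> 'a measure) \<Rightarrow> 'a set \<Rightarrow> ('a \<Rightarrow> real) set" where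
  "H_loc \<mu> E =
     {u. \<forall>D. open D \<and> closure D \<subseteq> E \<longrightarrow> square_integrable_on u D \<and> energy \<mu> D u < \<infinity>}"

definition H_space :: "('a::euclidean_space \<Rightarrow> 'a measure) \<Rightarrow> ('a \<Rightarrow> real) set" where
  "H_space \<mu> = {u. square_integrable_on u UNIV \<and> energy \<mu> UNIV u < \<infinity>}"

definition average :: "('a::euclidean_space \<Rightarrow> real) \<Rightarrow> 'a set \<Rightarrow> real" where
  "average v B = (LINT x:B|lebesgue. v x) / measure lebesgue B"

text \<open>
  Both sides are values in \<open>[0, \<infinity>]\<close>, since the closure of the ball need not lie in \<open>E\<close>. If the
  energy of \<open>v\<close> on the ball is finite, the inequality on the smaller concentric balls already
  forces \<open>v\<close> to be square integrable on the ball, so the average is then a genuine one.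
\<close>

definition poincare_inequality ::
  "real \<Rightarrow> ('a::euclidean_space \<Rightarrow> 'a measure) \<Rightarrow> 'a set \<Rightarrow> real \<Rightarrow> bool" where
  "poincare_inequality \<alpha> \<mu> E C \<longleftrightarrow>
     (\<forall>x\<^sub>0 \<rho>. \<forall>v\<in>H_loc \<mu> E. 0 < \<rho> \<and> ball x\<^sub>0 \<rho> \<subseteq> E \<longrightarrow>
        (\<integral>\<^sup>+x\<in>ball x\<^sub>0 \<rho>. ennreal ((v x - average v (ball x\<^sub>0 \<rho>))\<^sup>2) \<partial>lebesgue)
          \<le> ennreal (C * \<rho> powr \<alpha>) * energy \<mu> (ball x\<^sub>0 \<rho>) v)"

definition decay_estimate ::
  "real \<Rightarrow> ('a::euclidean_space \<Rightarrow> 'a measure) \<Rightarrow> real \<Rightarrow> bool" where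
  "decay_estimate \<alpha> \<mu> C \<longleftrightarrow>
     (\<forall>x\<^sub>0 r. 0 < r \<longrightarrow> emeasure (\<mu> x\<^sub>0) (- ball x\<^sub>0 r) \<le> ennreal (C * r powr (- \<alpha>)))"

definition admissible :: "('a::euclidean_space \<Rightarrow> 'a measure) \<Rightarrow> 'a set \<Rightarrow> ('a \<Rightarrow> real) \<Rightarrow> bool" where
  "admissible \<mu> E u \<longleftrightarrow>
     u \<in> borel_measurable lebesgue \<and> u \<in> H_loc \<mu> E \<and>
     (\<forall>x\<^sub>0 R. 0 < R \<and> ball x\<^sub>0 R \<subseteq> E \<longrightarrow>
        (SUP x\<in>ball x\<^sub>0 (7/8 * R). \<integral>\<^sup>+y\<in>- ball x\<^sub>0 R. ennreal \<bar>u y\<bar> \<partial>completion (\<mu> x)) < \<infinity>)"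

definition test_functions ::
  "('a::euclidean_space \<Rightarrow> 'a measure) \<Rightarrow> 'a set \<Rightarrow> ('a \<Rightarrow> real) set" where
  "test_functions \<mu> E =
     {\<phi> \<in> H_space \<mu>. (\<forall>x. 0 \<le> \<phi> x) \<and> closure {x. \<phi> x \<noteq> 0} \<subseteq> E}"

definition weak_subsolution ::
  "('a::euclidean_space \<Rightarrow> 'a measure) \<Rightarrow> 'a set \<Rightarrow> ('a \<Rightarrow> real) \<Rightarrow> bool" where
  "weak_subsolution \<mu> E u \<longleftrightarrow>
     admissible \<mu> E u \<and> (\<forall>\<phi>\<in>test_functions \<mu> E. energy_form \<mu> UNIV u \<phi> \<le> 0)"

definition weak_supersolution ::
  "('a::euclidean_space \<Rightarrow> 'a measure) \<Rightarrow> 'a set \<Rightarrow> ('a \<Rightarrow> real) \<Rightarrow> bool" where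
  "weak_supersolution \<mu> E u \<longleftrightarrow>
     admissible \<mu> E u \<and> (\<forall>\<phi>\<in>test_functions \<mu> E. energy_form \<mu> UNIV u \<phi> \<ge> 0)"

definition weak_solution ::
  "('a::euclidean_space \<Rightarrow> 'a measure) \<Rightarrow> 'a set \<Rightarrow> ('a \<Rightarrow> real) \<Rightarrow> bool" where
  "weak_solution \<mu> E u \<longleftrightarrow> weak_subsolution \<mu> E u \<and> weak_supersolution \<mu> E u"

text \<open>The argument \<open>w\<close> of \<open>tail\<close> is a non-negative function, as \<open>\<bar>u\<bar>\<close> is.\<close>

definition tail ::
  "real \<Rightarrow> ('a::euclidean_space \<Rightarrow> 'a measure) \<Rightarrow> ('a \<Rightarrow> ennreal) \<Rightarrow> 'a \<Rightarrow> real \<Rightarrow> real \<Rightarrow> ennreal" where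
  "tail \<alpha> \<mu> w x\<^sub>0 r\<^sub>1 r\<^sub>2 =
     ennreal (r\<^sub>2 powr \<alpha>) *
       (SUP x\<in>ball x\<^sub>0 r\<^sub>1. \<integral>\<^sup>+y\<in>- ball x\<^sub>0 r\<^sub>2. w y \<partial>completion (\<mu> x))"

definition ess_sup_on :: "'a::euclidean_space set \<Rightarrow> ('a \<Rightarrow> real) \<Rightarrow> ereal" where
  "ess_sup_on S f = esssup (lebesgue_on S) (\<lambda>x. ereal (f x))"

definition ess_inf_on :: "'a::euclidean_space set \<Rightarrow> ('a \<Rightarrow> real) \<Rightarrow> ereal" where
  "ess_inf_on S f = - ess_sup_on S (\<lambda>x. - f x)"

definition ess_osc_on :: "'a::euclidean_space set \<Rightarrow> ('a \<Rightarrow> real) \<Rightarrow> ereal" where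
  "ess_osc_on S f = ess_sup_on S f - ess_inf_on S f"

definition locally_ess_bounded :: "'a::euclidean_space set \<Rightarrow> ('a \<Rightarrow> real) \<Rightarrow> bool" where
  "locally_ess_bounded E u \<longleftrightarrow>
     (\<forall>K. compact K \<and> K \<subseteq> E \<longrightarrow> (\<exists>M. AE x in lebesgue_on K. \<bar>u x\<bar> \<le> M))"

definition locally_holder_on :: "'a::euclidean_space set \<Rightarrow> ('a \<Rightarrow> real) \<Rightarrow> bool" where
  "locally_holder_on E f \<longleftrightarrow>
     (\<exists>\<beta>. 0 < \<beta> \<and> \<beta> \<le> 1 \<and>
       (\<forall>K. compact K \<and> K \<subseteq> E \<longrightarrow>
         (\<exists>C. \<forall>x\<in>K. \<forall>y\<in>K. \<bar>f x - f y\<bar> \<le> C * dist x y powr \<beta>)))"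

end

theory Submission
  imports Defs "HOL-Probability.Giry_Monad"
begin

text \<open>
  Off the diagonal, \<open>\<mu>(x, dy) dx\<close> is a symmetric \<open>\<sigma>\<close>-finite measure on pairs, so after passing to a Borel
  representative of \<open>u\<close> every form becomes an integral against this measure. The Poincare inequality
  on all small balls yields a Faber--Krahn inequality, and testing the equation with truncations
  \<open>(\<epsilon> * (\<psi> - t) - u)\<^sub>+\<close> for a fixed cutoff \<open>\<psi>\<close> then gives a De Giorgi lemma: a non-negative supersolution
  that is at least \<open>\<epsilon>\<close> on most of a ball is at least \<open>\<epsilon>/2\<close> on the half ball. The smallness hypothesis is
  supplied by testing with \<open>\<psi>\<^sup>2 / (u + \<epsilon>)\<close>, which bounds the energy of \<open>ln (u + \<epsilon>)\<close>, and by the Poincare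
  inequality for the truncated logarithm. Applied to \<open>u - inf u\<close> or \<open>sup u - u\<close>, this reduces the
  oscillation by a fixed factor on a smaller ball, and the long-range contributions reproduce themselves
  with the same factor.
\<close>

section \<open>The joint measure of a symmetric kernel\<close>

text \<open>Neither a density of \<open>\<mu> x\<close> nor a pointwise lower bound is available:
  all coercivity comes from the Poincare inequality and all upper control from the decay estimate.
  The latter says nothing about the mass of \<open>\<mu> x\<close> at \<open>x\<close>, and masses
  near \<open>x\<close> may be infinite. So the diagonal, where every increment vanishes, is
  removed, and the other pairs are cut into countably many pieces of rectangles with a positive gap
  between their sides. There masses are finite and the symmetry hypothesis, given for disjoint sets,
  applies directly. The iteration is superlinear because a ball with twice the volume of a small set
  has a small radius: the factor \<alpha> powers of that radius become \<alpha>/N powers of the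
  measure. The logarithm makes the set small because its energy bound does not depend on \<epsilon>,
  while its size on the sublevel set grows as \<epsilon> decreases. Positivity holds only inside the
  ball, so negative values outside act as a source. The estimates tolerate it at the size
  \<open>\<epsilon> * R powr - \<alpha>\<close>, which is why the oscillation step raises a bound by
  little and shrinks the radius by much.\<close>

lemma separated_cover:
  obtains U V :: "nat \<Rightarrow> 'a::euclidean_space set" and W :: "nat \<Rightarrow> ('a \<times> 'a) set" and r :: "nat \<Rightarrow> real"
  where "\<And>n. U n \<in> sets borel" "\<And>n. V n \<in> sets borel" "\<And>n. bounded (U n)" "\<And>n. 0 < r n"
    "\<And>n x y. x \<in> U n \<Longrightarrow> y \<in> V n \<Longrightarrow> r n \<le> dist x y"
    "\<And>n. W n \<in> sets borel" "\<And>n. W n \<subseteq> U n \<times> V n" "disjoint_family W" "(\<Union>n. W n) = {z. fst z \<noteq> snd z}"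
proof -
  obtain D :: "'a set" where D: "countable D" "\<And>X. open X \<Longrightarrow> X \<noteq> {} \<Longrightarrow> \<exists>d\<in>D. d \<in> X"
    using countable_dense_exists by metis
  have "D \<noteq> {}" using D(2)[of UNIV] by auto
  define p where "p n = from_nat_into D (fst (prod_decode n))" for n
  define r where "r n = inverse (real (Suc (snd (prod_decode n))))" for n
  \<comment> \<open>Each rectangle pairs a small ball with the complement of the ball of twice the
    radius. For \<open>x \<noteq> y\<close> a radius below a third of the distance suffices: a
    centre that close to \<open>x\<close> is still more than two radii away from
    \<open>y\<close>.\<close>
  define U where "U n = ball (p n) (r n)" for n
  define V where "V n = - ball (p n) (2 * r n)" for n
  have r: "0 < r n" for n by (simp add: r_def)
  have sep: "r n \<le> dist x y" if "x \<in> U n" "y \<in> V n" for n x y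
    using that dist_triangle[of "p n" y x] by (auto simp: U_def V_def)
  have cov: "\<exists>n. x \<in> U n \<and> y \<in> V n" if "x \<noteq> y" for x y
  proof -
    obtain i where i: "inverse (real (Suc i)) < dist x y / 3"
      using reals_Archimedean[of "dist x y / 3"] \<open>x \<noteq> y\<close> zero_less_dist_iff[of x y]
      by (metis divide_pos_pos zero_less_numeral)
    obtain d where d: "d \<in> D" "d \<in> ball x (inverse (real (Suc i)))"
      using D(2)[of "ball x (inverse (real (Suc i)))"] by auto
    obtain k where k: "from_nat_into D k = d"
      using from_nat_into_surj[OF D(1) d(1)] by auto
    have "x \<in> U (prod_encode (k, i))" "y \<in> V (prod_encode (k, i))"
      using d i k dist_triangle[of x y d] by (auto simp: U_def V_def p_def r_def dist_commute)
    then show ?thesis by blast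
  qed
  have un: "(\<Union>n. U n \<times> V n) = {z. fst z \<noteq> snd z}"
  proof (intro set_eqI iffI)
    fix z :: "'a \<times> 'a" assume "z \<in> (\<Union>n. U n \<times> V n)"
    then obtain n where "fst z \<in> U n" "snd z \<in> V n" by (auto simp: mem_Times_iff)
    then have "0 < dist (fst z) (snd z)" using sep r less_le_trans by blast
    then show "z \<in> {z. fst z \<noteq> snd z}" by simp
  next
    fix z :: "'a \<times> 'a" assume "z \<in> {z. fst z \<noteq> snd z}"
    then show "z \<in> (\<Union>n. U n \<times> V n)" using cov[of "fst z" "snd z"] by (auto simp: mem_Times_iff)
  qed
  \<comment> \<open>Making the pieces disjoint destroys their product form, so the rectangles are
    kept alongside to provide the gap.\<close>
  define W where "W = disjointed (\<lambda>n. U n \<times> V n)"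
  have "U n \<times> V n \<in> sets borel" for n by (rule borel_Times) (auto simp: U_def V_def)
  then have W: "W n \<in> sets borel" "W n \<subseteq> U n \<times> V n" for n
    using sets.range_disjointed_sets[of "\<lambda>n. U n \<times> V n" borel] disjointed_subset[of "\<lambda>n. U n \<times> V n" n]
    by (auto simp: W_def)
  have "disjoint_family W" "(\<Union>n. W n) = {z. fst z \<noteq> snd z}"
    using un by (simp_all add: W_def disjoint_family_disjointed UN_disjointed_eq)
  with r sep W show ?thesis
    by (intro that[of U V r W]) (auto simp: U_def V_def)
qed

lemma nn_integral_suminf_disjoint_cover:
  fixes W :: "nat \<Rightarrow> 'b set"
  assumes "f \<in> borel_measurable M" "\<And>n. W n \<in> sets M" "disjoint_family W"
    and z: "\<And>x. x \<in> space M \<Longrightarrow> x \<notin> (\<Union>n. W n) \<Longrightarrow> f x = 0"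
  shows "(\<integral>\<^sup>+x. f x \<partial>M) = (\<Sum>n. \<integral>\<^sup>+x\<in>W n. f x \<partial>M)"
  using assms(1-3)
  by (subst nn_integral_disjoint_family[symmetric]) (auto intro!: nn_integral_cong simp: indicator_def z)

section \<open>Changes on null sets under the completion\<close>

lemma borel_measurable_completion_cong_AE:
  assumes f: "f \<in> borel_measurable (completion M)" and eq: "AE x in M. f x = g x"
  shows "g \<in> borel_measurable (completion M)"
proof (rule measurableI)
  fix A :: "'b set" assume A: "A \<in> sets borel"
  show "g -` A \<inter> space (completion M) \<in> sets (completion M)"
  proof (rule completion.in_sets_AE)
    show "f -` A \<inter> space (completion M) \<in> sets (completion M)"
      by (rule measurable_sets[OF f A])
    show "AE x in completion M. (x \<in> f -` A \<inter> space (completion M)) = (x \<in> g -` A \<inter> space (completion M))"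
      using AE_completion[OF eq] by eventually_elim auto
  qed auto
qed simp

text \<open>If one function fails to be measurable for the completion, so does the other, and both
  integrals take the default value 0. This matters where measurability of an inner integral in its
  parameter is not at hand.\<close>

lemma integral_completion_cong_AE:
  fixes f g :: "'a \<Rightarrow> 'b::{banach, second_countable_topology}"
  assumes eq: "AE x in M. f x = g x"
  shows "integral\<^sup>L (completion M) f = integral\<^sup>L (completion M) g"
proof (cases "f \<in> borel_measurable (completion M)")
  case True
  then show ?thesis
    using borel_measurable_completion_cong_AE[OF True eq] AE_completion[OF eq]
    by (intro integral_cong_AE) auto
next
  case False
  have "AE x in M. g x = f x" using eq by eventually_elim simp
  then have "g \<notin> borel_measurable (completion M)"
    using False borel_measurable_completion_cong_AE by blast
  then show ?thesis
    using False by (metis borel_measurable_integrable not_integrable_integral_eq)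
qed

text \<open>The measure \<mu>(x, dy) dx on pairs, with the diagonal removed: the decay estimate
  leaves the mass of \<open>{x}\<close> under \<open>\<mu> x\<close> unrestricted, possibly
  infinite, so keeping the diagonal could spoil sigma-finiteness, while no energy sees it. The outer
  integral is over \<open>lebesgue\<close> because masses are only known to be Lebesgue measurable
  in \<open>x\<close>.\<close>

definition joint :: "('a::euclidean_space \<Rightarrow> 'a measure) \<Rightarrow> ('a \<times> 'a) measure" where
  "joint \<mu> = measure_of UNIV (sets borel)
     (\<lambda>S. \<integral>\<^sup>+x. (\<integral>\<^sup>+y. indicator (S \<inter> {z. fst z \<noteq> snd z}) (x, y) \<partial>\<mu> x) \<partial>lebesgue)"

lemma sets_joint [measurable_cong, simp]: "sets (joint \<mu>) = sets borel"
  unfolding joint_def using sets.sigma_sets_eq[of borel] by simp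

lemma space_joint [simp]: "space (joint \<mu>) = UNIV"
  by (simp add: joint_def)

lemma diagonal_borel [measurable]:
  "{z :: 'a::euclidean_space \<times> 'a. fst z \<noteq> snd z} \<in> sets borel"
proof -
  have "open {z :: 'a \<times> 'a. fst z \<noteq> snd z}"
    by (intro open_Collect_neq continuous_intros)
  then show ?thesis by simp
qed

lemma diagonal_borel' [measurable, simp]:
  "{z :: 'a::euclidean_space \<times> 'a. fst z = snd z} \<in> sets borel"
proof -
  have "closed {z :: 'a \<times> 'a. fst z = snd z}"
    by (intro closed_Collect_eq continuous_intros)
  then show ?thesis by simp
qed

text \<open>Times \<open>s powr - \<alpha>\<close>, this bounds the truncated second moment of
  \<open>\<mu> x\<close> at scale \<open>s\<close>. It is the sum of a geometric series with ratio
  \<open>2 powr (\<alpha> - 2)\<close>, which converges because \<alpha> < 2.\<close>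

definition carre_const :: "real \<Rightarrow> real \<Rightarrow> real" where
  "carre_const \<alpha> C = C * 2 powr \<alpha> / (1 - 2 powr (\<alpha> - 2))"

lemma carre_const_positive:
  assumes "\<alpha> < 2" "1 \<le> C"
  shows "0 < carre_const \<alpha> C"
proof -
  have "2 powr (\<alpha> - 2) < 2 powr (0::real)" using assms by (intro powr_less_mono) auto
  then show ?thesis using assms by (auto simp: carre_const_def intro!: divide_pos_pos mult_pos_pos)
qed

section \<open>Measurability, finiteness and symmetry off the diagonal\<close>

locale symmetric_decay_kernel =
  fixes \<mu> :: "'a::euclidean_space \<Rightarrow> 'a measure" and \<alpha> C :: real
  assumes borel_mu: "borel_measure_family \<mu>" and sym_mu: "symmetric_kernel \<mu>"
    and decay_mu: "decay_estimate \<alpha> \<mu> C"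
    and alpha_pos: "0 < \<alpha>" and alpha_less: "\<alpha> < 2" and C_ge: "1 \<le> C"
begin

lemma sets_mu [measurable_cong, simp]: "sets (\<mu> x) = sets borel"
  using borel_mu by (simp add: borel_measure_family_def)

lemma space_mu [simp]: "space (\<mu> x) = UNIV"
  using sets_eq_imp_space_eq[OF sets_mu[of x]] by simp

lemma measurable_mu [simp]: "measurable (\<mu> x) = measurable borel"
  by (intro ext measurable_cong_sets) auto

lemma emeasure_mu_measurable:
  "A \<in> sets borel \<Longrightarrow> (\<lambda>x. emeasure (\<mu> x) A) \<in> borel_measurable lebesgue"
  using sym_mu unfolding symmetric_kernel_def kernel_measurable_def
  by (auto dest: spec[of _ A] spec[of _ "{}"])

lemma emeasure_mu_sym:
  "A \<in> sets borel \<Longrightarrow> B \<in> sets borel \<Longrightarrow> A \<inter> B = {} \<Longrightarrow>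
    (\<integral>\<^sup>+x\<in>A. emeasure (\<mu> x) B \<partial>lebesgue) = (\<integral>\<^sup>+x\<in>B. emeasure (\<mu> x) A \<partial>lebesgue)"
  using sym_mu unfolding symmetric_kernel_def kernel_measurable_def by auto

lemma emeasure_mu_far:
  assumes "0 < r" "\<And>y. y \<in> A \<Longrightarrow> r \<le> dist x y" 
  shows "emeasure (\<mu> x) A \<le> ennreal (C * r powr - \<alpha>)"
proof -
  have "emeasure (\<mu> x) A \<le> emeasure (\<mu> x) (- ball x r)"
    by (rule emeasure_mono) (use assms in force)+
  also have "\<dots> \<le> ennreal (C * r powr - \<alpha>)"
    using decay_mu assms(1) unfolding decay_estimate_def by blast
  finally show ?thesis .
qed

text \<open>The hypotheses make masses measurable in \<open>x\<close> one set at a time. On a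
  separated rectangle the masses are bounded, so after division by a bound the kernel is a
  measurable family of subprobability measures, whose parameter integrals are measurable.\<close>

lemma measurable_section_integral_aux:
  assumes [measurable]: "U \<in> sets borel" "V \<in> sets borel" and r: "0 < r"
    and sep: "\<And>x y. x \<in> U \<Longrightarrow> y \<in> V \<Longrightarrow> r \<le> dist x y"
    and [measurable]: "f \<in> borel_measurable borel" 
    and f0: "\<And>x y. (x, y) \<notin> U \<times> V \<Longrightarrow> f (x, y) = 0"
  shows "(\<lambda>x. \<integral>\<^sup>+y. f (x, y) \<partial>\<mu> x) \<in> borel_measurable lebesgue"
proof -
  define c where "c = max 1 (C * r powr - \<alpha>)"
  have c: "1 \<le> c" by (simp add: c_def)
  define L where "L x = (if x \<in> U then scale_measure (ennreal (1/c)) (density (\<mu> x) (indicator V))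
    else null_measure borel)" for x
  have L_em: "emeasure (L x) A = ennreal (1/c) * (emeasure (\<mu> x) (V \<inter> A)) * indicator U x" 
    if [measurable]: "A \<in> sets borel" for x A
  proof -
    have "(\<integral>\<^sup>+y. indicator V y * indicator A y \<partial>\<mu> x) = emeasure (\<mu> x) (V \<inter> A)"
      by (simp flip: indicator_inter_arith)
    then show ?thesis
      by (simp add: L_def emeasure_density del: nn_integral_indicator)
  qed
  have L_meas: "L \<in> measurable lebesgue (subprob_algebra borel)"
  proof (rule measurable_subprob_algebra)
    fix x :: 'a
    show "sets (L x) = sets borel" by (simp add: L_def)
    have "emeasure (L x) UNIV \<le> 1"
    proof (cases "x \<in> U")
      case True
      have "emeasure (\<mu> x) V \<le> ennreal c"
        by (rule order_trans[OF emeasure_mu_far[OF r]]) (auto simp: c_def sep[OF True] intro!: ennreal_leI)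
      then have "ennreal (1/c) * emeasure (\<mu> x) V \<le> ennreal (1/c) * ennreal c"
        by (rule mult_left_mono) simp
      also have "\<dots> = 1" using c by (simp flip: ennreal_mult'')
      finally show ?thesis using True by (simp add: L_em)
    qed (simp add: L_em)
    moreover have "space (L x) = UNIV" by (simp add: L_def space_scale_measure)
    ultimately show "subprob_space (L x)"
      by (intro subprob_spaceI) auto
  next
    fix A :: "'a set" assume [measurable]: "A \<in> sets borel"
    have [measurable]: "U \<in> sets lebesgue" by simp
    show "(\<lambda>x. emeasure (L x) A) \<in> borel_measurable lebesgue"
      using emeasure_mu_measurable[of "V \<inter> A"] by (simp add: L_em)
  qed
  have "f \<in> borel_measurable (borel \<Otimes>\<^sub>M borel)" by (simp add: borel_prod)
  moreover have "(\<lambda>z. z) \<in> (lebesgue \<Otimes>\<^sub>M borel) \<rightarrow>\<^sub>M ((borel :: 'a measure) \<Otimes>\<^sub>M (borel :: 'a measure))"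
    by (intro measurable_pair_measureI) (auto simp: sets_completionI_sets intro!: pair_measureI)
  ultimately have fm: "f \<in> borel_measurable (lebesgue \<Otimes>\<^sub>M borel)"
    using measurable_compose by blast
  have "(\<lambda>x. \<integral>\<^sup>+y. f (x, y) \<partial>L x) \<in> borel_measurable lebesgue"
    by (rule nn_integral_measurable_subprob_algebra2[OF _ L_meas]) (use fm in simp)
  then have "(\<lambda>x. ennreal c * (\<integral>\<^sup>+y. f (x, y) \<partial>L x)) \<in> borel_measurable lebesgue"
    by simp
  also have "(\<lambda>x. ennreal c * (\<integral>\<^sup>+y. f (x, y) \<partial>L x)) = (\<lambda>x. \<integral>\<^sup>+y. f (x, y) \<partial>\<mu> x)"
  proof
    fix x
    show "ennreal c * (\<integral>\<^sup>+y. f (x, y) \<partial>L x) = (\<integral>\<^sup>+y. f (x, y) \<partial>\<mu> x)"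
    proof (cases "x \<in> U")
      case True
      have "(\<integral>\<^sup>+y. f (x, y) \<partial>L x) = ennreal (1/c) * (\<integral>\<^sup>+y. indicator V y * f (x, y) \<partial>\<mu> x)"
        using True by (simp add: L_def nn_integral_scale_measure nn_integral_density)
      also have "(\<integral>\<^sup>+y. indicator V y * f (x, y) \<partial>\<mu> x) = (\<integral>\<^sup>+y. f (x, y) \<partial>\<mu> x)"
        using f0 by (intro nn_integral_cong) (auto simp: indicator_def)
      finally show ?thesis using c by (simp flip: ennreal_mult'' mult.assoc)
    qed (use f0 in \<open>auto simp: L_def nn_integral_null_measure\<close>)
  qed
  finally show ?thesis .
qed

lemma measurable_Pair_borel:
  assumes "f \<in> borel_measurable (borel :: ('a \<times> 'a) measure)"
  shows "(\<lambda>y. f (x, y)) \<in> borel_measurable borel"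
proof (rule measurable_compose[OF _ assms])
  show "Pair x \<in> borel \<rightarrow>\<^sub>M borel"
    by (intro borel_measurable_continuous_onI continuous_intros)
qed

text \<open>The separated cover has no piece on the diagonal, so splitting the integral along it
  relies on \<open>f (x, x) = 0\<close>.\<close>

lemma measurable_section_integral:
  fixes f :: "'a \<times> 'a \<Rightarrow> ennreal"
  assumes [measurable]: "f \<in> borel_measurable borel" and f0: "\<And>x. f (x, x) = 0"
  shows "(\<lambda>x. \<integral>\<^sup>+y. f (x, y) \<partial>\<mu> x) \<in> borel_measurable lebesgue"
proof -
  obtain U V :: "nat \<Rightarrow> 'a set" and W r where UV:
    "\<And>n. U n \<in> sets borel" "\<And>n. V n \<in> sets borel" "\<And>n. bounded (U n)" "\<And>n. 0 < r n"
    "\<And>n x y. x \<in> U n \<Longrightarrow> y \<in> V n \<Longrightarrow> r n \<le> dist x y"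
    and W [measurable]: "\<And>n. W n \<in> sets borel" and Wsub: "\<And>n. W n \<subseteq> U n \<times> V n"
    and Wd: "disjoint_family W" and Wun: "(\<Union>n. W n) = {z. fst z \<noteq> snd z}"
    by (rule separated_cover) (rule that)
  have eq: "(\<integral>\<^sup>+y. f (x, y) \<partial>\<mu> x) = (\<Sum>n. \<integral>\<^sup>+y. f (x, y) * indicator (W n) (x, y) \<partial>\<mu> x)" for x
  proof -
    have s: "{y. (x, y) \<in> W n} \<in> sets borel" for n
      using sets_Pair1[of "W n" borel borel x] by (simp add: borel_prod vimage_def)
    have "(\<integral>\<^sup>+y. f (x, y) \<partial>\<mu> x) = (\<Sum>n. \<integral>\<^sup>+y. f (x, y) * indicator {y. (x, y) \<in> W n} y \<partial>\<mu> x)"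
    proof (rule nn_integral_suminf_disjoint_cover)
      show "(\<lambda>y. f (x, y)) \<in> borel_measurable (\<mu> x)" by (simp add: measurable_Pair_borel)
      show "{y. (x, y) \<in> W n} \<in> sets (\<mu> x)" for n using s by simp
      show "disjoint_family (\<lambda>n. {y. (x, y) \<in> W n})"
        using Wd by (auto simp: disjoint_family_on_def)
      fix y assume "y \<notin> (\<Union>n. {y. (x, y) \<in> W n})"
      then have "(x, y) \<notin> (\<Union>n. W n)" by auto
      then have "x = y" unfolding Wun by simp
      then show "f (x, y) = 0" using f0 by simp
    qed
    then show ?thesis by (simp add: indicator_def)
  qed
  have "(\<lambda>x. \<integral>\<^sup>+y. f (x, y) * indicator (W n) (x, y) \<partial>\<mu> x) \<in> borel_measurable lebesgue" for n
    by (rule measurable_section_integral_aux[OF UV(1,2,4,5), where f = "\<lambda>z. f z * indicator (W n) z"])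
      (use Wsub[of n] in \<open>auto simp: indicator_def\<close>)
  then show ?thesis
    unfolding eq by measurable
qed

lemma emeasure_joint:
  assumes S: "S \<in> sets borel"
  shows "emeasure (joint \<mu>) S =
    (\<integral>\<^sup>+x. (\<integral>\<^sup>+y. indicator (S \<inter> {z. fst z \<noteq> snd z}) (x, y) \<partial>\<mu> x) \<partial>lebesgue)"
proof (rule emeasure_measure_of[OF joint_def])
  show "sets borel \<subseteq> Pow UNIV" by simp
  show "S \<in> sets (joint \<mu>)" using S by simp
  let ?E = "{z :: 'a \<times> 'a. fst z \<noteq> snd z}"
  show "positive (sets (joint \<mu>)) (\<lambda>S. \<integral>\<^sup>+x. (\<integral>\<^sup>+y. indicator (S \<inter> ?E) (x, y) \<partial>\<mu> x) \<partial>lebesgue)"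
    by (simp add: positive_def)
  show "countably_additive (sets (joint \<mu>)) (\<lambda>S. \<integral>\<^sup>+x. (\<integral>\<^sup>+y. indicator (S \<inter> ?E) (x, y) \<partial>\<mu> x) \<partial>lebesgue)"
  proof (rule countably_additiveI)
    fix A :: "nat \<Rightarrow> ('a \<times> 'a) set" assume A: "range A \<subseteq> sets (joint \<mu>)" "disjoint_family A"
    then have [measurable]: "A n \<in> sets borel" for n by auto
    have m: "(indicator (A n \<inter> ?E) :: _ \<Rightarrow> ennreal) \<in> borel_measurable borel" for n by measurable
    have "(\<Sum>n. \<integral>\<^sup>+x. (\<integral>\<^sup>+y. indicator (A n \<inter> ?E) (x, y) \<partial>\<mu> x) \<partial>lebesgue) =
      (\<integral>\<^sup>+x. (\<Sum>n. \<integral>\<^sup>+y. indicator (A n \<inter> ?E) (x, y) \<partial>\<mu> x) \<partial>lebesgue)"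
      by (intro nn_integral_suminf[symmetric] measurable_section_integral m) simp
    also have "\<dots> = (\<integral>\<^sup>+x. (\<integral>\<^sup>+y. (\<Sum>n. indicator (A n \<inter> ?E) (x, y)) \<partial>\<mu> x) \<partial>lebesgue)"
      by (intro nn_integral_cong nn_integral_suminf[symmetric]) (simp add: measurable_Pair_borel[OF m])
    also have "\<dots> = (\<integral>\<^sup>+x. (\<integral>\<^sup>+y. indicator ((\<Union>n. A n) \<inter> ?E) (x, y) \<partial>\<mu> x) \<partial>lebesgue)"
    proof (intro nn_integral_cong)
      fix x y
      have "disjoint_family (\<lambda>n. A n \<inter> ?E)" using A(2) by (auto simp: disjoint_family_on_def)
      from suminf_indicator[OF this, of "(x, y)"]
      show "(\<Sum>n. indicator (A n \<inter> ?E) (x, y)) = (indicator ((\<Union>n. A n) \<inter> ?E) (x, y) :: ennreal)"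
        unfolding Int_UN_distrib2 by (simp only: UN_simps)
    qed
    finally show "(\<Sum>n. \<integral>\<^sup>+x. (\<integral>\<^sup>+y. indicator (A n \<inter> ?E) (x, y) \<partial>\<mu> x) \<partial>lebesgue) =
      (\<integral>\<^sup>+x. (\<integral>\<^sup>+y. indicator ((\<Union>n. A n) \<inter> ?E) (x, y) \<partial>\<mu> x) \<partial>lebesgue)" .
  qed
qed

lemma nn_integral_joint_off_diagonal:
  fixes f :: "'a \<times> 'a \<Rightarrow> ennreal"
  assumes "f \<in> borel_measurable borel"
  shows "(\<integral>\<^sup>+z. f z \<partial>joint \<mu>) =
    (\<integral>\<^sup>+x. (\<integral>\<^sup>+y. f (x, y) * indicator {z. fst z \<noteq> snd z} (x, y) \<partial>\<mu> x) \<partial>lebesgue)"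
  using assms
proof (induction rule: borel_measurable_induct)
  case (cong f g)
  then show ?case by (metis (no_types, lifting) ext UNIV_I space_borel)
next
  case (set A)
  then show ?case
    by (simp add: emeasure_joint indicator_inter_arith)
next
  case (mult u c)
  note [measurable] = mult(2)
  let ?g = "\<lambda>z. u z * indicator {z. fst z \<noteq> snd z} z"
  have m: "?g \<in> borel_measurable borel" by measurable
  have "(\<integral>\<^sup>+z. c * u z \<partial>joint \<mu>) = c * (\<integral>\<^sup>+x. (\<integral>\<^sup>+y. ?g (x, y) \<partial>\<mu> x) \<partial>lebesgue)"
    by (simp add: nn_integral_cmult mult)
  also have "\<dots> = (\<integral>\<^sup>+x. c * (\<integral>\<^sup>+y. ?g (x, y) \<partial>\<mu> x) \<partial>lebesgue)"
    by (intro nn_integral_cmult[symmetric] measurable_section_integral m) simp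
  also have "\<dots> = (\<integral>\<^sup>+x. (\<integral>\<^sup>+y. c * ?g (x, y) \<partial>\<mu> x) \<partial>lebesgue)"
    by (intro nn_integral_cong nn_integral_cmult[symmetric]) (simp add: measurable_Pair_borel[OF m])
  finally show ?case by (simp add: mult.assoc)
next
  case (add u v)
  note [measurable] = add(1,3)
  let ?g = "\<lambda>z. u z * indicator {z. fst z \<noteq> snd z} z"
  let ?h = "\<lambda>z. v z * indicator {z. fst z \<noteq> snd z} z"
  have m: "?g \<in> borel_measurable borel" by measurable
  have m': "?h \<in> borel_measurable borel" by measurable
  have "(\<integral>\<^sup>+z. u z + v z \<partial>joint \<mu>) =
     (\<integral>\<^sup>+x. (\<integral>\<^sup>+y. ?g (x, y) \<partial>\<mu> x) \<partial>lebesgue) + (\<integral>\<^sup>+x. (\<integral>\<^sup>+y. ?h (x, y) \<partial>\<mu> x) \<partial>lebesgue)"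
    by (simp add: nn_integral_add add)
  also have "\<dots> = (\<integral>\<^sup>+x. (\<integral>\<^sup>+y. ?g (x, y) \<partial>\<mu> x) + (\<integral>\<^sup>+y. ?h (x, y) \<partial>\<mu> x) \<partial>lebesgue)"
    by (intro nn_integral_add[symmetric] measurable_section_integral m m') simp_all
  also have "\<dots> = (\<integral>\<^sup>+x. (\<integral>\<^sup>+y. ?g (x, y) + ?h (x, y) \<partial>\<mu> x) \<partial>lebesgue)"
    by (intro nn_integral_cong nn_integral_add[symmetric]) (simp_all add: measurable_Pair_borel[OF m] measurable_Pair_borel[OF m'])
  finally show ?case by (simp add: distrib_right add.commute)
next
  case (seq U)
  note [measurable] = seq(1)
  let ?g = "\<lambda>i z. U i z * indicator {z. fst z \<noteq> snd z} z"
  have m: "?g i \<in> borel_measurable borel" for i by measurable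
  have inc: "incseq (\<lambda>i. ?g i)" using seq(3) by (auto simp: incseq_def le_fun_def intro!: mult_right_mono)
  have "(\<integral>\<^sup>+z. (SUP i. U i) z \<partial>joint \<mu>) = (SUP i. \<integral>\<^sup>+z. U i z \<partial>joint \<mu>)"
    using nn_integral_monotone_convergence_SUP[of U "joint \<mu>"] seq(3) by (simp add: image_comp)
  also have "\<dots> = (SUP i. \<integral>\<^sup>+x. (\<integral>\<^sup>+y. ?g i (x, y) \<partial>\<mu> x) \<partial>lebesgue)"
    using seq by simp
  also have "\<dots> = (\<integral>\<^sup>+x. (SUP i. \<integral>\<^sup>+y. ?g i (x, y) \<partial>\<mu> x) \<partial>lebesgue)"
  proof (intro nn_integral_monotone_convergence_SUP[symmetric] measurable_section_integral m)
    show "incseq (\<lambda>i x. \<integral>\<^sup>+y. ?g i (x, y) \<partial>\<mu> x)"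
      using inc by (auto simp: incseq_def le_fun_def intro!: nn_integral_mono)
  qed simp
  also have "\<dots> = (\<integral>\<^sup>+x. (\<integral>\<^sup>+y. (SUP i. ?g i (x, y)) \<partial>\<mu> x) \<partial>lebesgue)"
  proof (intro nn_integral_cong nn_integral_monotone_convergence_SUP[symmetric])
    show "incseq (\<lambda>i y. ?g i (x, y))" for x
      using inc by (auto simp: incseq_def le_fun_def)
    show "(\<lambda>y. ?g i (x, y)) \<in> borel_measurable (\<mu> x)" for i x
      using measurable_Pair_borel[OF m] by simp
  qed
  finally show ?case by (simp add: SUP_mult_right_ennreal image_comp)
qed

lemma nn_integral_joint:
  fixes f :: "'a \<times> 'a \<Rightarrow> ennreal"
  assumes "f \<in> borel_measurable borel" and f0: "\<And>x. f (x, x) = 0"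
  shows "(\<integral>\<^sup>+z. f z \<partial>joint \<mu>) = (\<integral>\<^sup>+x. (\<integral>\<^sup>+y. f (x, y) \<partial>\<mu> x) \<partial>lebesgue)"
  unfolding nn_integral_joint_off_diagonal[OF assms(1)]
  by (intro nn_integral_cong) (use f0 in \<open>auto simp: indicator_def\<close>)


lemma emeasure_joint_times:
  assumes [measurable]: "A \<in> sets borel" "B \<in> sets borel" and "A \<inter> B = {}"
  shows "emeasure (joint \<mu>) (A \<times> B) = (\<integral>\<^sup>+x\<in>A. emeasure (\<mu> x) B \<partial>lebesgue)"
proof -
  have AB: "A \<times> B \<in> sets borel"
    by (intro borel_Times assms)
  have "emeasure (joint \<mu>) (A \<times> B) = (\<integral>\<^sup>+z. indicator (A \<times> B) z \<partial>joint \<mu>)"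
    using AB by simp
  also have "\<dots> = (\<integral>\<^sup>+x. (\<integral>\<^sup>+y. indicator (A \<times> B) (x, y) \<partial>\<mu> x) \<partial>lebesgue)"
    using assms(3) AB by (intro nn_integral_joint) (auto simp: indicator_def)
  also have "\<dots> = (\<integral>\<^sup>+x\<in>A. emeasure (\<mu> x) B \<partial>lebesgue)"
  proof (intro nn_integral_cong)
    fix x
    have "(\<integral>\<^sup>+y. indicator (A \<times> B) (x, y) \<partial>\<mu> x) = (\<integral>\<^sup>+y. indicator A x * indicator B y \<partial>\<mu> x)"
      by (intro nn_integral_cong) (auto simp: indicator_def)
    also have "\<dots> = indicator A x * emeasure (\<mu> x) B"
      by (subst nn_integral_cmult_indicator) auto
    finally show "(\<integral>\<^sup>+y. indicator (A \<times> B) (x, y) \<partial>\<mu> x) = emeasure (\<mu> x) B * indicator A x"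
      by (simp add: mult.commute)
  qed
  finally show ?thesis .
qed

lemma emeasure_joint_separated_finite:
  assumes U: "U \<in> sets borel" "V \<in> sets borel" "bounded U" and r: "0 < r"
    and sep: "\<And>x y. x \<in> U \<Longrightarrow> y \<in> V \<Longrightarrow> r \<le> dist x y"
  shows "emeasure (joint \<mu>) (U \<times> V) < \<infinity>"
proof -
  have "U \<inter> V = {}" using sep r by force
  then have "emeasure (joint \<mu>) (U \<times> V) = (\<integral>\<^sup>+x\<in>U. emeasure (\<mu> x) V \<partial>lebesgue)"
    using U by (intro emeasure_joint_times)
  also have "\<dots> \<le> (\<integral>\<^sup>+x\<in>U. ennreal (C * r powr - \<alpha>) \<partial>lebesgue)"
    using sep r by (intro nn_integral_mono) (auto simp: indicator_def intro!: emeasure_mu_far)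
  also have "\<dots> = ennreal (C * r powr - \<alpha>) * emeasure lborel U"
    using U by (simp add: nn_integral_completion nn_integral_cmult_indicator)
  also have "\<dots> < \<infinity>"
    using emeasure_bounded_finite[OF U(3)] by (simp add: ennreal_mult_less_top)
  finally show ?thesis .
qed

lemma emeasure_joint_diagonal: "emeasure (joint \<mu>) {z. fst z = snd z} = 0"
  by (subst emeasure_joint) (auto simp: indicator_def)

text \<open>Each piece of the separated cover has finite mass and the diagonal has none. This is
  what permits Tonelli in \<open>faber_krahn\<close>.\<close>

lemma sigma_finite_joint: "sigma_finite_measure (joint \<mu>)"
proof
  obtain U V :: "nat \<Rightarrow> 'a set" and W r where UV:
    "\<And>n. U n \<in> sets borel" "\<And>n. V n \<in> sets borel" "\<And>n. bounded (U n)" "\<And>n. 0 < r n"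
    "\<And>n x y. x \<in> U n \<Longrightarrow> y \<in> V n \<Longrightarrow> r n \<le> dist x y"
    and W [measurable]: "\<And>n. W n \<in> sets borel" and Wsub: "\<And>n. W n \<subseteq> U n \<times> V n"
    and Wd: "disjoint_family W" and Wun: "(\<Union>n. W n) = {z. fst z \<noteq> snd z}"
    by (rule separated_cover) (rule that)
  let ?A = "insert {z. fst z = snd z} (range W)"
  have "emeasure (joint \<mu>) (W n) < \<infinity>" for n
    using emeasure_mono[OF Wsub[of n], of "joint \<mu>"] emeasure_joint_separated_finite[OF UV(1,2,3,4,5), of n]
    by (simp add: borel_Times UV le_less_trans)
  then show "\<exists>A. countable A \<and> A \<subseteq> sets (joint \<mu>) \<and> \<Union>A = space (joint \<mu>) \<and>
    (\<forall>a\<in>A. emeasure (joint \<mu>) a \<noteq> \<infinity>)"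
    using Wun emeasure_joint_diagonal by (intro exI[of _ ?A]) (auto simp: less_top)
qed

text \<open>Symmetry is given only for disjoint sets. Inside a separated rectangle all subrectangles
  have disjoint sides; they form an intersection-stable generator on which two finite measures
  agree, and the pieces of the cover then add up.\<close>

lemma distr_joint_swap: "distr (joint \<mu>) borel prod.swap = joint \<mu>"
proof (rule measure_eqI)
  obtain U V :: "nat \<Rightarrow> 'a set" and W r where UV:
    "\<And>n. U n \<in> sets borel" "\<And>n. V n \<in> sets borel" "\<And>n. bounded (U n)" "\<And>n. 0 < r n"
    "\<And>n x y. x \<in> U n \<Longrightarrow> y \<in> V n \<Longrightarrow> r n \<le> dist x y"
    and W [measurable]: "\<And>n. W n \<in> sets borel" and Wsub: "\<And>n. W n \<subseteq> U n \<times> V n"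
    and Wd: "disjoint_family W" and Wun: "(\<Union>n. W n) = {z. fst z \<noteq> snd z}"
    by (rule separated_cover) (rule that)
  have rect: "A \<times> B \<in> sets borel" if "A \<in> sets borel" "B \<in> sets borel" for A B :: "'a set"
    using that by (rule borel_Times)
  have sw [measurable]: "prod.swap \<in> (borel :: ('a \<times> 'a) measure) \<rightarrow>\<^sub>M borel"
    by (intro borel_measurable_continuous_onI continuous_intros)
  have swj: "prod.swap \<in> joint \<mu> \<rightarrow>\<^sub>M borel" by simp
  show "sets (distr (joint \<mu>) borel prod.swap) = sets (joint \<mu>)" by simp
  have rect_swap: "emeasure (joint \<mu>) (A \<times> B) = emeasure (joint \<mu>) (B \<times> A)"
    if "A \<in> sets borel" "B \<in> sets borel" "A \<inter> B = {}" for A B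
    using that emeasure_mu_sym[OF that] emeasure_joint_times[of A B] emeasure_joint_times[of B A]
    by (auto simp: Int_commute)
  have piece: "emeasure (joint \<mu>) (prod.swap -` T) = emeasure (joint \<mu>) T"
    if T: "T \<in> sets borel" "T \<subseteq> U n \<times> V n" for T n
  proof -
    let ?M = "density (joint \<mu>) (indicator (U n \<times> V n))"
    let ?N = "distr (density (joint \<mu>) (indicator (V n \<times> U n))) borel prod.swap"
    let ?R = "{a \<times> b | a b. a \<in> sets borel \<and> b \<in> sets borel} :: ('a \<times> 'a) set set"
    have disj: "U n \<inter> V n = {}" using UV(4)[of n] UV(5)[of _ n] by force
    have R: "sets borel = sigma_sets UNIV ?R"
      by (subst borel_prod[symmetric], subst sets_pair_measure) simp
    have MM: "emeasure ?M X = emeasure (joint \<mu>) (U n \<times> V n \<inter> X)" if "X \<in> sets borel" for X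
      using that rect UV by (subst emeasure_density) (auto simp flip: indicator_inter_arith)
    have NN: "emeasure ?N X = emeasure (joint \<mu>) (V n \<times> U n \<inter> prod.swap -` X)" if "X \<in> sets borel" for X
    proof -
      have "prod.swap -` X \<in> sets (borel :: ('a \<times> 'a) measure)"
        using measurable_sets[OF sw that] by simp
      then show ?thesis
        using that rect UV by (subst emeasure_distr) (auto simp: emeasure_density simp flip: indicator_inter_arith)
    qed
    have "?M = ?N"
    proof (rule measure_eqI_generator_eq[of ?R UNIV _ _ "\<lambda>_. UNIV"])
      show "Int_stable ?R" by (rule Int_stable_pair_measure_generator)
      show "sets ?M = sigma_sets UNIV ?R" "sets ?N = sigma_sets UNIV ?R" using R by simp_all
      show "range (\<lambda>_::nat. UNIV) \<subseteq> ?R" 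
        by (auto intro!: exI[of _ "UNIV :: 'a set"])
      show "emeasure ?M UNIV \<noteq> \<infinity>"
        using emeasure_joint_separated_finite[OF UV(1,2,3,4,5)] by (auto simp: MM less_top)
      fix X assume "X \<in> ?R"
      then obtain A B where X: "X = A \<times> B" and AB: "A \<in> sets borel" "B \<in> sets borel" by auto
      have "emeasure ?M X = emeasure (joint \<mu>) ((U n \<inter> A) \<times> (V n \<inter> B))"
        using AB rect by (subst MM) (auto simp: X Times_Int_Times)
      also have "\<dots> = emeasure (joint \<mu>) ((V n \<inter> B) \<times> (U n \<inter> A))"
        using AB UV disj by (intro rect_swap) auto
      also have "\<dots> = emeasure ?N X"
      proof -
        have "V n \<times> U n \<inter> prod.swap -` X = (V n \<inter> B) \<times> (U n \<inter> A)" by (auto simp: X)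
        then show ?thesis using AB rect by (subst NN) (auto simp: X)
      qed
      finally show "emeasure ?M X = emeasure ?N X" .
    qed auto
    then have "emeasure ?M T = emeasure ?N T" by simp
    moreover have "U n \<times> V n \<inter> T = T" "V n \<times> U n \<inter> prod.swap -` T = prod.swap -` T"
      using T(2) by auto
    ultimately show ?thesis using T(1) by (simp add: MM NN)
  qed
  fix S assume "S \<in> sets (distr (joint \<mu>) borel prod.swap)"
  then have S [measurable]: "S \<in> sets borel" by simp
  have split: "emeasure (joint \<mu>) X = (\<Sum>n. emeasure (joint \<mu>) (X \<inter> Y n))"
    if "X \<in> sets borel" "\<And>n. Y n \<in> sets borel" "disjoint_family Y" "(\<Union>n. Y n) = {z. fst z \<noteq> snd z}"
    for X :: "('a \<times> 'a) set" and Y :: "nat \<Rightarrow> ('a \<times> 'a) set"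
  proof -
    have "(\<Sum>n. emeasure (joint \<mu>) (X \<inter> Y n)) = emeasure (joint \<mu>) (\<Union>n. X \<inter> Y n)"
      using that by (intro suminf_emeasure) (auto simp: disjoint_family_on_def)
    also have "(\<Union>n. X \<inter> Y n) = X - {z. fst z = snd z}" using that(4) by auto
    also have "emeasure (joint \<mu>) \<dots> = emeasure (joint \<mu>) X"
      using that emeasure_joint_diagonal
      by (intro emeasure_Diff_null_set) (auto simp: null_sets_def)
    finally show ?thesis ..
  qed
  have SS: "prod.swap -` X \<in> sets borel" if "X \<in> sets borel" for X :: "('a \<times> 'a) set"
    using measurable_sets[OF sw that] by simp
  have "emeasure (distr (joint \<mu>) borel prod.swap) S = emeasure (joint \<mu>) (prod.swap -` S)"
    by (subst emeasure_distr[OF swj]) auto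
  also have "\<dots> = (\<Sum>n. emeasure (joint \<mu>) (prod.swap -` S \<inter> prod.swap -` W n))"
  proof (rule split)
    show "disjoint_family (\<lambda>n. prod.swap -` W n)"
      using Wd unfolding disjoint_family_on_def by (auto 0 0 simp: vimage_Int[symmetric])
    have "(\<Union>n. prod.swap -` W n) = prod.swap -` (\<Union>n. W n)" by auto
    then show "(\<Union>n. prod.swap -` W n) = {z :: 'a \<times> 'a. fst z \<noteq> snd z}" unfolding Wun by auto
  qed (auto intro: SS)
  also have "\<dots> = (\<Sum>n. emeasure (joint \<mu>) (prod.swap -` (S \<inter> W n)))" by (simp add: vimage_Int)
  also have "\<dots> = (\<Sum>n. emeasure (joint \<mu>) (S \<inter> W n))"
    using Wsub by (intro suminf_cong piece) auto
  also have "\<dots> = emeasure (joint \<mu>) S"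
    by (rule split[symmetric]) (auto simp: Wd Wun)
  finally show "emeasure (distr (joint \<mu>) borel prod.swap) S = emeasure (joint \<mu>) S" .
qed

lemma nn_integral_joint_swap:
  fixes f :: "'a \<times> 'a \<Rightarrow> ennreal"
  assumes [measurable]: "f \<in> borel_measurable borel"
  shows "(\<integral>\<^sup>+z. f (snd z, fst z) \<partial>joint \<mu>) = (\<integral>\<^sup>+z. f z \<partial>joint \<mu>)"
proof -
  have sw: "prod.swap \<in> (borel :: ('a \<times> 'a) measure) \<rightarrow>\<^sub>M borel"
    by (intro borel_measurable_continuous_onI continuous_intros)
  have "(\<integral>\<^sup>+z. f z \<partial>joint \<mu>) = (\<integral>\<^sup>+z. f z \<partial>distr (joint \<mu>) borel prod.swap)"
    by (simp add: distr_joint_swap)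
  also have "\<dots> = (\<integral>\<^sup>+z. f (prod.swap z) \<partial>joint \<mu>)"
    by (rule nn_integral_distr) (use sw in auto)
  finally show ?thesis by (simp add: prod.swap_def)
qed

text \<open>Symmetry, applied to \<open>N\<close> and its complement, turns the mass that points
  outside \<open>N\<close> send into \<open>N\<close> into an integral over \<open>N\<close>, which
  is zero. This is what makes a change of \<open>u\<close> on a null set invisible to the
  form.\<close>

lemma null_set_mu:
  assumes N: "N \<in> null_sets lborel"
  shows "AE x in lebesgue. emeasure (\<mu> x) N = 0"
proof -
  have Nb [measurable]: "N \<in> sets borel" using N by auto
  have [measurable]: "N \<in> sets lebesgue" by simp
  have NL: "AE x in lebesgue. x \<notin> N" using AE_completion[OF AE_not_in[OF N]] .
  have "(\<integral>\<^sup>+x\<in>-N. emeasure (\<mu> x) N \<partial>lebesgue) = (\<integral>\<^sup>+x\<in>N. emeasure (\<mu> x) (-N) \<partial>lebesgue)"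
    by (intro emeasure_mu_sym) auto
  also have "\<dots> = 0"
    using NL emeasure_mu_measurable[of "-N"] by (subst nn_integral_0_iff_AE) auto
  finally have "AE x in lebesgue. emeasure (\<mu> x) N * indicator (-N) x = 0"
    using emeasure_mu_measurable[of N] by (subst (asm) nn_integral_0_iff_AE) auto
  then show ?thesis using NL by eventually_elim (auto simp: indicator_def)
qed

section \<open>Second moments and iterated integrals\<close>

lemmas carre_const_pos = carre_const_positive[OF alpha_less C_ge]

text \<open>Nested exteriors of balls with radii \<open>s / 2 ^ Suc k\<close>, weighted by
  \<open>(1/4) ^ k\<close>, dominate the integrand. Their masses grow like
  \<open>2 powr (\<alpha> * k)\<close>, which the weights beat since \<alpha> < 2.\<close>

lemma truncated_second_moment:
  assumes s: "0 < s"
  shows "(\<integral>\<^sup>+y. ennreal (min 1 ((dist x y / s)\<^sup>2)) \<partial>\<mu> x) \<le> ennreal (carre_const \<alpha> C * s powr - \<alpha>)"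
proof -
  define A where "A k = {y. s / 2 ^ Suc k \<le> dist x y}" for k
  define q where "q = 2 powr (\<alpha> - 2)"
  have q: "0 < q" "q < 1"
    using powr_less_mono[of "\<alpha> - 2" 0 2] alpha_less by (auto simp: q_def)
  have A [measurable]: "A k \<in> sets borel" for k unfolding A_def by measurable
  have pt: "ennreal (min 1 ((dist x y / s)\<^sup>2)) \<le> (\<Sum>k. ennreal ((1/4) ^ k) * indicator (A k) y)" for y
  proof (cases "x = y")
    case False
    have ex: "\<exists>k. s / 2 ^ Suc k \<le> dist x y"
    proof -
      obtain n where "(1/2) ^ n < dist x y / s"
        using real_arch_pow_inv[of "dist x y / s" "1/2"] False s by auto
      then have "s / 2 ^ n < dist x y" using s by (simp add: field_simps power_one_over)
      moreover have "s / 2 ^ Suc n \<le> s / 2 ^ n" using s by (simp add: field_simps)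
      ultimately show ?thesis by (intro exI[of _ n]) linarith
    qed
    \<comment> \<open>The first exterior containing \<open>y\<close>. Failure at the preceding index
      gives \<open>dist x y < s / 2 ^ k\<close>, hence the weight \<open>(1/4) ^ k\<close>; for
      \<open>k = 0\<close> the truncation at 1 suffices.\<close>
    define k where "k = (LEAST k. s / 2 ^ Suc k \<le> dist x y)"
    have k: "s / 2 ^ Suc k \<le> dist x y" unfolding k_def by (rule LeastI_ex[OF ex])
    have "min 1 ((dist x y / s)\<^sup>2) \<le> (1/4) ^ k"
    proof (cases k)
      case (Suc j)
      have "\<not> s / 2 ^ Suc j \<le> dist x y"
        by (rule not_less_Least[of j "\<lambda>k. s / 2 ^ Suc k \<le> dist x y", folded k_def]) (simp add: Suc)
      then have "dist x y / s \<le> (1/2) ^ k" using s by (simp add: field_simps power_one_over Suc)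
      then have "(dist x y / s)\<^sup>2 \<le> ((1/2) ^ k)\<^sup>2" using s by (intro power_mono) auto
      also have "\<dots> = (1/4) ^ k" by (simp add: power2_eq_square flip: power_mult_distrib)
      finally show ?thesis by simp
    qed simp
    then have "ennreal (min 1 ((dist x y / s)\<^sup>2)) \<le> (\<Sum>i\<in>{k}. ennreal ((1/4) ^ i) * indicator (A i) y)"
      using k by (simp add: A_def ennreal_leI)
    also have "\<dots> \<le> (\<Sum>k. ennreal ((1/4) ^ k) * indicator (A k) y)"
      by (rule sum_le_suminf) auto
    finally show ?thesis .
  qed simp
  have coeff: "ennreal ((1/4) ^ k) * emeasure (\<mu> x) (A k) \<le> ennreal (C * 2 powr \<alpha> * s powr - \<alpha> * q ^ k)" for k
  proof -
    have "ennreal ((1/4) ^ k) * emeasure (\<mu> x) (A k) \<le> ennreal ((1/4) ^ k) * ennreal (C * (s / 2 ^ Suc k) powr - \<alpha>)"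
      using s by (intro mult_left_mono emeasure_mu_far) (auto simp: A_def)
    also have "\<dots> = ennreal ((1/4) ^ k * (C * (s / 2 ^ Suc k) powr - \<alpha>))"
      by (rule ennreal_mult''[symmetric]) (use C_ge in auto)
    also have "(1/4) ^ k * (C * (s / 2 ^ Suc k) powr - \<alpha>) = C * 2 powr \<alpha> * s powr - \<alpha> * q ^ k"
    proof -
      have "(2::real) ^ Suc k = 2 powr (1 + real k)" by (simp add: powr_add powr_realpow)
      then have "(s / 2 ^ Suc k) powr - \<alpha> = s powr - \<alpha> * 2 powr (\<alpha> * (1 + real k))"
        using s by (simp add: powr_divide powr_powr powr_minus field_simps)
      moreover have "(1/4::real) ^ k = 2 powr (- 2 * real k)"
      proof -
        have "(2::real) powr (- 2 * real k) = (2 powr - 2) powr real k" by (simp only: powr_powr)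
        also have "(2::real) powr - 2 = 1/4" by (simp add: powr_minus powr_numeral)
        finally show ?thesis by (simp add: powr_realpow)
      qed
      moreover have "q ^ k = 2 powr ((\<alpha> - 2) * real k)"
        unfolding q_def by (simp add: powr_realpow[symmetric] powr_powr)
      moreover have "2 powr (- 2 * real k) * 2 powr (\<alpha> * (1 + real k)) = 2 powr \<alpha> * (2 powr ((\<alpha> - 2) * real k) :: real)"
        by (simp add: powr_add[symmetric] algebra_simps)
      ultimately show ?thesis by (simp add: algebra_simps)
    qed
    finally show ?thesis .
  qed
  have "(\<integral>\<^sup>+y. ennreal (min 1 ((dist x y / s)\<^sup>2)) \<partial>\<mu> x) \<le>
     (\<integral>\<^sup>+y. (\<Sum>k. ennreal ((1/4) ^ k) * indicator (A k) y) \<partial>\<mu> x)"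
    by (intro nn_integral_mono pt)
  also have "\<dots> = (\<Sum>k. \<integral>\<^sup>+y. ennreal ((1/4) ^ k) * indicator (A k) y \<partial>\<mu> x)"
    by (rule nn_integral_suminf) simp
  also have "\<dots> = (\<Sum>k. ennreal ((1/4) ^ k) * emeasure (\<mu> x) (A k))"
    by (simp add: nn_integral_cmult_indicator)
  also have "\<dots> \<le> (\<Sum>k. ennreal (C * 2 powr \<alpha> * s powr - \<alpha> * q ^ k))"
    by (intro suminf_le coeff) auto
  also have "\<dots> = ennreal (\<Sum>k. C * 2 powr \<alpha> * s powr - \<alpha> * q ^ k)"
    using q C_ge by (intro suminf_ennreal2 summable_mult summable_geometric) auto
  also have "(\<Sum>k. C * 2 powr \<alpha> * s powr - \<alpha> * q ^ k) = carre_const \<alpha> C * s powr - \<alpha>"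
    using q by (subst suminf_mult) (auto simp: suminf_geometric carre_const_def q_def)
  finally show ?thesis .
qed

text \<open>Positive and negative parts are treated separately. The sections that are not
  integrable, where the inner integral is a default value, form a null set. The iterated side has
  the shape in which \<open>energy_form\<close> is defined.\<close>

lemma integral_joint:
  fixes F :: "'a \<times> 'a \<Rightarrow> real"
  assumes F: "integrable (joint \<mu>) F" and F0: "\<And>x. F (x, x) = 0"
  shows "(LINT x|lebesgue. (LINT y|\<mu> x. F (x, y))) = (LINT z|joint \<mu>. F z)"
proof -
  have Fm [measurable]: "F \<in> borel_measurable borel"
    using borel_measurable_integrable[OF F] by simp
  define P where "P x = (\<integral>\<^sup>+y. ennreal (F (x, y)) \<partial>\<mu> x)" for x
  define Q where "Q x = (\<integral>\<^sup>+y. ennreal (- F (x, y)) \<partial>\<mu> x)" for x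
  have [measurable]: "P \<in> borel_measurable lebesgue" "Q \<in> borel_measurable lebesgue"
    unfolding P_def Q_def
    by (rule measurable_section_integral[where f = "\<lambda>z. ennreal (F z)"] 
        measurable_section_integral[where f = "\<lambda>z. ennreal (- F z)"]; use F0 in simp)+
  have P: "(\<integral>\<^sup>+x. P x \<partial>lebesgue) = (\<integral>\<^sup>+z. ennreal (F z) \<partial>joint \<mu>)"
    and Q: "(\<integral>\<^sup>+x. Q x \<partial>lebesgue) = (\<integral>\<^sup>+z. ennreal (- F z) \<partial>joint \<mu>)"
    unfolding P_def Q_def
    by (subst nn_integral_joint; use F0 in simp)+
  have fin: "(\<integral>\<^sup>+x. P x \<partial>lebesgue) < \<infinity>" "(\<integral>\<^sup>+x. Q x \<partial>lebesgue) < \<infinity>"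
    using F unfolding P Q real_integrable_def by (auto simp: less_top)
  have PA: "AE x in lebesgue. P x \<noteq> \<infinity>" "AE x in lebesgue. Q x \<noteq> \<infinity>"
    using fin by (auto simp del: infinity_ennreal_def intro!: nn_integral_PInf_AE)
  have intg: "integrable lebesgue (\<lambda>x. enn2real (P x))" "integrable lebesgue (\<lambda>x. enn2real (Q x))"
  proof -
    have "(\<integral>\<^sup>+x. ennreal (enn2real (P x)) \<partial>lebesgue) = (\<integral>\<^sup>+x. P x \<partial>lebesgue)"
      using PA(1) by (intro nn_integral_cong_AE) (auto simp: less_top)
    moreover have "(\<integral>\<^sup>+x. ennreal (enn2real (Q x)) \<partial>lebesgue) = (\<integral>\<^sup>+x. Q x \<partial>lebesgue)"
      using PA(2) by (intro nn_integral_cong_AE) (auto simp: less_top)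
    ultimately show "integrable lebesgue (\<lambda>x. enn2real (P x))" "integrable lebesgue (\<lambda>x. enn2real (Q x))"
      using fin by (auto intro!: integrableI_bounded)
  qed
  have e: "(LINT x|lebesgue. enn2real (P x)) = enn2real (\<integral>\<^sup>+x. P x \<partial>lebesgue)"
    "(LINT x|lebesgue. enn2real (Q x)) = enn2real (\<integral>\<^sup>+x. Q x \<partial>lebesgue)"
    using PA by (auto simp: integral_eq_nn_integral less_top intro!: arg_cong[where f = enn2real] nn_integral_cong_AE)
  have "(LINT x|lebesgue. (LINT y|\<mu> x. F (x, y))) = (LINT x|lebesgue. enn2real (P x) - enn2real (Q x))"
  proof (rule integral_completion_cong_AE)
    show "AE x in lborel. (LINT y|\<mu> x. F (x, y)) = enn2real (P x) - enn2real (Q x)"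
      using PA[unfolded AE_completion_iff]
    proof eventually_elim
      case (elim x)
      have "integrable (\<mu> x) (\<lambda>y. F (x, y))"
        using elim measurable_Pair_borel[OF Fm, of x] by (auto simp: real_integrable_def P_def Q_def)
      then show ?case by (simp add: real_lebesgue_integral_def P_def Q_def)
    qed
  qed
  also have "\<dots> = enn2real (\<integral>\<^sup>+x. P x \<partial>lebesgue) - enn2real (\<integral>\<^sup>+x. Q x \<partial>lebesgue)"
    using intg by (simp add: e)
  also have "\<dots> = (LINT z|joint \<mu>. F z)"
    using F by (simp add: P Q real_lebesgue_integral_def)
  finally show ?thesis .
qed

end

section \<open>Supersolutions\<close>

lemma measurable_fst_snd_borel [measurable]:
  "fst \<in> (borel :: ('a::euclidean_space \<times> 'b::euclidean_space) measure) \<rightarrow>\<^sub>M borel"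
  "snd \<in> (borel :: ('a::euclidean_space \<times> 'b::euclidean_space) measure) \<rightarrow>\<^sub>M borel"
  by (intro borel_measurable_continuous_onI continuous_intros)+

lemma borel_measurable_lebesgue_on:
  assumes "f \<in> borel_measurable borel"
  shows "f \<in> borel_measurable (lebesgue_on D)"
  using assms by (intro measurable_restrict_space1 measurable_completion) simp

text \<open>On the joint measure, the form of the paper is the integral of this function over pairs \<open>(x, y)\<close>.\<close>

definition increment_product :: "('a \<Rightarrow> real) \<Rightarrow> ('a \<Rightarrow> real) \<Rightarrow> 'a \<times> 'a \<Rightarrow> real" where
  "increment_product u v z = (u (snd z) - u (fst z)) * (v (snd z) - v (fst z))"

lemma increment_product_measurable [measurable]:
  fixes u v :: "'a::euclidean_space \<Rightarrow> real"
  assumes [measurable]: "u \<in> borel_measurable borel" "v \<in> borel_measurable borel"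
  shows "increment_product u v \<in> borel_measurable borel"
  unfolding increment_product_def by measurable

lemma increment_product_self: "increment_product u u z = (u (snd z) - u (fst z))\<^sup>2"
  by (simp add: increment_product_def power2_eq_square)

text \<open>Almost every \<open>x\<close> replaces the supremum over all \<open>x\<close>: a Borel
  representative agrees with \<open>u\<close> almost everywhere under \<open>\<mu> x\<close> only
  for almost every \<open>x\<close>, so only this form survives the replacement.\<close>

definition tail_finite :: "('a::euclidean_space \<Rightarrow> 'a measure) \<Rightarrow> 'a set \<Rightarrow> ('a \<Rightarrow> real) \<Rightarrow> bool" where
  "tail_finite \<mu> E u \<longleftrightarrow> (\<forall>x\<^sub>0 R. 0 < R \<and> ball x\<^sub>0 R \<subseteq> E \<longrightarrow>
     (\<exists>T. AE x in lborel. x \<in> ball x\<^sub>0 (7/8 * R) \<longrightarrow>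
        (\<integral>\<^sup>+y\<in>- ball x\<^sub>0 R. ennreal \<bar>u y\<bar> \<partial>\<mu> x) \<le> ennreal T))"

text \<open>Integrability is a premise because it ensures that the integral over pairs agrees with
  the iterated one in \<open>energy_form\<close>; \<open>energy_estimate\<close> verifies it for its
  test functions.\<close>

definition borel_supersolution ::
  "('a::euclidean_space \<Rightarrow> 'a measure) \<Rightarrow> 'a set \<Rightarrow> ('a \<Rightarrow> real) \<Rightarrow> bool" where
  "borel_supersolution \<mu> E u \<longleftrightarrow>
     u \<in> borel_measurable borel \<and> u \<in> H_loc \<mu> E \<and> tail_finite \<mu> E u \<and>
     (\<forall>\<phi>\<in>test_functions \<mu> E. \<phi> \<in> borel_measurable borel \<longrightarrow>
        integrable (joint \<mu>) (increment_product u \<phi>) \<longrightarrow>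
        0 \<le> (LINT z|joint \<mu>. increment_product u \<phi> z))"

context symmetric_decay_kernel
begin

lemma AE_mu:
  assumes "AE x in lborel. P x"
  shows "AE x in lborel. AE y in \<mu> x. P y"
proof -
  obtain N where N: "N \<in> null_sets lborel" "{x. \<not> P x} \<subseteq> N"
    using assms unfolding eventually_ae_filter by auto
  have "AE x in lborel. emeasure (\<mu> x) N = 0"
    using null_set_mu[OF N(1)] by (simp add: AE_completion_iff)
  then show ?thesis
  proof eventually_elim
    case (elim x)
    then have "N \<in> null_sets (\<mu> x)" using N by (auto simp: null_sets_def)
    from AE_not_in[OF this] show ?case by eventually_elim (use N(2) in auto)
  qed
qed

lemma energy_joint:
  assumes [measurable]: "v \<in> borel_measurable borel" "D \<in> sets borel"
  shows "energy \<mu> D v = (\<integral>\<^sup>+z\<in>D \<times> D. ennreal (increment_product v v z) \<partial>joint \<mu>)"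
proof -
  have [measurable]: "D \<times> D \<in> sets borel" by (rule borel_Times) simp_all
  have "(\<integral>\<^sup>+z\<in>D \<times> D. ennreal (increment_product v v z) \<partial>joint \<mu>) =
    (\<integral>\<^sup>+x. (\<integral>\<^sup>+y. ennreal (increment_product v v (x, y)) * indicator (D \<times> D) (x, y) \<partial>\<mu> x) \<partial>lebesgue)"
    by (rule nn_integral_joint) (simp_all add: increment_product_def)
  also have "\<dots> = energy \<mu> D v"
    unfolding energy_def nn_integral_completion
  proof (intro nn_integral_cong)
    fix x
    show "(\<integral>\<^sup>+y. ennreal (increment_product v v (x, y)) * indicator (D \<times> D) (x, y) \<partial>\<mu> x) =
      (\<integral>\<^sup>+y\<in>D. ennreal ((v y - v x)\<^sup>2) \<partial>\<mu> x) * indicator D x"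
      by (cases "x \<in> D") (auto simp: indicator_def increment_product_self intro!: nn_integral_cong)
  qed
  finally show ?thesis ..
qed

lemma energy_cong_AE:
  assumes eq: "AE x in lborel. u x = v x"
  shows "energy \<mu> D u = energy \<mu> D v"
  unfolding energy_def nn_integral_completion
proof (rule nn_integral_cong_AE)
  show "AE x in lborel. (\<integral>\<^sup>+y\<in>D. ennreal ((u y - u x)\<^sup>2) \<partial>\<mu> x) * indicator D x =
    (\<integral>\<^sup>+y\<in>D. ennreal ((v y - v x)\<^sup>2) \<partial>\<mu> x) * indicator D x"
    using eq AE_mu[OF eq]
  proof eventually_elim
    case (elim x)
    have "(\<integral>\<^sup>+y\<in>D. ennreal ((u y - u x)\<^sup>2) \<partial>\<mu> x) = (\<integral>\<^sup>+y\<in>D. ennreal ((v y - v x)\<^sup>2) \<partial>\<mu> x)"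
    proof (rule nn_integral_cong_AE)
      show "AE y in \<mu> x. ennreal ((u y - u x)\<^sup>2) * indicator D y = ennreal ((v y - v x)\<^sup>2) * indicator D y"
        using elim(2) by eventually_elim (simp add: elim(1))
    qed
    then show ?case by simp
  qed
qed

lemma H_loc_cong_AE:
  assumes u: "u \<in> H_loc \<mu> E" and [measurable]: "v \<in> borel_measurable borel"
    and eq: "AE x in lborel. u x = v x"
  shows "v \<in> H_loc \<mu> E"
proof -
  have "square_integrable_on v D \<and> energy \<mu> D v < \<infinity>" if D: "open D" "closure D \<subseteq> E" for D
  proof
    have u': "square_integrable_on u D" "energy \<mu> D u < \<infinity>" using u D by (auto simp: H_loc_def)
    have "(\<integral>\<^sup>+x\<in>D. ennreal ((v x)\<^sup>2) \<partial>lborel) = (\<integral>\<^sup>+x\<in>D. ennreal ((u x)\<^sup>2) \<partial>lborel)"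
      using eq by (intro nn_integral_cong_AE) auto
    then show "square_integrable_on v D"
      using u'(1) by (simp add: square_integrable_on_def nn_integral_completion borel_measurable_lebesgue_on)
    show "energy \<mu> D v < \<infinity>" using u'(2) energy_cong_AE[OF eq] by simp
  qed
  then show ?thesis by (simp add: H_loc_def)
qed

text \<open>Increments grow at most by the factor \<open>L\<close>. Since \<open>f 0\<close> may be
  non-zero, boundedness of \<open>E\<close> is used to make constants square integrable.\<close>

lemma H_loc_lipschitz:
  assumes u: "u \<in> H_loc \<mu> E" and [measurable]: "u \<in> borel_measurable borel" "f \<in> borel_measurable borel"
    and lip: "\<And>s t. \<bar>f s - f t\<bar> \<le> L * \<bar>s - t\<bar>" and E: "bounded E"
  shows "(\<lambda>x. f (u x)) \<in> H_loc \<mu> E"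
proof -
  have L: "0 \<le> L" using lip[of 1 0] by simp
  have "square_integrable_on (\<lambda>x. f (u x)) D \<and> energy \<mu> D (\<lambda>x. f (u x)) < \<infinity>"
    if D: "open D" "closure D \<subseteq> E" for D
  proof
    have u': "square_integrable_on u D" "energy \<mu> D u < \<infinity>" using u D by (auto simp: H_loc_def)
    have [measurable]: "D \<in> sets borel" "D \<times> D \<in> sets borel" using D by (auto intro!: borel_Times)
    have "bounded D" by (rule bounded_subset[OF E order_trans[OF closure_subset D(2)]])
    then have Df: "emeasure lborel D < \<infinity>" by (rule emeasure_bounded_finite)
    have pt: "ennreal ((f t)\<^sup>2) \<le> ennreal (2 * L\<^sup>2) * ennreal (t\<^sup>2) + ennreal (2 * (f 0)\<^sup>2)" for t
    proof -
      have "\<bar>f t\<bar> \<le> L * \<bar>t\<bar> + \<bar>f 0\<bar>" using lip[of t 0] by simp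
      then have "\<bar>f t\<bar>\<^sup>2 \<le> (L * \<bar>t\<bar> + \<bar>f 0\<bar>)\<^sup>2" by (intro power_mono) auto
      also have "\<dots> \<le> 2 * (L * \<bar>t\<bar>)\<^sup>2 + 2 * \<bar>f 0\<bar>\<^sup>2"
        using sum_squares_bound[of "L * \<bar>t\<bar>" "\<bar>f 0\<bar>"] by (simp add: power2_sum)
      finally have "(f t)\<^sup>2 \<le> (2 * L\<^sup>2) * t\<^sup>2 + 2 * (f 0)\<^sup>2" by (simp add: power_mult_distrib)
      then show ?thesis by (simp flip: ennreal_mult'' ennreal_plus add: ennreal_leI)
    qed
    have "(\<integral>\<^sup>+x\<in>D. ennreal ((f (u x))\<^sup>2) \<partial>lborel) \<le>
       (\<integral>\<^sup>+x. ennreal (2 * L\<^sup>2) * (ennreal ((u x)\<^sup>2) * indicator D x) + ennreal (2 * (f 0)\<^sup>2) * indicator D x \<partial>lborel)"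
      using pt by (intro nn_integral_mono) (auto simp: indicator_def)
    also have "\<dots> = ennreal (2 * L\<^sup>2) * (\<integral>\<^sup>+x\<in>D. ennreal ((u x)\<^sup>2) \<partial>lborel) + ennreal (2 * (f 0)\<^sup>2) * emeasure lborel D"
      by (simp add: nn_integral_add nn_integral_cmult nn_integral_cmult_indicator)
    also have "\<dots> < \<infinity>"
      using u'(1) Df by (auto simp: square_integrable_on_def nn_integral_completion ennreal_mult_less_top)
    finally show "square_integrable_on (\<lambda>x. f (u x)) D"
      by (simp add: square_integrable_on_def nn_integral_completion borel_measurable_lebesgue_on)
    have "increment_product (\<lambda>x. f (u x)) (\<lambda>x. f (u x)) z \<le> L\<^sup>2 * increment_product u u z" for z
      using power_mono[OF lip[of "u (snd z)" "u (fst z)"], of 2]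
      by (simp add: increment_product_self power_mult_distrib)
    then have "energy \<mu> D (\<lambda>x. f (u x)) \<le>
      (\<integral>\<^sup>+z. ennreal (L\<^sup>2) * (ennreal (increment_product u u z) * indicator (D \<times> D) z) \<partial>joint \<mu>)"
      by (subst energy_joint) (auto intro!: nn_integral_mono ennreal_leI simp: indicator_def simp flip: ennreal_mult')
    also have "\<dots> = ennreal (L\<^sup>2) * energy \<mu> D u"
      by (simp add: energy_joint nn_integral_cmult)
    also have "\<dots> < \<infinity>" using u'(2) by (simp add: ennreal_mult_less_top)
    finally show "energy \<mu> D (\<lambda>x. f (u x)) < \<infinity>" .
  qed
  then show ?thesis by (simp add: H_loc_def)
qed

lemma emeasure_mu_ball_complement:
  assumes "x \<in> ball x\<^sub>0 r" "r < R"
  shows "emeasure (\<mu> x) (- ball x\<^sub>0 R) \<le> ennreal (C * (R - r) powr - \<alpha>)"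
proof (rule emeasure_mu_far)
  fix y assume "y \<in> - ball x\<^sub>0 R"
  then show "R - r \<le> dist x y" using assms dist_triangle[of x\<^sub>0 y x] by auto
qed (use assms in auto)

lemma admissible_borel_tail:
  assumes adm: "admissible \<mu> E u" and [measurable]: "v \<in> borel_measurable borel"
    and eq: "AE x in lborel. u x = v x"
  shows "tail_finite \<mu> E v"
  unfolding tail_finite_def
proof (intro allI impI)
  fix x\<^sub>0 R assume "0 < R \<and> ball x\<^sub>0 R \<subseteq> E"
  then have fin: "(SUP x\<in>ball x\<^sub>0 (7/8 * R). \<integral>\<^sup>+y\<in>- ball x\<^sub>0 R. ennreal \<bar>u y\<bar> \<partial>\<mu> x) < \<infinity>" (is "?S < _")
    using adm unfolding admissible_def nn_integral_completion by blast
  have "AE x in lborel. x \<in> ball x\<^sub>0 (7/8 * R) \<longrightarrow>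
        (\<integral>\<^sup>+y\<in>- ball x\<^sub>0 R. ennreal \<bar>v y\<bar> \<partial>\<mu> x) \<le> ennreal (enn2real ?S)"
    using AE_mu[OF eq]
  proof (eventually_elim, intro impI)
    fix x assume elim: "AE y in \<mu> x. u y = v y" "x \<in> ball x\<^sub>0 (7/8 * R)"
    have "(\<integral>\<^sup>+y\<in>- ball x\<^sub>0 R. ennreal \<bar>v y\<bar> \<partial>\<mu> x) = (\<integral>\<^sup>+y\<in>- ball x\<^sub>0 R. ennreal \<bar>u y\<bar> \<partial>\<mu> x)"
      using elim(1) by (intro nn_integral_cong_AE) auto
    also have "\<dots> \<le> ?S" using elim(2) by (rule SUP_upper)
    finally show "(\<integral>\<^sup>+y\<in>- ball x\<^sub>0 R. ennreal \<bar>v y\<bar> \<partial>\<mu> x) \<le> ennreal (enn2real ?S)"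
      using fin by simp
  qed
  then show "\<exists>T. AE x in lborel. x \<in> ball x\<^sub>0 (7/8 * R) \<longrightarrow>
        (\<integral>\<^sup>+y\<in>- ball x\<^sub>0 R. ennreal \<bar>v y\<bar> \<partial>\<mu> x) \<le> ennreal T" by blast
qed

text \<open>The additive constant contributes its size times the mass of the exterior, which is
  finite because points of \<open>ball x\<^sub>0 (7/8 * R)\<close> keep distance \<open>R/8\<close>
  from it.\<close>

lemma tail_finite_affine:
  assumes fin: "tail_finite \<mu> E u" and [measurable]: "u \<in> borel_measurable borel"
    and eq: "AE x in lborel. v x = a * u x + b"
  shows "tail_finite \<mu> E v"
  unfolding tail_finite_def
proof (intro allI impI)
  fix x\<^sub>0 R assume R: "0 < R \<and> ball x\<^sub>0 R \<subseteq> E"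
  then obtain T where T: "AE x in lborel. x \<in> ball x\<^sub>0 (7/8 * R) \<longrightarrow>
        (\<integral>\<^sup>+y\<in>- ball x\<^sub>0 R. ennreal \<bar>u y\<bar> \<partial>\<mu> x) \<le> ennreal T"
    using fin unfolding tail_finite_def by blast
  define T' where "T' = \<bar>a\<bar> * max 0 T + \<bar>b\<bar> * (C * (R - 7/8 * R) powr - \<alpha>)"
  have "AE x in lborel. x \<in> ball x\<^sub>0 (7/8 * R) \<longrightarrow>
        (\<integral>\<^sup>+y\<in>- ball x\<^sub>0 R. ennreal \<bar>v y\<bar> \<partial>\<mu> x) \<le> ennreal T'"
    using AE_mu[OF eq] T
  proof (eventually_elim, intro impI)
    fix x assume elim: "AE y in \<mu> x. v y = a * u y + b"
      "x \<in> ball x\<^sub>0 (7/8 * R) \<longrightarrow> (\<integral>\<^sup>+y\<in>- ball x\<^sub>0 R. ennreal \<bar>u y\<bar> \<partial>\<mu> x) \<le> ennreal T"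
      "x \<in> ball x\<^sub>0 (7/8 * R)"
    let ?B = "- ball x\<^sub>0 R"
    have "(\<integral>\<^sup>+y\<in>?B. ennreal \<bar>v y\<bar> \<partial>\<mu> x) \<le>
      (\<integral>\<^sup>+y. ennreal \<bar>a\<bar> * (ennreal \<bar>u y\<bar> * indicator ?B y) + ennreal \<bar>b\<bar> * indicator ?B y \<partial>\<mu> x)"
    proof (rule nn_integral_mono_AE)
      show "AE y in \<mu> x. ennreal \<bar>v y\<bar> * indicator ?B y \<le>
        ennreal \<bar>a\<bar> * (ennreal \<bar>u y\<bar> * indicator ?B y) + ennreal \<bar>b\<bar> * indicator ?B y"
        using elim(1)
      proof eventually_elim
        case (elim y)
        have "ennreal \<bar>v y\<bar> \<le> ennreal \<bar>a\<bar> * ennreal \<bar>u y\<bar> + ennreal \<bar>b\<bar>"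
          using abs_triangle_ineq[of "a * u y" b]
          by (simp add: elim abs_mult ennreal_leI flip: ennreal_mult'' ennreal_plus)
        then show ?case by (simp add: indicator_def)
      qed
    qed
    also have "\<dots> = ennreal \<bar>a\<bar> * (\<integral>\<^sup>+y\<in>?B. ennreal \<bar>u y\<bar> \<partial>\<mu> x) + ennreal \<bar>b\<bar> * emeasure (\<mu> x) ?B"
      by (simp add: nn_integral_add nn_integral_cmult nn_integral_cmult_indicator)
    also have "\<dots> \<le> ennreal \<bar>a\<bar> * ennreal (max 0 T) + ennreal \<bar>b\<bar> * ennreal (C * (R - 7/8 * R) powr - \<alpha>)"
      using elim(2,3) R 
      by (intro add_mono mult_left_mono emeasure_mu_ball_complement) 
         (auto simp: ennreal_max_0 intro: order_trans)
    also have "\<dots> = ennreal T'"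
      using C_ge by (simp add: T'_def flip: ennreal_mult'' ennreal_plus)
    finally show "(\<integral>\<^sup>+y\<in>?B. ennreal \<bar>v y\<bar> \<partial>\<mu> x) \<le> ennreal T'" .
  qed
  then show "\<exists>T. AE x in lborel. x \<in> ball x\<^sub>0 (7/8 * R) \<longrightarrow>
        (\<integral>\<^sup>+y\<in>- ball x\<^sub>0 R. ennreal \<bar>v y\<bar> \<partial>\<mu> x) \<le> ennreal T" by blast
qed

text \<open>For a solution the form vanishes on every test function, so \<open>a\<close> may have
  either sign: both \<open>u - m\<close> and \<open>M - u\<close> yield supersolutions. The relation
  between \<open>v\<close> and \<open>w\<close> holds only almost everywhere so that later a
  multiple of \<open>u - m\<close> can be made non-negative at every point of a ball.\<close>

lemma weak_solution_affine_supersolution: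
  assumes sol: "weak_solution \<mu> E u" and E: "bounded E"
    and w [measurable]: "w \<in> borel_measurable borel" and uw: "AE x in lborel. u x = w x"
    and v [measurable]: "v \<in> borel_measurable borel" and vw: "AE x in lborel. v x = a * w x + b"
  shows "borel_supersolution \<mu> E v"
proof -
  have test: "energy_form \<mu> UNIV u \<phi> = 0" if "\<phi> \<in> test_functions \<mu> E" for \<phi>
    using sol that by (auto simp: weak_solution_def weak_subsolution_def weak_supersolution_def intro: antisym)
  have adm: "admissible \<mu> E u" using sol by (simp add: weak_solution_def weak_subsolution_def)
  have wH: "w \<in> H_loc \<mu> E"
    using adm by (intro H_loc_cong_AE[OF _ w uw]) (simp add: admissible_def)
  have "(\<lambda>x. a * w x + b) \<in> H_loc \<mu> E"
    by (rule H_loc_lipschitz[OF wH, where f = "\<lambda>t. a * t + b" and L = "\<bar>a\<bar>"])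
      (simp_all add: E abs_mult flip: right_diff_distrib)
  moreover have vw': "AE x in lborel. a * w x + b = v x" using vw by eventually_elim simp
  ultimately have vH: "v \<in> H_loc \<mu> E" using H_loc_cong_AE v by blast
  have tail: "tail_finite \<mu> E v"
    by (rule tail_finite_affine[OF admissible_borel_tail[OF adm w uw] w vw])
  have "AE x in lborel. v x = a * u x + b" using uw vw by eventually_elim simp
  note vu = this AE_mu[OF this]
  have "(LINT z|joint \<mu>. increment_product v \<phi> z) = 0"
    if \<phi>: "\<phi> \<in> test_functions \<mu> E" and [measurable]: "\<phi> \<in> borel_measurable borel"
      and int: "integrable (joint \<mu>) (increment_product v \<phi>)" for \<phi>
  proof -
    have "(LINT z|joint \<mu>. increment_product v \<phi> z) =
        (LINT x|lebesgue. (LINT y|\<mu> x. increment_product v \<phi> (x, y)))"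
      by (rule integral_joint[OF int, symmetric]) (simp add: increment_product_def)
    \<comment> \<open>Measurability in \<open>x\<close> of the inner integral of \<open>u\<close> is
      not at hand here, so the outer integrands are exchanged by the congruence that assumes
      none.\<close>
    also have "\<dots> = (LINT x|lebesgue. a * (LINT y|completion (\<mu> x). (u y - u x) * (\<phi> y - \<phi> x)))"
    proof (rule integral_completion_cong_AE)
      show "AE x in lborel. (LINT y|\<mu> x. increment_product v \<phi> (x, y)) =
        a * (LINT y|completion (\<mu> x). (u y - u x) * (\<phi> y - \<phi> x))"
        using vu
      proof eventually_elim
        case (elim x)
        have "(LINT y|\<mu> x. increment_product v \<phi> (x, y)) = (LINT y|completion (\<mu> x). increment_product v \<phi> (x, y))"
          by (rule integral_completion[symmetric]) (simp add: increment_product_def)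
        also have "\<dots> = (LINT y|completion (\<mu> x). a * ((u y - u x) * (\<phi> y - \<phi> x)))"
        proof (rule integral_completion_cong_AE)
          show "AE y in \<mu> x. increment_product v \<phi> (x, y) = a * ((u y - u x) * (\<phi> y - \<phi> x))"
            using elim(2) by eventually_elim (simp add: increment_product_def elim(1) algebra_simps)
        qed
        finally show ?case by simp
      qed
    qed
    also have "\<dots> = a * energy_form \<mu> UNIV u \<phi>"
      by (simp add: energy_form_def set_lebesgue_integral_def)
    finally show ?thesis using test[OF \<phi>] by simp
  qed
  then show ?thesis
    unfolding borel_supersolution_def using v vH tail by auto
qed

lemma nn_integral_joint_le:
  fixes f :: "'a \<times> 'a \<Rightarrow> ennreal"
  assumes [measurable]: "f \<in> borel_measurable borel" "S \<in> sets borel"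
    and f0: "\<And>x. f (x, x) = 0" "\<And>x y. x \<notin> S \<Longrightarrow> f (x, y) = 0"
    and bd: "AE x in lborel. x \<in> S \<longrightarrow> (\<integral>\<^sup>+y. f (x, y) \<partial>\<mu> x) \<le> t"
  shows "(\<integral>\<^sup>+z. f z \<partial>joint \<mu>) \<le> t * emeasure lborel S"
proof -
  have "(\<integral>\<^sup>+z. f z \<partial>joint \<mu>) = (\<integral>\<^sup>+x. (\<integral>\<^sup>+y. f (x, y) \<partial>\<mu> x) \<partial>lborel)"
    using f0(1) by (simp add: nn_integral_joint nn_integral_completion)
  also have "\<dots> \<le> (\<integral>\<^sup>+x. t * indicator S x \<partial>lborel)"
  proof (rule nn_integral_mono_AE)
    show "AE x in lborel. (\<integral>\<^sup>+y. f (x, y) \<partial>\<mu> x) \<le> t * indicator S x"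
      using bd by eventually_elim (auto simp: indicator_def f0(2))
  qed
  also have "\<dots> = t * emeasure lborel S" by (simp add: nn_integral_cmult_indicator)
  finally show ?thesis .
qed

lemma nn_integral_joint_cutoff:
  assumes [measurable]: "\<psi> \<in> borel_measurable borel" "S \<in> sets borel" and s: "0 < s"
    and lip: "\<And>x y. \<bar>\<psi> y - \<psi> x\<bar> \<le> min 1 (dist x y / s)"
  shows "(\<integral>\<^sup>+z\<in>S \<times> UNIV. ennreal (increment_product \<psi> \<psi> z) \<partial>joint \<mu>) \<le>
    ennreal (carre_const \<alpha> C * s powr - \<alpha>) * emeasure lborel S"
proof (rule nn_integral_joint_le)
  have [measurable]: "S \<times> UNIV \<in> sets (borel :: ('a \<times> 'a) measure)" by (rule borel_Times) auto
  show "(\<lambda>z. ennreal (increment_product \<psi> \<psi> z) * indicator (S \<times> UNIV) z) \<in> borel_measurable borel"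
    by measurable
  have "(\<psi> y - \<psi> x)\<^sup>2 \<le> min 1 ((dist x y / s)\<^sup>2)" for x y
  proof -
    have "\<bar>\<psi> y - \<psi> x\<bar>\<^sup>2 \<le> (min 1 (dist x y / s))\<^sup>2" by (rule power_mono[OF lip]) simp
    also have "\<dots> = min 1 ((dist x y / s)\<^sup>2)"
      using s power_mono[of "dist x y / s" 1 2] power_mono[of 1 "dist x y / s" 2] by (auto simp: min_def)
    finally show ?thesis by simp
  qed
  then have "(\<integral>\<^sup>+y. ennreal (increment_product \<psi> \<psi> (x, y)) * indicator (S \<times> UNIV) (x, y) \<partial>\<mu> x) \<le>
    (\<integral>\<^sup>+y. ennreal (min 1 ((dist x y / s)\<^sup>2)) \<partial>\<mu> x)" for x
    by (intro nn_integral_mono) (auto simp: indicator_def increment_product_self intro!: ennreal_leI)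
  then show "AE x in lborel. x \<in> S \<longrightarrow> (\<integral>\<^sup>+y. ennreal (increment_product \<psi> \<psi> (x, y)) * indicator (S \<times> UNIV) (x, y) \<partial>\<mu> x)
    \<le> ennreal (carre_const \<alpha> C * s powr - \<alpha>)"
    by (intro AE_I2 impI order_trans[OF _ truncated_second_moment[OF s]])
qed (auto simp: increment_product_def)

end

section \<open>The energy estimate\<close>

text \<open>The support radius \<open>3/4 * R\<close> leaves a gap \<open>R/4\<close> to the
  exterior of the ball, so jumps from the support out of the ball are long enough for the decay
  estimate. The support also lies in the ball of radius \<open>7/8 * R\<close>, on which tails are
  finite.\<close>

definition cutoff :: "'a::euclidean_space \<Rightarrow> real \<Rightarrow> 'a \<Rightarrow> real" where
  "cutoff x\<^sub>0 R x = max 0 (min 1 (3 - 4 * dist x\<^sub>0 x / R))"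

lemma cutoff_nonneg: "0 \<le> cutoff x\<^sub>0 R x" and cutoff_le_1: "cutoff x\<^sub>0 R x \<le> 1"
  by (simp_all add: cutoff_def)

lemma cutoff_eq_0: "0 < R \<Longrightarrow> x \<notin> ball x\<^sub>0 (3/4 * R) \<Longrightarrow> cutoff x\<^sub>0 R x = 0"
  by (auto simp: cutoff_def field_simps)

lemma cutoff_eq_1: "0 < R \<Longrightarrow> x \<in> ball x\<^sub>0 (R/2) \<Longrightarrow> cutoff x\<^sub>0 R x = 1"
  by (auto simp: cutoff_def field_simps)

lemma cutoff_lipschitz:
  assumes "0 < R"
  shows "\<bar>cutoff x\<^sub>0 R y - cutoff x\<^sub>0 R x\<bar> \<le> min 1 (dist x y / (R/4))"
proof -
  have "\<bar>4 * dist x\<^sub>0 y / R - 4 * dist x\<^sub>0 x / R\<bar> = 4 * \<bar>dist x\<^sub>0 y - dist x\<^sub>0 x\<bar> / R"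
  proof -
    have "4 * dist x\<^sub>0 y / R - 4 * dist x\<^sub>0 x / R = 4 * (dist x\<^sub>0 y - dist x\<^sub>0 x) / R"
      by (simp add: right_diff_distrib diff_divide_distrib)
    then show ?thesis using assms by (simp only: abs_divide abs_mult abs_numeral abs_of_pos)
  qed
  also have "\<dots> \<le> 4 * dist x y / R"
    using assms dist_triangle[of x\<^sub>0 y x] dist_triangle[of x\<^sub>0 x y]
    by (intro divide_right_mono mult_left_mono) (auto simp: dist_commute)
  finally have "\<bar>4 * dist x\<^sub>0 y / R - 4 * dist x\<^sub>0 x / R\<bar> \<le> dist x y / (R/4)"
    by (simp add: mult.commute)
  then have d: "\<bar>(3 - 4 * dist x\<^sub>0 y / R) - (3 - 4 * dist x\<^sub>0 x / R)\<bar> \<le> dist x y / (R/4)"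
    by linarith
  have clamp: "\<bar>max 0 (min 1 a) - max 0 (min 1 b)\<bar> \<le> min 1 \<bar>a - b\<bar>" for a b :: real
    by (cases "a \<le> 0"; cases "a \<le> 1"; cases "b \<le> 0"; cases "b \<le> 1"; simp)
  show ?thesis
    unfolding cutoff_def by (rule order_trans[OF clamp]) (rule min.mono[OF order_refl d])
qed

lemma cutoff_measurable [measurable]: "cutoff x\<^sub>0 R \<in> borel_measurable borel"
  unfolding cutoff_def by measurable

text \<open>The cutoff varies at scale \<open>R/4\<close> and the exterior lies at distance
  \<open>R/4\<close>; rescaling to \<open>R\<close> puts \<open>4 powr \<alpha>\<close> in front of
  \<open>carre_const \<alpha> C\<close> and \<open>C\<close>. The summand 1 is the negative tail,
  and the outer factor 2 counts both orders of a pair.\<close>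

definition energy_const :: "real \<Rightarrow> real \<Rightarrow> real" where
  "energy_const \<alpha> C = 2 * (4 powr \<alpha> * (carre_const \<alpha> C + C) + 1)"

lemma energy_const_positive:
  assumes "\<alpha> < 2" "1 \<le> C"
  shows "0 < energy_const \<alpha> C"
  using carre_const_positive[OF assms] assms by (auto simp: energy_const_def intro!: add_pos_pos mult_pos_pos)

context symmetric_decay_kernel
begin

lemma test_function_in_H_loc: "\<phi> \<in> test_functions \<mu> E' \<Longrightarrow> \<phi> \<in> H_loc \<mu> E"
proof -
  assume "\<phi> \<in> test_functions \<mu> E'"
  then have h: "square_integrable_on \<phi> UNIV" "energy \<mu> UNIV \<phi> < \<infinity>"
    by (auto simp: test_functions_def H_space_def)
  have "square_integrable_on \<phi> D \<and> energy \<mu> D \<phi> < \<infinity>" if "open D" for D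
  proof
    have "energy \<mu> D \<phi> \<le> energy \<mu> UNIV \<phi>"
      unfolding energy_def by (intro nn_integral_mono mult_mono) (auto simp: indicator_def)
    then show "energy \<mu> D \<phi> < \<infinity>" using h(2) by (rule le_less_trans)
    have "(\<integral>\<^sup>+x\<in>D. ennreal ((\<phi> x)\<^sup>2) \<partial>lebesgue) \<le> (\<integral>\<^sup>+x\<in>UNIV. ennreal ((\<phi> x)\<^sup>2) \<partial>lebesgue)"
      by (intro nn_integral_mono mult_mono) (auto simp: indicator_def)
    then show "square_integrable_on \<phi> D"
      using h(1) by (auto simp: square_integrable_on_def lebesgue_on_UNIV_eq 
          intro: measurable_restrict_space1 le_less_trans)
  qed
  then show ?thesis by (auto simp: H_loc_def)
qed

lemma finite_joint_ball_far:
  assumes R: "0 < R" and S: "S \<in> sets borel" "S \<subseteq> ball x\<^sub>0 (3/4 * R)"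
  shows "emeasure (joint \<mu>) (S \<times> - ball x\<^sub>0 R) < \<infinity>"
proof (rule emeasure_joint_separated_finite)
  show "bounded S" using bounded_subset[OF bounded_ball S(2)] .
  show "R/4 \<le> dist x y" if "x \<in> S" "y \<in> - ball x\<^sub>0 R" for x y
    using that S(2) dist_triangle[of x\<^sub>0 y x] by fastforce
qed (use R S in auto)

text \<open>Pairs inside the ball are controlled by the energies of \<open>u\<close> and of the
  cutoff. A pair with one point in \<open>S\<close> and the other outside the ball costs at most
  \<open>M\<^sup>2\<close>, and the mass of such pairs is finite by the gap.\<close>

lemma test_function_lipschitz:
  assumes R: "0 < R" and ball: "cball x\<^sub>0 R \<subseteq> E"
    and uH: "u \<in> H_loc \<mu> E" and [measurable]: "u \<in> borel_measurable borel"
    and \<phi> [measurable]: "\<phi> \<in> borel_measurable borel" and S [measurable]: "S \<in> sets borel"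
    and S_sub: "S \<subseteq> ball x\<^sub>0 (3/4 * R)"
    and \<phi>_nn: "\<And>x. 0 \<le> \<phi> x" and \<phi>_0: "\<And>x. x \<notin> S \<Longrightarrow> \<phi> x = 0" and \<phi>_M: "\<And>x. \<phi> x \<le> M"
    and lip: "\<And>x y. x \<in> ball x\<^sub>0 R \<Longrightarrow> y \<in> ball x\<^sub>0 R \<Longrightarrow>
      \<bar>\<phi> y - \<phi> x\<bar> \<le> L * (\<bar>u y - u x\<bar> + \<bar>cutoff x\<^sub>0 R y - cutoff x\<^sub>0 R x\<bar>)"
  shows "\<phi> \<in> test_functions \<mu> E"
proof -
  define D where "D = ball x\<^sub>0 R"
  define \<psi> where "\<psi> = cutoff x\<^sub>0 R"
  have [measurable]: "D \<in> sets borel" "\<psi> \<in> borel_measurable borel" by (auto simp: D_def \<psi>_def)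
  have [measurable]: "D \<times> D \<in> sets borel" "D \<times> UNIV \<in> sets (borel :: ('a \<times> 'a) measure)" "S \<times> - D \<in> sets borel"
    by (auto intro!: borel_Times)
  have SD: "S \<subseteq> D" using S_sub R by (auto simp: D_def)
  have uD: "energy \<mu> D u < \<infinity>"
    using uH ball R by (auto simp: H_loc_def D_def closure_ball)
  have M: "0 \<le> M" using \<phi>_nn \<phi>_M order_trans by blast
  have fin: "emeasure lborel X < \<infinity>" if "X \<subseteq> D" for X
    using that by (intro emeasure_bounded_finite) (auto simp: D_def intro: bounded_subset)
  let ?i = "indicator (S \<times> - D) :: 'a \<times> 'a \<Rightarrow> ennreal"
  have pt: "ennreal (increment_product \<phi> \<phi> z) \<le>
      ennreal (2 * L\<^sup>2) * (ennreal (increment_product u u z) * indicator (D \<times> D) z)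
    + ennreal (2 * L\<^sup>2) * (ennreal (increment_product \<psi> \<psi> z) * indicator (D \<times> UNIV) z)
    + ennreal (M\<^sup>2) * ?i z + ennreal (M\<^sup>2) * ?i (snd z, fst z)" for z
  proof -
    obtain x y where z: "z = (x, y)" by (cases z)
    consider "x \<in> D" "y \<in> D" | "x \<notin> S" "y \<notin> S" | "x \<in> S" "y \<notin> D" | "x \<notin> D" "y \<in> S"
      using SD by blast
    then show ?thesis
    proof cases
      case 1
      have "\<bar>\<phi> y - \<phi> x\<bar>\<^sup>2 \<le> (L * (\<bar>u y - u x\<bar> + \<bar>\<psi> y - \<psi> x\<bar>))\<^sup>2"
        using lip[of x y] 1 by (intro power_mono) (auto simp: D_def \<psi>_def)
      also have "\<dots> \<le> L\<^sup>2 * (2 * \<bar>u y - u x\<bar>\<^sup>2 + 2 * \<bar>\<psi> y - \<psi> x\<bar>\<^sup>2)"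
        using sum_squares_bound[of "\<bar>u y - u x\<bar>" "\<bar>\<psi> y - \<psi> x\<bar>"]
        unfolding power_mult_distrib by (intro mult_left_mono) (auto simp: power2_sum)
      finally have "(\<phi> y - \<phi> x)\<^sup>2 \<le> 2 * L\<^sup>2 * (u y - u x)\<^sup>2 + 2 * L\<^sup>2 * (\<psi> y - \<psi> x)\<^sup>2"
        by (simp add: algebra_simps)
      then have "ennreal ((\<phi> y - \<phi> x)\<^sup>2) \<le> ennreal (2 * L\<^sup>2) * ennreal ((u y - u x)\<^sup>2) + ennreal (2 * L\<^sup>2) * ennreal ((\<psi> y - \<psi> x)\<^sup>2)"
        by (simp add: ennreal_leI flip: ennreal_mult'' ennreal_plus)
      then show ?thesis using 1 by (simp add: z increment_product_self add_increasing2)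
    next
      case 2 then show ?thesis by (simp add: z increment_product_def \<phi>_0)
    next
      case 3
      then have "\<phi> y = 0" using \<phi>_0[of y] SD by auto
      then have "(\<phi> y - \<phi> x)\<^sup>2 \<le> M\<^sup>2" using power_mono[OF \<phi>_M \<phi>_nn, of x 2] by simp
      then have "ennreal (increment_product \<phi> \<phi> z) \<le> ennreal (M\<^sup>2) * ?i z"
        using 3 by (simp add: z increment_product_self ennreal_leI)
      then show ?thesis by (intro add_increasing2[OF _ add_increasing]) auto
    next
      case 4
      then have "\<phi> x = 0" using \<phi>_0[of x] SD by auto
      then have "(\<phi> y - \<phi> x)\<^sup>2 \<le> M\<^sup>2" using power_mono[OF \<phi>_M \<phi>_nn, of y 2] by simp
      then have "ennreal (increment_product \<phi> \<phi> z) \<le> ennreal (M\<^sup>2) * ?i (snd z, fst z)"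
        using 4 by (simp add: z increment_product_self ennreal_leI)
      then show ?thesis by (intro add_increasing) auto
    qed
  qed
  have "(\<lambda>z. ?i (snd z, fst z)) \<in> borel_measurable borel"
    by (rule measurable_compose[where g = ?i and N = borel])
      (auto intro!: borel_measurable_continuous_onI continuous_intros)
  note this [measurable]
  have sw: "(\<integral>\<^sup>+z. ?i (snd z, fst z) \<partial>joint \<mu>) = emeasure (joint \<mu>) (S \<times> - D)"
    by (subst nn_integral_joint_swap) auto
  have "energy \<mu> UNIV \<phi> = (\<integral>\<^sup>+z. ennreal (increment_product \<phi> \<phi> z) \<partial>joint \<mu>)"
    by (subst energy_joint) auto
  also have "\<dots> \<le> (\<integral>\<^sup>+z. ennreal (2 * L\<^sup>2) * (ennreal (increment_product u u z) * indicator (D \<times> D) z)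
    + ennreal (2 * L\<^sup>2) * (ennreal (increment_product \<psi> \<psi> z) * indicator (D \<times> UNIV) z)
    + ennreal (M\<^sup>2) * ?i z + ennreal (M\<^sup>2) * ?i (snd z, fst z) \<partial>joint \<mu>)"
    by (intro nn_integral_mono pt)
  also have "\<dots> = ennreal (2 * L\<^sup>2) * energy \<mu> D u
    + ennreal (2 * L\<^sup>2) * (\<integral>\<^sup>+z\<in>D \<times> UNIV. ennreal (increment_product \<psi> \<psi> z) \<partial>joint \<mu>)
    + ennreal (M\<^sup>2) * emeasure (joint \<mu>) (S \<times> - D) + ennreal (M\<^sup>2) * emeasure (joint \<mu>) (S \<times> - D)"
    by (simp add: nn_integral_add nn_integral_cmult energy_joint sw)
  also have "\<dots> < \<infinity>"
  proof -
    have "(\<integral>\<^sup>+z\<in>D \<times> UNIV. ennreal (increment_product \<psi> \<psi> z) \<partial>joint \<mu>) \<le>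
      ennreal (carre_const \<alpha> C * (R/4) powr - \<alpha>) * emeasure lborel D"
      using R cutoff_lipschitz[OF R, of x\<^sub>0] by (intro nn_integral_joint_cutoff) (auto simp: \<psi>_def)
    also have "\<dots> < \<infinity>" using fin by (simp add: ennreal_mult_less_top)
    finally show ?thesis
      using uD finite_joint_ball_far[OF R S S_sub] by (simp add: ennreal_mult_less_top D_def)
  qed
  finally have en: "energy \<mu> UNIV \<phi> < \<infinity>" .
  have "(\<integral>\<^sup>+x. ennreal ((\<phi> x)\<^sup>2) \<partial>lborel) \<le> (\<integral>\<^sup>+x. ennreal (M\<^sup>2) * indicator S x \<partial>lborel)"
    using \<phi>_nn \<phi>_M \<phi>_0 by (intro nn_integral_mono) (auto simp: indicator_def intro!: ennreal_leI power_mono)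
  also have "\<dots> = ennreal (M\<^sup>2) * emeasure lborel S" by (simp add: nn_integral_cmult_indicator)
  also have "\<dots> < \<infinity>" using fin[OF SD] by (simp add: ennreal_mult_less_top)
  finally have sq: "square_integrable_on \<phi> UNIV"
    by (simp add: square_integrable_on_def nn_integral_completion borel_measurable_lebesgue_on)
  have "closure {x. \<phi> x \<noteq> 0} \<subseteq> cball x\<^sub>0 R"
    using \<phi>_0 SD by (intro closure_minimal) (auto simp: D_def dest!: subsetD)
  then show ?thesis using en sq \<phi>_nn ball by (auto simp: test_functions_def H_space_def)
qed

lemmas energy_const_pos = energy_const_positive[OF alpha_less C_ge]

text \<open>The template for both uses of the equation. The test function \<open>(\<epsilon> * (\<psi> - t) - u)\<^sub>+\<close> satisfies the
  hypotheses with \<open>\<kappa> = \<epsilon>\<^sup>2\<close>, and \<open>\<psi>\<^sup>2 / (u + \<epsilon>)\<close> with \<open>\<kappa> = 1\<close>, where \<open>\<psi>\<close> is the cutoff; in both cases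
  the cutoff enters only through its energy on \<open>S\<close>, so no product of a cutoff and \<open>u\<close> has to be estimated.\<close>

lemma energy_estimate:
  assumes R: "0 < R" and ball: "cball x\<^sub>0 R \<subseteq> E" and super: "borel_supersolution \<mu> E u"
    and pos: "\<And>x. x \<in> ball x\<^sub>0 R \<Longrightarrow> 0 \<le> u x" and \<epsilon>: "0 < \<epsilon>"
    and neg: "AE x in lborel. x \<in> ball x\<^sub>0 (3/4 * R) \<longrightarrow>
      (\<integral>\<^sup>+y\<in>- ball x\<^sub>0 R. ennreal (- u y) \<partial>\<mu> x) \<le> ennreal (\<epsilon> * R powr - \<alpha>)"
    and \<kappa>: "0 \<le> \<kappa>"
    and \<phi> [measurable]: "\<phi> \<in> borel_measurable borel" and S [measurable]: "S \<in> sets borel"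
    and S_sub: "S \<subseteq> ball x\<^sub>0 (3/4 * R)"
    and \<phi>_nn: "\<And>x. 0 \<le> \<phi> x" and \<phi>_0: "\<And>x. x \<notin> S \<Longrightarrow> \<phi> x = 0"
    and \<phi>_\<kappa>: "\<And>x. x \<in> S \<Longrightarrow> \<epsilon> * \<phi> x \<le> \<kappa>" and u\<phi>_\<kappa>: "\<And>x. x \<in> S \<Longrightarrow> u x * \<phi> x \<le> \<kappa>"
    and lip: "\<And>x y. x \<in> ball x\<^sub>0 R \<Longrightarrow> y \<in> ball x\<^sub>0 R \<Longrightarrow>
      \<bar>\<phi> y - \<phi> x\<bar> \<le> L * (\<bar>u y - u x\<bar> + \<bar>cutoff x\<^sub>0 R y - cutoff x\<^sub>0 R x\<bar>)"
    and h [measurable]: "h \<in> borel_measurable borel" and h_nn: "\<And>z. 0 \<le> h z"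
    and key: "\<And>x y. x \<in> ball x\<^sub>0 R \<Longrightarrow> y \<in> ball x\<^sub>0 R \<Longrightarrow> increment_product u \<phi> (x, y) \<le>
      \<kappa> * (cutoff x\<^sub>0 R y - cutoff x\<^sub>0 R x)\<^sup>2 * of_bool (x \<in> S \<or> y \<in> S) - h (x, y)"
  shows "(\<integral>\<^sup>+z\<in>ball x\<^sub>0 R \<times> ball x\<^sub>0 R. ennreal (h z) \<partial>joint \<mu>) \<le>
    ennreal (\<kappa> * energy_const \<alpha> C * R powr - \<alpha>) * emeasure lborel S"
proof -
  define D where "D = ball x\<^sub>0 R"
  define \<psi> where "\<psi> = cutoff x\<^sub>0 R"
  \<comment> \<open>An upper bound for \<open>\<phi>\<close>, by
    \<open>\<epsilon> * \<phi> x \<le> \<kappa>\<close>. Multiplied by the negative tail of size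
    \<open>\<epsilon> * R powr - \<alpha>\<close> it gives back exactly
    \<open>\<kappa> * R powr - \<alpha>\<close>.\<close>
  define M where "M = \<kappa> / \<epsilon>"
  define F where "F = increment_product u \<phi>"
  have u [measurable]: "u \<in> borel_measurable borel" and uH: "u \<in> H_loc \<mu> E" and tail: "tail_finite \<mu> E u"
    using super by (auto simp: borel_supersolution_def)
  have [measurable]: "D \<in> sets borel" "\<psi> \<in> borel_measurable borel" by (auto simp: D_def \<psi>_def)
  have DD [measurable]: "D \<times> D \<in> sets borel" by (auto intro!: borel_Times)
  have Fm [measurable]: "F \<in> borel_measurable borel" unfolding F_def by measurable
  have SD: "S \<subseteq> D" using S_sub R by (auto simp: D_def)
  have M: "0 \<le> M" using \<kappa> \<epsilon> by (simp add: M_def)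
  have \<phi>_M: "\<phi> x \<le> M" for x
    using \<phi>_\<kappa>[of x] \<phi>_0[of x] \<epsilon> M by (cases "x \<in> S") (auto simp: M_def field_simps)
  have test: "\<phi> \<in> test_functions \<mu> E"
    by (rule test_function_lipschitz[OF R ball uH u \<phi> S S_sub \<phi>_nn \<phi>_0 \<phi>_M lip])
  have Sfin: "emeasure lborel S < \<infinity>"
    using S_sub by (intro emeasure_bounded_finite) (auto intro: bounded_subset)
  have mu_far: "emeasure (\<mu> x) (- D) \<le> ennreal (C * (R/4) powr - \<alpha>)" if "x \<in> S" for x
    using emeasure_mu_ball_complement[of x x\<^sub>0 "3/4 * R" R] that S_sub R by (auto simp: D_def)
  have swap_meas: "(\<lambda>z. f (snd z, fst z)) \<in> borel_measurable borel"
    if "f \<in> borel_measurable borel" for f :: "'a \<times> 'a \<Rightarrow> real"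
    by (rule measurable_compose[OF _ that])
      (auto intro!: borel_measurable_continuous_onI continuous_intros)

  \<comment> \<open>\<open>P\<close> majorises the pairs that leave the ball. It contains the full
    tail of \<open>u\<close>, which is finite but not quantified, so it serves only to prove
    integrability. The bound in the conclusion comes from \<open>G'\<close> below, where only the
    negative part of \<open>u\<close> appears.\<close>
  define P where "P z = indicator S (fst z) * indicator (- D) (snd z) * (M * \<bar>u (snd z)\<bar> + \<kappa>)" for z
  have Pm [measurable]: "P \<in> borel_measurable borel" unfolding P_def by measurable
  have Ps [measurable]: "(\<lambda>z. P (snd z, fst z)) \<in> borel_measurable borel" by (rule swap_meas[OF Pm])
  have P_nn: "0 \<le> P z" for z using M \<kappa> by (simp add: P_def indicator_def)
  obtain T where T: "AE x in lborel. x \<in> ball x\<^sub>0 (7/8 * R) \<longrightarrow> (\<integral>\<^sup>+y\<in>- ball x\<^sub>0 R. ennreal \<bar>u y\<bar> \<partial>\<mu> x) \<le> ennreal T"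
    using tail ball R unfolding tail_finite_def by (meson ball_subset_cball order_trans)
  have "(\<integral>\<^sup>+z. ennreal (P z) \<partial>joint \<mu>) \<le>
    (ennreal M * ennreal T + ennreal \<kappa> * ennreal (C * (R/4) powr - \<alpha>)) * emeasure lborel S"
  proof (rule nn_integral_joint_le)
    show "AE x in lborel. x \<in> S \<longrightarrow> (\<integral>\<^sup>+y. ennreal (P (x, y)) \<partial>\<mu> x) \<le>
      ennreal M * ennreal T + ennreal \<kappa> * ennreal (C * (R/4) powr - \<alpha>)"
      using T
    proof (eventually_elim, intro impI)
      fix x assume Tx: "x \<in> ball x\<^sub>0 (7/8 * R) \<longrightarrow> (\<integral>\<^sup>+y\<in>- ball x\<^sub>0 R. ennreal \<bar>u y\<bar> \<partial>\<mu> x) \<le> ennreal T" and x: "x \<in> S"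
      have "(\<integral>\<^sup>+y. ennreal (P (x, y)) \<partial>\<mu> x) =
        (\<integral>\<^sup>+y. ennreal M * (ennreal \<bar>u y\<bar> * indicator (- D) y) + ennreal \<kappa> * indicator (- D) y \<partial>\<mu> x)"
        using x M \<kappa> by (intro nn_integral_cong) (auto simp: P_def indicator_def ennreal_mult'' ennreal_plus)
      also have "\<dots> = ennreal M * (\<integral>\<^sup>+y\<in>- D. ennreal \<bar>u y\<bar> \<partial>\<mu> x) + ennreal \<kappa> * emeasure (\<mu> x) (- D)"
        by (simp add: nn_integral_add nn_integral_cmult nn_integral_cmult_indicator)
      also have "\<dots> \<le> ennreal M * ennreal T + ennreal \<kappa> * ennreal (C * (R/4) powr - \<alpha>)"
        using Tx x S_sub R mu_far[OF x] by (intro add_mono mult_left_mono) (auto simp: D_def)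
      finally show "(\<integral>\<^sup>+y. ennreal (P (x, y)) \<partial>\<mu> x) \<le> ennreal M * ennreal T + ennreal \<kappa> * ennreal (C * (R/4) powr - \<alpha>)" .
    qed
  qed (use SD in \<open>auto simp: P_def indicator_def\<close>)
  also have "\<dots> < \<infinity>" using Sfin by (simp add: ennreal_mult_less_top)
  finally have Pfin: "(\<integral>\<^sup>+z. ennreal (P z) \<partial>joint \<mu>) < \<infinity>" .
  have F_bd: "\<bar>F z\<bar> \<le> indicator (D \<times> D) z * (increment_product u u z + increment_product \<phi> \<phi> z) + P z + P (snd z, fst z)" for z
  proof -
    obtain x y where z: "z = (x, y)" by (cases z)
    have side: "\<bar>(u b - u a) * (\<phi> b - \<phi> a)\<bar> \<le> M * \<bar>u b\<bar> + \<kappa>" if "a \<in> S" "b \<notin> D" for a b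
    proof -
      have "\<phi> b = 0" using that SD \<phi>_0 by auto
      then have "\<bar>(u b - u a) * (\<phi> b - \<phi> a)\<bar> = \<bar>u b - u a\<bar> * \<phi> a" using \<phi>_nn[of a] by (simp add: abs_mult)
      also have "\<dots> \<le> (\<bar>u b\<bar> + u a) * \<phi> a"
        using pos[of a] that SD \<phi>_nn by (intro mult_right_mono) (auto simp: D_def)
      also have "\<dots> \<le> \<bar>u b\<bar> * M + \<kappa>"
        using u\<phi>_\<kappa>[OF that(1)] \<phi>_M[of a] by (simp add: distrib_right add_mono mult_left_mono)
      finally show ?thesis by (simp add: mult.commute)
    qed
    have dd: "\<bar>a * b\<bar> \<le> a * a + b * b" for a b :: real
      using sum_squares_bound[of a b] sum_squares_bound[of a "-b"] zero_le_square[of a] zero_le_square[of b]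
      by (auto simp: abs_if power2_eq_square)
    consider "x \<in> D" "y \<in> D" | "x \<notin> S" "y \<notin> S" | "x \<in> S" "y \<notin> D" | "x \<notin> D" "y \<in> S"
      using SD by blast
    then show ?thesis
    proof cases
      case 1 then show ?thesis by (auto simp: z F_def increment_product_def P_def dd)
    next
      case 2
      then show ?thesis by (auto simp: z F_def increment_product_def P_def \<phi>_0 indicator_def)
    next
      case 3
      then show ?thesis using SD side[of x y] by (auto simp: z F_def increment_product_def P_def)
    next
      case 4
      have "(u y - u x) * (\<phi> y - \<phi> x) = (u x - u y) * (\<phi> x - \<phi> y)" by (simp add: algebra_simps)
      then show ?thesis using 4 SD side[of y x] by (auto simp: z F_def increment_product_def P_def)
    qed
  qed
  have F_int: "integrable (joint \<mu>) F"
  proof (rule integrableI_bounded)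
    have "(\<integral>\<^sup>+z. ennreal (norm (F z)) \<partial>joint \<mu>) \<le> (\<integral>\<^sup>+z. (ennreal (increment_product u u z) * indicator (D \<times> D) z
        + ennreal (increment_product \<phi> \<phi> z) * indicator (D \<times> D) z) + ennreal (P z) + ennreal (P (snd z, fst z)) \<partial>joint \<mu>)"
    proof (rule nn_integral_mono)
      fix z
      have "ennreal (norm (F z)) \<le> ennreal (indicator (D \<times> D) z * (increment_product u u z + increment_product \<phi> \<phi> z) + P z + P (snd z, fst z))"
        using F_bd[of z] by (simp add: ennreal_leI)
      also have "\<dots> = (ennreal (increment_product u u z) * indicator (D \<times> D) z
        + ennreal (increment_product \<phi> \<phi> z) * indicator (D \<times> D) z) + ennreal (P z) + ennreal (P (snd z, fst z))"
        using P_nn by (auto simp: indicator_def increment_product_self)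
      finally show "ennreal (norm (F z)) \<le> \<dots>" .
    qed
    also have "\<dots> = energy \<mu> D u + energy \<mu> D \<phi> + (\<integral>\<^sup>+z. ennreal (P z) \<partial>joint \<mu>) + (\<integral>\<^sup>+z. ennreal (P (snd z, fst z)) \<partial>joint \<mu>)"
      by (simp add: nn_integral_add energy_joint)
    also have "\<dots> < \<infinity>"
      using uH test_function_in_H_loc[OF test, of E] Pfin ball R
        nn_integral_joint_swap[of "\<lambda>z. ennreal (P z)"]
      by (auto simp: H_loc_def D_def closure_ball)
    finally show "(\<integral>\<^sup>+z. ennreal (norm (F z)) \<partial>joint \<mu>) < \<infinity>" .
  qed simp
  have F_nn: "0 \<le> (LINT z|joint \<mu>. F z)"
    using super test \<phi> F_int unfolding borel_supersolution_def F_def by auto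

  \<comment> \<open>Near \<open>S\<close> the form is bounded by the energy of the cutoff. A jump
    from \<open>x\<close> in \<open>S\<close> to \<open>y\<close> outside the ball costs at most
    \<open>u x * \<phi> x \<le> \<kappa>\<close> plus the negative part of \<open>u y\<close> times
    the bound on \<open>\<phi>\<close>; positive values outside the ball have the favourable
    sign.\<close>
  define G' where "G' z = indicator S (fst z) * (\<kappa> * increment_product \<psi> \<psi> z)
    + indicator S (fst z) * indicator (- D) (snd z) * (\<kappa> + M * max 0 (- u (snd z)))" for z
  have G'm [measurable]: "G' \<in> borel_measurable borel" unfolding G'_def by measurable
  have G's [measurable]: "(\<lambda>z. G' (snd z, fst z)) \<in> borel_measurable borel" by (rule swap_meas[OF G'm])
  have G'_nn: "0 \<le> G' z" for z using M \<kappa> by (simp add: G'_def indicator_def increment_product_self)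
  have G'_le: "(\<integral>\<^sup>+z. ennreal (G' z) \<partial>joint \<mu>) \<le> ennreal (\<kappa> * energy_const \<alpha> C / 2 * R powr - \<alpha>) * emeasure lborel S"
  proof (rule nn_integral_joint_le)
    show "AE x in lborel. x \<in> S \<longrightarrow> (\<integral>\<^sup>+y. ennreal (G' (x, y)) \<partial>\<mu> x) \<le> ennreal (\<kappa> * energy_const \<alpha> C / 2 * R powr - \<alpha>)"
      using neg
    proof (eventually_elim, intro impI)
      fix x assume Tx: "x \<in> ball x\<^sub>0 (3/4 * R) \<longrightarrow> (\<integral>\<^sup>+y\<in>- ball x\<^sub>0 R. ennreal (- u y) \<partial>\<mu> x) \<le> ennreal (\<epsilon> * R powr - \<alpha>)" and x: "x \<in> S"
      have sq: "(\<psi> y - \<psi> x)\<^sup>2 \<le> min 1 ((dist x y / (R/4))\<^sup>2)" for y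
      proof -
        have "\<bar>\<psi> y - \<psi> x\<bar>\<^sup>2 \<le> (min 1 (dist x y / (R/4)))\<^sup>2"
          using cutoff_lipschitz[OF R, of x\<^sub>0 y x] by (intro power_mono) (auto simp: \<psi>_def)
        also have "\<dots> = min 1 ((dist x y / (R/4))\<^sup>2)"
          using R power_mono[of "dist x y / (R/4)" 1 2] power_mono[of 1 "dist x y / (R/4)" 2] by (auto simp: min_def)
        finally show ?thesis by simp
      qed
      have "(\<integral>\<^sup>+y. ennreal (G' (x, y)) \<partial>\<mu> x) \<le>
        (\<integral>\<^sup>+y. ennreal \<kappa> * ennreal (min 1 ((dist x y / (R/4))\<^sup>2)) + (ennreal \<kappa> * indicator (- D) y
          + ennreal M * (ennreal (- u y) * indicator (- D) y)) \<partial>\<mu> x)"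
      proof (rule nn_integral_mono)
        fix y
        have "ennreal (G' (x, y)) = ennreal (\<kappa> * (\<psi> y - \<psi> x)\<^sup>2 + indicator (- D) y * (\<kappa> + M * max 0 (- u y)))"
          using x by (simp add: G'_def increment_product_self)
        also have "\<dots> \<le> ennreal (\<kappa> * min 1 ((dist x y / (R/4))\<^sup>2) + indicator (- D) y * (\<kappa> + M * max 0 (- u y)))"
          using \<kappa> sq by (intro ennreal_leI add_right_mono mult_left_mono) auto
        also have "\<dots> = ennreal \<kappa> * ennreal (min 1 ((dist x y / (R/4))\<^sup>2)) + (ennreal \<kappa> * indicator (- D) y
          + ennreal M * (ennreal (- u y) * indicator (- D) y))"
        proof -
          have "ennreal (- u y) = ennreal (max 0 (- u y))" by (simp add: ennreal_max_0)
          then show ?thesis using \<kappa> M by (auto simp: indicator_def ennreal_mult'' ennreal_plus)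
        qed
        finally show "ennreal (G' (x, y)) \<le> \<dots>" .
      qed
      also have "\<dots> = ennreal \<kappa> * (\<integral>\<^sup>+y. ennreal (min 1 ((dist x y / (R/4))\<^sup>2)) \<partial>\<mu> x)
        + (ennreal \<kappa> * emeasure (\<mu> x) (- D) + ennreal M * (\<integral>\<^sup>+y\<in>- D. ennreal (- u y) \<partial>\<mu> x))"
        by (simp add: nn_integral_add nn_integral_cmult nn_integral_cmult_indicator)
      also have "\<dots> \<le> ennreal \<kappa> * ennreal (carre_const \<alpha> C * (R/4) powr - \<alpha>)
        + (ennreal \<kappa> * ennreal (C * (R/4) powr - \<alpha>) + ennreal M * ennreal (\<epsilon> * R powr - \<alpha>))"
        using Tx x S_sub mu_far[OF x] R
        by (intro add_mono mult_left_mono truncated_second_moment) (auto simp: D_def)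
      also have "\<dots> = ennreal (\<kappa> * (carre_const \<alpha> C * (R/4) powr - \<alpha>) + (\<kappa> * (C * (R/4) powr - \<alpha>) + M * (\<epsilon> * R powr - \<alpha>)))"
        using \<kappa> M carre_const_pos C_ge \<epsilon> by (simp add: ennreal_mult'' ennreal_plus)
      also have "\<kappa> * (carre_const \<alpha> C * (R/4) powr - \<alpha>) + (\<kappa> * (C * (R/4) powr - \<alpha>) + M * (\<epsilon> * R powr - \<alpha>))
        = \<kappa> * energy_const \<alpha> C / 2 * R powr - \<alpha>"
      proof -
        have "(R/4) powr - \<alpha> = 4 powr \<alpha> * R powr - \<alpha>" using R by (simp add: powr_divide powr_minus field_simps)
        moreover have "M * (\<epsilon> * R powr - \<alpha>) = \<kappa> * R powr - \<alpha>" using \<epsilon> by (simp add: M_def)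
        ultimately show ?thesis by (simp add: energy_const_def algebra_simps)
      qed
      finally show "(\<integral>\<^sup>+y. ennreal (G' (x, y)) \<partial>\<mu> x) \<le> ennreal (\<kappa> * energy_const \<alpha> C / 2 * R powr - \<alpha>)" .
    qed
  qed (use SD in \<open>auto simp: G'_def indicator_def increment_product_def\<close>)
  define G where "G z = G' z + G' (snd z, fst z)" for z
  have Gm [measurable]: "G \<in> borel_measurable borel" unfolding G_def by measurable
  have G_nn: "0 \<le> G z" for z using G'_nn by (simp add: G_def)
  have "(\<integral>\<^sup>+z. ennreal (G z) \<partial>joint \<mu>) = (\<integral>\<^sup>+z. ennreal (G' z) \<partial>joint \<mu>) + (\<integral>\<^sup>+z. ennreal (G' (snd z, fst z)) \<partial>joint \<mu>)"
    unfolding G_def using G'_nn by (simp add: nn_integral_add)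
  also have "\<dots> \<le> 2 * (ennreal (\<kappa> * energy_const \<alpha> C / 2 * R powr - \<alpha>) * emeasure lborel S)"
    using G'_le nn_integral_joint_swap[of "\<lambda>z. ennreal (G' z)"] by (simp add: mult_2 add_mono)
  also have "\<dots> = ennreal (2 * (\<kappa> * energy_const \<alpha> C / 2 * R powr - \<alpha>)) * emeasure lborel S"
  proof -
    have "2 * ennreal a = ennreal (2 * a)" for a by (subst ennreal_mult') auto
    then show ?thesis by (simp only: mult.assoc[symmetric])
  qed
  finally have G_le: "(\<integral>\<^sup>+z. ennreal (G z) \<partial>joint \<mu>) \<le> ennreal (\<kappa> * energy_const \<alpha> C * R powr - \<alpha>) * emeasure lborel S"
    by simp
  have G_int: "integrable (joint \<mu>) G"
  proof (rule integrableI_nonneg)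
    show "(\<integral>\<^sup>+z. ennreal (G z) \<partial>joint \<mu>) < \<infinity>"
      using G_le Sfin by (auto simp: ennreal_mult_less_top intro: le_less_trans)
  qed (use G_nn in auto)
  have pt: "indicator (D \<times> D) z * h z \<le> G z - F z" for z
  proof -
    obtain x y where z: "z = (x, y)" by (cases z)
    have side: "(u b - u a) * (\<phi> b - \<phi> a) \<le> \<kappa> + M * max 0 (- u b)" if "a \<in> S" "b \<notin> D" for a b
    proof -
      have "\<phi> b = 0" using that SD \<phi>_0 by auto
      then have "(u b - u a) * (\<phi> b - \<phi> a) = u a * \<phi> a + (- u b) * \<phi> a" by (simp add: algebra_simps)
      also have "\<dots> \<le> \<kappa> + max 0 (- u b) * \<phi> a"
        using u\<phi>_\<kappa>[OF that(1)] \<phi>_nn[of a] by (intro add_mono mult_right_mono) auto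
      also have "\<dots> \<le> \<kappa> + max 0 (- u b) * M"
        using \<phi>_M[of a] by (intro add_left_mono mult_left_mono) auto
      finally show ?thesis by (simp add: mult.commute)
    qed
    have nn: "0 \<le> indicator S (a :: 'a) * (\<kappa> * increment_product \<psi> \<psi> w)" for a w
      using \<kappa> by (simp add: indicator_def increment_product_self)
    consider "x \<in> D" "y \<in> D" | "x \<notin> S" "y \<notin> S" "(x, y) \<notin> D \<times> D" | "x \<in> S" "y \<notin> D" | "x \<notin> D" "y \<in> S"
      using SD by blast
    then show ?thesis
    proof cases
      case 1
      have "\<kappa> * (\<psi> y - \<psi> x)\<^sup>2 * of_bool (x \<in> S \<or> y \<in> S) \<le> G z"
        using 1 \<kappa> by (auto simp: G_def G'_def z increment_product_self indicator_def power2_commute)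
      then show ?thesis using key[of x y] 1 by (auto simp: z F_def D_def \<psi>_def)
    next
      case 2
      then have "F z = 0" by (simp add: F_def z increment_product_def \<phi>_0)
      moreover have "indicator (D \<times> D) z = (0 :: real)" using 2 by (auto simp: z indicator_def)
      ultimately show ?thesis using G_nn[of z] by simp
    next
      case 3
      then show ?thesis using SD side[of x y] nn[of x "(x, y)"] nn[of y "(y, x)"] 
        by (auto simp: z F_def increment_product_def G_def G'_def indicator_def subset_iff split: if_splits)
    next
      case 4
      have "(u y - u x) * (\<phi> y - \<phi> x) = (u x - u y) * (\<phi> x - \<phi> y)" by (simp add: algebra_simps)
      then show ?thesis using 4 SD side[of y x] nn[of y "(y, x)"] nn[of x "(x, y)"]
        by (auto simp: z F_def increment_product_def G_def G'_def indicator_def subset_iff split: if_splits)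
    qed
  qed
  have "(\<integral>\<^sup>+z\<in>D \<times> D. ennreal (h z) \<partial>joint \<mu>) \<le> (\<integral>\<^sup>+z. ennreal (G z - F z) \<partial>joint \<mu>)"
  proof (rule nn_integral_mono)
    fix z show "ennreal (h z) * indicator (D \<times> D) z \<le> ennreal (G z - F z)"
      using pt[of z] by (auto simp: indicator_def ennreal_leI split: if_splits)
  qed
  also have "\<dots> = ennreal (LINT z|joint \<mu>. G z - F z)"
  proof (rule nn_integral_eq_integral)
    have "0 \<le> G z - F z" for z
      by (rule order_trans[OF _ pt[of z]]) (simp add: h_nn)
    then show "AE z in joint \<mu>. 0 \<le> G z - F z" by simp
  qed (use G_int F_int in simp)
  also have "\<dots> \<le> ennreal (LINT z|joint \<mu>. G z)"
    using G_int F_int F_nn by (intro ennreal_leI) simp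
  also have "\<dots> = (\<integral>\<^sup>+z. ennreal (G z) \<partial>joint \<mu>)"
    using G_int G_nn by (intro nn_integral_eq_integral[symmetric]) auto
  also note G_le
  finally show ?thesis by (simp add: D_def)
qed

end

section \<open>De Giorgi iteration\<close>

lemma emeasure_lborel_ball_finite: "emeasure lborel (ball (x :: 'a::euclidean_space) r) < \<infinity>"
  by (intro emeasure_bounded_finite) simp

lemma emeasure_lborel_ball_nonzero: "0 < r \<Longrightarrow> emeasure lborel (ball (x :: 'a::euclidean_space) r) \<noteq> 0"
  using unit_ball_vol_pos[of "real DIM('a)"] by (simp add: emeasure_ball less_imp_neq[symmetric])

lemma ennreal_numeral_mult: "numeral k * ennreal a = ennreal (numeral k * a)"
  by (subst ennreal_mult') auto

text \<open>The positive part is increasing and does not enlarge differences. This gives the form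
  its coercivity on truncations.\<close>

lemma square_positive_part_le:
  fixes a b :: real
  shows "(max 0 b - max 0 a) * (max 0 b - max 0 a) \<le> (b - a) * (max 0 b - max 0 a)"
proof (cases "(0 \<le> a \<and> 0 \<le> b) \<or> (a \<le> 0 \<and> b \<le> 0)")
  case False
  then have "a * b \<le> 0" by (auto simp: mult_le_0_iff)
  then show ?thesis using False by (auto simp: max_def algebra_simps)
qed auto

text \<open>Fast geometric convergence: the exponent \<open>1 + \<sigma>\<close> beats the loss from
  ever closer levels. The step is assumed only while \<open>a t \<le> \<nu>\<close>, a condition
  that the induction preserves.\<close>

lemma de_giorgi_decay:
  fixes a :: "real \<Rightarrow> real"
  assumes nn: "\<And>t. 0 \<le> a t" and mono: "\<And>s t. s \<le> t \<Longrightarrow> a t \<le> a s"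
    and step: "\<And>t d. 0 \<le> t \<Longrightarrow> 0 < d \<Longrightarrow> a t \<le> \<nu> \<Longrightarrow> d\<^sup>2 * a (t + d) \<le> K * a t powr (1 + \<sigma>)"
    and \<sigma>: "0 < \<sigma>" and K: "0 \<le> K" and \<nu>: "0 < \<nu>" and init: "a 0 \<le> \<nu>"
    and small: "16 * K * \<nu> powr \<sigma> \<le> 4 powr (- 1 / \<sigma>)"
  shows "a (1/2) = 0"
proof -
  \<comment> \<open>Chosen so that \<open>q powr \<sigma> = 1/4\<close> cancels the factor 4 by
    which the squared gap between levels deteriorates at each step.\<close>
  define q where "q = (4::real) powr (- 1 / \<sigma>)"
  have q: "0 < q" "q < 1"
    using \<sigma> powr_less_mono[of "- 1 / \<sigma>" 0 4] by (auto simp: q_def)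
  have q\<sigma>: "q powr \<sigma> = 1/4" 
  proof -
    have "q powr \<sigma> = 4 powr - 1" using \<sigma> unfolding q_def powr_powr by simp
    then show ?thesis by (simp add: powr_minus_divide)
  qed
  \<comment> \<open>The levels increase to \<open>1/2\<close> with gaps
    \<open>(1/2) ^ j / 4\<close>; squaring the 4 produces the 16 in the smallness
    hypothesis.\<close>
  define t where "t j = (1 - (1/2) ^ j) / (2 :: real)" for j :: nat
  have bound: "a (t j) \<le> \<nu> * q ^ j" for j
  proof (induction j)
    case 0 then show ?case using init by (simp add: t_def)
  next
    case (Suc j)
    define d where "d = ((1/2) ^ j) / (4 :: real)"
    have d: "0 < d" by (simp add: d_def)
    have td: "t (Suc j) = t j + d" by (simp add: t_def d_def field_simps)
    have d2: "d\<^sup>2 = (1/4) ^ j / 16"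
      by (simp add: d_def power_divide power2_eq_square flip: power_mult_distrib)
    have "\<nu> * q ^ j \<le> \<nu>" using \<nu> q by (simp add: mult_left_le power_le_one)
    with Suc have le: "a (t j) \<le> \<nu>" by simp
    have "d\<^sup>2 * a (t (Suc j)) \<le> K * a (t j) powr (1 + \<sigma>)"
      unfolding td by (rule step) (use d le in \<open>auto simp: t_def power_le_one\<close>)
    also have "\<dots> \<le> K * (\<nu> * q ^ j) powr (1 + \<sigma>)"
      using Suc nn K \<sigma> by (intro mult_left_mono powr_mono2) auto
    also have "(\<nu> * q ^ j) powr (1 + \<sigma>) = (\<nu> * q ^ j) * (\<nu> powr \<sigma> * (1/4) ^ j)"
    proof -
      have "(q ^ j) powr \<sigma> = (q powr \<sigma>) ^ j"
        using q by (simp add: powr_powr mult.commute flip: powr_realpow)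
      then show ?thesis using \<nu> q by (simp add: powr_add powr_mult q\<sigma>)
    qed
    finally have "(1/4) ^ j * a (t (Suc j)) \<le> (1/4) ^ j * ((16 * K * \<nu> powr \<sigma>) * (\<nu> * q ^ j))"
      by (simp add: d2 field_simps)
    then have "a (t (Suc j)) \<le> (16 * K * \<nu> powr \<sigma>) * (\<nu> * q ^ j)"
      by (rule mult_left_le_imp_le) simp
    also have "\<dots> \<le> q * (\<nu> * q ^ j)"
      using small \<nu> q by (intro mult_right_mono) (auto simp: q_def)
    finally show ?case by (simp add: mult_ac)
  qed
  have "a (1/2) \<le> \<nu> * q ^ j" for j
    using mono[of "t j" "1/2"] bound[of j] by (simp add: t_def)
  moreover have "(\<lambda>j. \<nu> * q ^ j) \<longlonglongrightarrow> \<nu> * 0"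
    using q by (intro tendsto_mult_left LIMSEQ_realpow_zero) auto
  ultimately have "a (1/2) \<le> 0"
    using LIMSEQ_le_const[of "\<lambda>j. \<nu> * q ^ j" "\<nu> * 0" "a (1/2)"] by auto
  then show ?thesis using nn by (intro antisym)
qed

context symmetric_decay_kernel
begin

text \<open>The proof works for every number in place of the average, so it does not matter whether the
  average is a genuine one.\<close>

lemma poincare_vanishing_half:
  assumes poin: "poincare_inequality \<alpha> \<mu> E C\<^sub>1" and C\<^sub>1: "0 \<le> C\<^sub>1"
    and v: "v \<in> H_loc \<mu> E" and [measurable]: "v \<in> borel_measurable borel"
    and r: "0 < r" and ball: "ball z r \<subseteq> E"
    and half: "measure lborel {x \<in> ball z r. v x \<noteq> 0} \<le> measure lborel (ball z r) / 2"
  shows "(\<integral>\<^sup>+x\<in>ball z r. ennreal ((v x)\<^sup>2) \<partial>lborel) \<le>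
    ennreal (6 * C\<^sub>1 * r powr \<alpha>) * energy \<mu> (ball z r) v"
proof -
  define B where "B = ball z r"
  define A where "A = {x \<in> B. v x \<noteq> 0}"
  define Z where "Z = {x \<in> B. v x = 0}"
  define m where "m = average v B"
  define I where "I = (\<integral>\<^sup>+x\<in>B. ennreal ((v x - m)\<^sup>2) \<partial>lborel)"
  have [measurable]: "B \<in> sets borel" "A \<in> sets borel" "Z \<in> sets borel"
    by (auto simp: B_def A_def Z_def)
  have Bfin: "B \<in> fmeasurable lborel"
    using emeasure_lborel_ball_finite by (intro fmeasurableI) (auto simp: B_def)
  have fin: "A \<in> fmeasurable lborel" "Z \<in> fmeasurable lborel"
    by (rule fmeasurableI2[OF Bfin]; auto simp: A_def Z_def B_def)+
  have "measure lborel (A \<union> Z) = measure lborel A + measure lborel Z"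
  proof -
    have "A \<inter> Z = {}" by (auto simp: A_def Z_def)
    then show ?thesis using measure_Un3[OF fin] by simp
  qed
  moreover have "A \<union> Z = B" by (auto simp: A_def Z_def)
  ultimately have "measure lborel B \<le> 2 * measure lborel Z"
    using half by (simp add: A_def B_def)
  then have BZ: "emeasure lborel B \<le> 2 * emeasure lborel Z"
    using fin Bfin by (simp add: emeasure_eq_measure2 ennreal_numeral_mult ennreal_leI)
  \<comment> \<open>On the zero set the deviation from \<open>m\<close> has size
    \<open>\<bar>m\<bar>\<close>, so \<open>I\<close> controls \<open>m\<^sup>2\<close>. In the
    final constant 6 = 2 + 4, the 2 comes from \<open>(v x - m)\<^sup>2\<close> and the 4 from
    \<open>m\<^sup>2\<close>, as the zero set fills at least half of the ball.\<close>
  have "ennreal (m\<^sup>2) * emeasure lborel Z = (\<integral>\<^sup>+x. ennreal (m\<^sup>2) * indicator Z x \<partial>lborel)"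
    by (simp add: nn_integral_cmult_indicator)
  also have "\<dots> \<le> I"
    unfolding I_def by (intro nn_integral_mono) (auto simp: Z_def indicator_def)
  finally have mZ: "ennreal (m\<^sup>2) * emeasure lborel Z \<le> I" .
  have "(\<integral>\<^sup>+x\<in>B. ennreal ((v x)\<^sup>2) \<partial>lborel) \<le>
    (\<integral>\<^sup>+x. 2 * (ennreal ((v x - m)\<^sup>2) * indicator B x) + (2 * ennreal (m\<^sup>2)) * indicator B x \<partial>lborel)"
  proof (rule nn_integral_mono)
    fix x
    have "(v x)\<^sup>2 \<le> 2 * (v x - m)\<^sup>2 + 2 * m\<^sup>2"
      using zero_le_power2[of "v x - 2 * m"] by (simp add: power2_eq_square algebra_simps)
    then have "ennreal ((v x)\<^sup>2) \<le> 2 * ennreal ((v x - m)\<^sup>2) + 2 * ennreal (m\<^sup>2)"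
      by (simp add: ennreal_leI flip: ennreal_mult' ennreal_plus ennreal_numeral)
    then show "ennreal ((v x)\<^sup>2) * indicator B x \<le>
      2 * (ennreal ((v x - m)\<^sup>2) * indicator B x) + (2 * ennreal (m\<^sup>2)) * indicator B x"
      by (simp add: indicator_def)
  qed
  also have "\<dots> = 2 * I + (2 * ennreal (m\<^sup>2)) * emeasure lborel B"
    unfolding I_def by (simp add: nn_integral_add nn_integral_cmult nn_integral_cmult_indicator)
  also have "\<dots> \<le> 2 * I + 2 * (ennreal (m\<^sup>2) * (2 * emeasure lborel Z))"
    using BZ by (auto simp: mult.assoc intro!: add_left_mono mult_left_mono)
  also have "\<dots> = 2 * I + 4 * (ennreal (m\<^sup>2) * emeasure lborel Z)"
    by (simp add: mult_ac)
  also have "\<dots> \<le> 2 * I + 4 * I" using mZ by (intro add_left_mono mult_left_mono) auto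
  also have "\<dots> = 6 * I" by (simp flip: distrib_right)
  also have "\<dots> \<le> 6 * (ennreal (C\<^sub>1 * r powr \<alpha>) * energy \<mu> (ball z r) v)"
    using poin v r ball unfolding poincare_inequality_def I_def m_def B_def nn_integral_completion
    by (intro mult_left_mono) auto
  also have "\<dots> = ennreal (6 * C\<^sub>1 * r powr \<alpha>) * energy \<mu> (ball z r) v"
  proof -
    have "6 * ennreal (C\<^sub>1 * r powr \<alpha>) = ennreal (6 * C\<^sub>1 * r powr \<alpha>)"
      by (simp only: ennreal_numeral_mult mult.assoc)
    then show ?thesis by (simp only: mult.assoc[symmetric])
  qed
  finally show ?thesis by (simp add: B_def)
qed

text \<open>Averaging the Poincare inequality over the balls of a fixed small radius, with the centre
  ranging over the whole space, replaces a covering argument.\<close>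

lemma faber_krahn:
  assumes poin: "poincare_inequality \<alpha> \<mu> E C\<^sub>1" and C\<^sub>1: "0 \<le> C\<^sub>1"
    and v: "v \<in> H_loc \<mu> E" and [measurable]: "v \<in> borel_measurable borel"
    and R: "0 < R" and ball: "ball x\<^sub>0 R \<subseteq> E" and r: "0 < r" "r \<le> R/8"
    and supp: "\<And>x. x \<notin> ball x\<^sub>0 (3/4 * R) \<Longrightarrow> v x = 0"
    and half: "measure lborel {x. v x \<noteq> 0} \<le> measure lborel (ball x\<^sub>0 r) / 2"
  shows "(\<integral>\<^sup>+x. ennreal ((v x)\<^sup>2) \<partial>lborel) \<le>
    ennreal (6 * C\<^sub>1 * r powr \<alpha>) * (\<integral>\<^sup>+z\<in>ball x\<^sub>0 R \<times> ball x\<^sub>0 R. ennreal (increment_product v v z) \<partial>joint \<mu>)"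
proof -
  define D where "D = ball x\<^sub>0 R"
  have [measurable]: "D \<in> sets borel" by (simp add: D_def)
  have DD [measurable]: "D \<times> D \<in> sets borel" by (auto intro!: borel_Times)
  define V where "V = emeasure lborel (ball x\<^sub>0 r)"
  have V: "emeasure lborel (ball x r) = V" for x :: 'a
    using r by (simp add: V_def emeasure_ball)
  have V_fin: "V < \<infinity>" unfolding V_def by (rule emeasure_lborel_ball_finite)
  have V_pos: "V \<noteq> 0" unfolding V_def by (rule emeasure_lborel_ball_nonzero[OF r(1)])
  define c where "c = ennreal (6 * C\<^sub>1 * r powr \<alpha>)"
  define g where "g w = ennreal (increment_product v v w) * indicator (D \<times> D) w" for w
  have g [measurable]: "g \<in> borel_measurable borel" unfolding g_def by measurable
  \<comment> \<open>Only balls that meet the support matter, and these lie in \<open>D\<close>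
    because \<open>3/4 * R + 2 * r \<le> R\<close>.\<close>
  have local: "(\<integral>\<^sup>+x\<in>ball z r. ennreal ((v x)\<^sup>2) \<partial>lborel) \<le>
    c * (\<integral>\<^sup>+w. g w * indicator (ball z r \<times> ball z r) w \<partial>joint \<mu>)" for z
  proof (cases "ball z r \<inter> ball x\<^sub>0 (3/4 * R) = {}")
    case True
    then have "(\<integral>\<^sup>+x\<in>ball z r. ennreal ((v x)\<^sup>2) \<partial>lborel) = (\<integral>\<^sup>+x. 0 \<partial>(lborel :: 'a measure))"
    proof (intro nn_integral_cong)
      fix x
      have "v x = 0" if "x \<in> ball z r" using that True supp by blast
      then show "ennreal ((v x)\<^sup>2) * indicator (ball z r) x = 0" by (cases "x \<in> ball z r") auto
    qed
    then show ?thesis by simp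
  next
    case False
    then obtain y where y: "dist z y < r" "dist x\<^sub>0 y < 3/4 * R" by auto
    have sub: "ball z r \<subseteq> D"
    proof
      fix x assume "x \<in> ball z r"
      then show "x \<in> D"
        using y r dist_triangle[of x\<^sub>0 x y] dist_triangle[of y x z] by (auto simp: D_def dist_commute)
    qed
    have "{x. v x \<noteq> 0} \<subseteq> ball x\<^sub>0 (3/4 * R)" using supp by blast
    then have fm: "{x. v x \<noteq> 0} \<in> fmeasurable lborel"
      by (intro fmeasurableI) (auto intro!: emeasure_bounded_finite[unfolded infinity_ennreal_def] bounded_subset[OF bounded_ball])
    have "measure lborel {x \<in> ball z r. v x \<noteq> 0} \<le> measure lborel {x. v x \<noteq> 0}"
      by (rule measure_mono_fmeasurable[OF _ _ fm]) auto
    also have "\<dots> \<le> measure lborel (ball z r) / 2"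
      using half V by (simp add: measure_def V_def[symmetric])
    finally have "(\<integral>\<^sup>+x\<in>ball z r. ennreal ((v x)\<^sup>2) \<partial>lborel) \<le> c * energy \<mu> (ball z r) v"
      unfolding c_def using sub ball r by (intro poincare_vanishing_half[OF poin C\<^sub>1 v]) (auto simp: D_def)
    also have "energy \<mu> (ball z r) v = (\<integral>\<^sup>+w. g w * indicator (ball z r \<times> ball z r) w \<partial>joint \<mu>)"
    proof -
      have "g w * indicator (ball z r \<times> ball z r) w =
        ennreal (increment_product v v w) * indicator (ball z r \<times> ball z r) w" for w
      proof (cases "w \<in> ball z r \<times> ball z r")
        case True
        then have "w \<in> D \<times> D" using sub by blast
        then show ?thesis by (simp add: g_def)
      qed simp
      then show ?thesis by (simp add: energy_joint)
    qed
    finally show ?thesis .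
  qed
  interpret J: sigma_finite_measure "joint \<mu>" by (rule sigma_finite_joint)
  interpret P2: pair_sigma_finite "lborel :: 'a measure" "joint \<mu>" ..
  have sets1: "sets (lborel \<Otimes>\<^sub>M lborel) = sets (borel :: ('a \<times> 'a) measure)"
    by (subst borel_prod[symmetric], rule sets_pair_measure_cong) simp_all
  have sets2: "sets (lborel \<Otimes>\<^sub>M joint \<mu>) = sets (borel :: ('a \<times> 'a \<times> 'a) measure)"
    by (subst borel_prod[symmetric], rule sets_pair_measure_cong) simp_all
  have m1: "(\<lambda>(z, x). ennreal ((v x)\<^sup>2) * indicator (ball z r) x) \<in> borel_measurable (lborel \<Otimes>\<^sub>M lborel)"
  proof -
    have "open {p :: 'a \<times> 'a. dist (fst p) (snd p) < r}"
      by (intro open_Collect_less continuous_intros)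
    then have [measurable]: "{p :: 'a \<times> 'a. dist (fst p) (snd p) < r} \<in> sets (lborel \<Otimes>\<^sub>M lborel)"
      unfolding sets1 by simp
    have "(\<lambda>p. ennreal ((v (snd p))\<^sup>2) * indicator {p :: 'a \<times> 'a. dist (fst p) (snd p) < r} p)
      \<in> borel_measurable (lborel \<Otimes>\<^sub>M lborel)" by measurable
    then show ?thesis by (simp add: case_prod_beta' indicator_def)
  qed
  have m2: "(\<lambda>(z, w). g w * indicator (ball z r \<times> ball z r) w) \<in> borel_measurable (lborel \<Otimes>\<^sub>M joint \<mu>)"
  proof -
    have "open {p :: 'a \<times> 'a \<times> 'a. dist (fst p) (fst (snd p)) < r \<and> dist (fst p) (snd (snd p)) < r}"
      by (intro open_Collect_conj open_Collect_less continuous_intros)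
    then have [measurable]: "{p :: 'a \<times> 'a \<times> 'a. dist (fst p) (fst (snd p)) < r \<and> dist (fst p) (snd (snd p)) < r} \<in> sets (lborel \<Otimes>\<^sub>M joint \<mu>)"
      unfolding sets2 by simp
    have "(\<lambda>p. g (snd p) * indicator {p. dist (fst p) (fst (snd p)) < r \<and> dist (fst p) (snd (snd p)) < r} p)
      \<in> borel_measurable (lborel \<Otimes>\<^sub>M joint \<mu>)" by measurable
    then show ?thesis by (simp add: case_prod_beta' indicator_def mem_Times_iff)
  qed
  \<comment> \<open>Both sides are integrated over the centre \<open>z\<close>. On the left every
    point gets weight exactly \<open>V\<close>; on the right a pair gets weight at most
    \<open>V\<close>, since a ball containing both points contains the first. The factor
    \<open>V\<close> then cancels.\<close>
  have "V * (\<integral>\<^sup>+x. ennreal ((v x)\<^sup>2) \<partial>lborel) = (\<integral>\<^sup>+x. ennreal ((v x)\<^sup>2) * V \<partial>lborel)"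
    by (subst nn_integral_cmult[symmetric]) (auto simp: mult.commute)
  also have "\<dots> = (\<integral>\<^sup>+x. (\<integral>\<^sup>+z. ennreal ((v x)\<^sup>2) * indicator (ball z r) x \<partial>lborel) \<partial>lborel)"
  proof (rule nn_integral_cong)
    fix x
    have "(\<integral>\<^sup>+z. ennreal ((v x)\<^sup>2) * indicator (ball z r) x \<partial>lborel) = (\<integral>\<^sup>+z. ennreal ((v x)\<^sup>2) * indicator (ball x r) z \<partial>lborel)"
      by (intro nn_integral_cong) (auto simp: indicator_def dist_commute)
    then show "ennreal ((v x)\<^sup>2) * V = (\<integral>\<^sup>+z. ennreal ((v x)\<^sup>2) * indicator (ball z r) x \<partial>lborel)"
      by (simp add: nn_integral_cmult_indicator V)
  qed
  also have "\<dots> = (\<integral>\<^sup>+z. (\<integral>\<^sup>+x\<in>ball z r. ennreal ((v x)\<^sup>2) \<partial>lborel) \<partial>lborel)"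
    by (rule lborel_pair.Fubini'[OF m1])
  also have "\<dots> \<le> (\<integral>\<^sup>+z. c * (\<integral>\<^sup>+w. g w * indicator (ball z r \<times> ball z r) w \<partial>joint \<mu>) \<partial>lborel)"
    by (intro nn_integral_mono local)
  also have "\<dots> = c * (\<integral>\<^sup>+z. (\<integral>\<^sup>+w. g w * indicator (ball z r \<times> ball z r) w \<partial>joint \<mu>) \<partial>lborel)"
    by (rule nn_integral_cmult) (use J.borel_measurable_nn_integral[OF m2] in simp)
  also have "(\<integral>\<^sup>+z. (\<integral>\<^sup>+w. g w * indicator (ball z r \<times> ball z r) w \<partial>joint \<mu>) \<partial>lborel)
    = (\<integral>\<^sup>+w. (\<integral>\<^sup>+z. g w * indicator (ball z r \<times> ball z r) w \<partial>lborel) \<partial>joint \<mu>)"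
    by (rule P2.Fubini'[OF m2, symmetric])
  also have "c * \<dots> \<le> c * (\<integral>\<^sup>+w. V * g w \<partial>joint \<mu>)"
  proof (intro mult_left_mono nn_integral_mono)
    fix w :: "'a \<times> 'a"
    have "(\<integral>\<^sup>+z. g w * indicator (ball z r \<times> ball z r) w \<partial>lborel) \<le> (\<integral>\<^sup>+z. g w * indicator (ball (fst w) r) z \<partial>lborel)"
      by (intro nn_integral_mono) (auto simp: indicator_def dist_commute mem_Times_iff)
    also have "\<dots> = V * g w" by (simp add: nn_integral_cmult_indicator V mult.commute)
    finally show "(\<integral>\<^sup>+z. g w * indicator (ball z r \<times> ball z r) w \<partial>lborel) \<le> V * g w" .
  qed simp
  also have "\<dots> = V * (c * (\<integral>\<^sup>+w. g w \<partial>joint \<mu>))"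
    by (simp add: nn_integral_cmult mult_ac)
  finally show ?thesis
    using V_pos V_fin by (simp add: ennreal_mult_le_mult_iff c_def g_def D_def)
qed

text \<open>De Giorgi iteration over the sets where \<open>\<epsilon> * (\<psi> - t) > u\<close>, with one fixed cutoff \<open>\<psi>\<close> and \<open>t\<close>
  increasing from \<open>0\<close> to \<open>1/2\<close>.\<close>

lemma positivity_from_small_sublevel:
  assumes poin: "poincare_inequality \<alpha> \<mu> E C\<^sub>1" and C\<^sub>1: "0 \<le> C\<^sub>1"
    and R: "0 < R" and ball: "cball x\<^sub>0 R \<subseteq> E" and super: "borel_supersolution \<mu> E u"
    and pos: "\<And>x. x \<in> ball x\<^sub>0 R \<Longrightarrow> 0 \<le> u x" and \<epsilon>: "0 < \<epsilon>"
    and neg: "AE x in lborel. x \<in> ball x\<^sub>0 (3/4 * R) \<longrightarrow>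
      (\<integral>\<^sup>+y\<in>- ball x\<^sub>0 R. ennreal (- u y) \<partial>\<mu> x) \<le> ennreal (\<epsilon> * R powr - \<alpha>)"
    and \<nu>: "0 < \<nu>" "2 * \<nu> * 8 ^ DIM('a) \<le> 1"
    and \<nu>_small: "16 * (12 * C\<^sub>1 * energy_const \<alpha> C * 2 powr (\<alpha> / DIM('a))) * \<nu> powr (\<alpha> / DIM('a)) \<le> 4 powr (- 1 / (\<alpha> / DIM('a)))"
    and sublevel: "measure lborel {x \<in> ball x\<^sub>0 R. u x < \<epsilon>} \<le> \<nu> * measure lborel (ball x\<^sub>0 R)"
  shows "AE x in lborel. x \<in> ball x\<^sub>0 (R/2) \<longrightarrow> \<epsilon>/2 \<le> u x"
proof -
  define N where "N = DIM('a)"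
  define \<sigma> where "\<sigma> = \<alpha> / N"
  define K where "K = 12 * C\<^sub>1 * energy_const \<alpha> C * 2 powr \<sigma>"
  define D where "D = ball x\<^sub>0 R"
  define \<psi> where "\<psi> = cutoff x\<^sub>0 R"
  have N: "0 < N" by (simp add: N_def)
  have u [measurable]: "u \<in> borel_measurable borel" and uH: "u \<in> H_loc \<mu> E"
    using super by (auto simp: borel_supersolution_def)
  have [measurable]: "D \<in> sets borel" "\<psi> \<in> borel_measurable borel" by (auto simp: D_def \<psi>_def)
  define \<phi> where "\<phi> t x = max 0 (\<epsilon> * (\<psi> x - t) - max 0 (u x))" for t x
  define S where "S t = {x \<in> ball x\<^sub>0 (3/4 * R). \<phi> t x \<noteq> 0}" for t
  define b where "b = measure lborel D"
  define a where "a t = measure lborel (S t) / b" for t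
  have \<phi>m [measurable]: "\<phi> t \<in> borel_measurable borel" for t unfolding \<phi>_def by measurable
  have Sm [measurable]: "S t \<in> sets borel" for t unfolding S_def by measurable
  have b_eq: "b = unit_ball_vol N * R ^ N" using R by (simp add: b_def D_def N_def content_ball)
  have ub: "0 < unit_ball_vol N" by simp
  have b: "0 < b" using R by (simp add: b_eq)
  have Df: "D \<in> fmeasurable lborel"
    using emeasure_lborel_ball_finite by (intro fmeasurableI) (auto simp: D_def)
  have SD: "S t \<subseteq> D" for t using R by (auto simp: S_def D_def)
  have Sf: "S t \<in> fmeasurable lborel" for t by (rule fmeasurableI2[OF Df SD]) simp
  have S_iff: "x \<in> S t \<longleftrightarrow> x \<in> ball x\<^sub>0 (3/4 * R) \<and> max 0 (u x) < \<epsilon> * (\<psi> x - t)" for x t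
    by (auto simp: S_def \<phi>_def simp del: mem_ball max_less_iff_conj)
  have S_anti: "S t \<subseteq> S s" if "s \<le> t" for s t
  proof
    fix x assume x: "x \<in> S t"
    have "\<epsilon> * (\<psi> x - t) \<le> \<epsilon> * (\<psi> x - s)" using that \<epsilon> by (intro mult_left_mono) auto
    then show "x \<in> S s" using x unfolding S_iff by (meson less_le_trans)
  qed
  have a_eq: "measure lborel (S t) = a t * b" for t using b by (simp add: a_def)
  have a_mono: "a t \<le> a s" if "s \<le> t" for s t
    unfolding a_def using b S_anti[OF that] by (intro divide_right_mono measure_mono_fmeasurable Sf) auto
  have \<phi>_nn: "0 \<le> \<phi> t x" for t x by (simp add: \<phi>_def)
  have step: "d\<^sup>2 * a (t + d) \<le> K * a t powr (1 + \<sigma>)" if t: "0 \<le> t" and d: "0 < d" and le: "a t \<le> \<nu>" for t d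
  proof (cases "a t = 0")
    case True
    then have "a (t + d) = 0"
      using a_mono[of t "t + d"] d b by (intro antisym) (auto simp: a_def)
    then show ?thesis using True by simp
  next
    case False
    then have at: "0 < a t" using b by (simp add: a_def less_le)
    \<comment> \<open>The ball of radius \<open>r\<close> has exactly twice the measure of
      \<open>S t\<close>, as \<open>faber_krahn\<close> requires. The bounds
      \<open>a t \<le> \<nu>\<close> and \<open>2 * \<nu> * 8 ^ N \<le> 1\<close> keep
      \<open>r\<close> at most \<open>R/8\<close>.\<close>
    define r where "r = R * (2 * a t) powr (1 / N)"
    have r: "0 < r" using R at by (simp add: r_def)
    have rN: "r ^ N = R ^ N * (2 * a t)"
      using at N by (simp add: r_def power_mult_distrib powr_powr flip: powr_realpow)
    have "2 * a t * 8 ^ N \<le> 2 * \<nu> * 8 ^ N" using le by (intro mult_right_mono) auto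
    also have "\<dots> \<le> 1" using \<nu>(2) by (simp add: N_def)
    finally have "2 * a t \<le> (1/8) ^ N" by (simp add: power_one_over pos_le_divide_eq)
    then have "(2 * a t) powr (1/N) \<le> ((1/8) ^ N) powr (1/N)"
      using at by (intro powr_mono2) auto
    also have "\<dots> = 1/8" using N by (simp add: powr_powr flip: powr_realpow)
    finally have r8: "r \<le> R/8" using R by (simp add: r_def mult_left_mono)
    have supp: "\<phi> t x = 0" if "x \<notin> ball x\<^sub>0 (3/4 * R)" for x
    proof -
      have "\<epsilon> * (\<psi> x - t) \<le> 0"
        using cutoff_eq_0[OF R that] t \<epsilon> by (intro mult_nonneg_nonpos) (auto simp: \<psi>_def)
      then show ?thesis unfolding \<phi>_def by linarith
    qed
    have S_eq: "S t = {x. \<phi> t x \<noteq> 0}" using supp by (auto simp: S_def)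
    have \<phi>_le: "\<phi> t x \<le> \<epsilon>" for x
    proof -
      have "\<epsilon> * (\<psi> x - t) \<le> \<epsilon> * 1"
        using \<epsilon> t cutoff_le_1[of x\<^sub>0 R x] by (intro mult_left_mono) (auto simp: \<psi>_def)
      then show ?thesis unfolding \<phi>_def using \<epsilon> by linarith
    qed
    have u_le: "u x \<le> \<epsilon>" if "x \<in> S t" for x
    proof -
      have "max 0 (u x) < \<epsilon> * (\<psi> x - t)" using that S_iff by blast
      moreover have "\<epsilon> * (\<psi> x - t) \<le> \<epsilon> * 1"
        using \<epsilon> t cutoff_le_1[of x\<^sub>0 R x] by (intro mult_left_mono) (auto simp: \<psi>_def)
      ultimately show ?thesis by linarith
    qed
    have lip: "\<bar>\<phi> t y - \<phi> t x\<bar> \<le> (1 + \<epsilon>) * (\<bar>u y - u x\<bar> + \<bar>\<psi> y - \<psi> x\<bar>)" for x y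
    proof -
      have "\<bar>\<phi> t y - \<phi> t x\<bar> \<le> \<bar>\<epsilon> * (\<psi> y - \<psi> x)\<bar> + \<bar>u y - u x\<bar>"
        by (auto simp: \<phi>_def max_def algebra_simps)
      also have "\<dots> \<le> (1 + \<epsilon>) * \<bar>\<psi> y - \<psi> x\<bar> + (1 + \<epsilon>) * \<bar>u y - u x\<bar>"
      proof (rule add_mono)
        show "\<bar>\<epsilon> * (\<psi> y - \<psi> x)\<bar> \<le> (1 + \<epsilon>) * \<bar>\<psi> y - \<psi> x\<bar>"
          unfolding abs_mult using \<epsilon> by (intro mult_right_mono) auto
        show "\<bar>u y - u x\<bar> \<le> (1 + \<epsilon>) * \<bar>u y - u x\<bar>"
          using \<epsilon> mult_right_mono[of 1 "1 + \<epsilon>" "\<bar>u y - u x\<bar>"] by simp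
      qed
      finally show ?thesis by (simp add: algebra_simps)
    qed
    let ?h = "\<lambda>z. increment_product (\<phi> t) (\<phi> t) z / 2"
    have key: "increment_product u (\<phi> t) (x, y) \<le>
      \<epsilon>\<^sup>2 * (\<psi> y - \<psi> x)\<^sup>2 * of_bool (x \<in> S t \<or> y \<in> S t) - ?h (x, y)" if "x \<in> D" "y \<in> D" for x y
    proof (cases "x \<in> S t \<or> y \<in> S t")
      case False
      then show ?thesis by (simp add: S_eq increment_product_def)
    next
      case True
      define p where "p = \<phi> t y - \<phi> t x"
      define k where "k = \<epsilon> * (\<psi> y - \<psi> x)"
      define f where "f w = \<epsilon> * (\<psi> w - t) - u w" for w
      have \<phi>f: "\<phi> t w = max 0 (f w)" if "w \<in> D" for w
        using pos[of w] that by (simp add: \<phi>_def f_def D_def)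
      have "p * p \<le> (f y - f x) * p"
        unfolding p_def \<phi>f[OF that(1)] \<phi>f[OF that(2)] by (rule square_positive_part_le)
      \<comment> \<open>The increment of \<open>u\<close> is that of
        \<open>\<epsilon> * \<psi>\<close> minus that of the untruncated \<open>f\<close>. By
        Young's inequality half of the energy of \<open>\<phi> t\<close> absorbs the mixed term, and
        only the cutoff remains.\<close>
      moreover have "u y - u x = k - (f y - f x)" by (simp add: f_def k_def algebra_simps)
      ultimately have "(u y - u x) * p \<le> k * p - p * p" by (simp add: left_diff_distrib)
      also have "k * p \<le> k\<^sup>2 / 2 + p * p / 2" using sum_squares_bound[of k p] by (simp add: power2_eq_square)
      finally have "(u y - u x) * p \<le> k\<^sup>2 - p * p / 2" using zero_le_power2[of k] by linarith
      then show ?thesis using True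
        by (simp add: increment_product_def p_def k_def power_mult_distrib)
    qed
    have "(\<integral>\<^sup>+z\<in>ball x\<^sub>0 R \<times> ball x\<^sub>0 R. ennreal (?h z) \<partial>joint \<mu>) \<le> ennreal (\<epsilon>\<^sup>2 * energy_const \<alpha> C * R powr - \<alpha>) * emeasure lborel (S t)"
    proof (rule energy_estimate[OF R ball super pos \<epsilon> neg])
      show "S t \<subseteq> ball x\<^sub>0 (3/4 * R)" by (auto simp: S_def)
      show "\<phi> t x = 0" if "x \<notin> S t" for x using that by (simp add: S_eq)
      show "\<epsilon> * \<phi> t x \<le> \<epsilon>\<^sup>2" for x using \<phi>_le \<epsilon> by (simp add: power2_eq_square)
      show "u x * \<phi> t x \<le> \<epsilon>\<^sup>2" if "x \<in> S t" for x
      proof -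
        have "u x * \<phi> t x \<le> \<epsilon> * \<phi> t x" using u_le[OF that] \<phi>_nn by (rule mult_right_mono)
        also have "\<dots> \<le> \<epsilon> * \<epsilon>" using \<phi>_le \<epsilon> by (intro mult_left_mono) auto
        finally show ?thesis by (simp add: power2_eq_square)
      qed
      show "\<bar>\<phi> t y - \<phi> t x\<bar> \<le> (1 + \<epsilon>) * (\<bar>u y - u x\<bar> + \<bar>cutoff x\<^sub>0 R y - cutoff x\<^sub>0 R x\<bar>)" for x y
        using lip by (simp add: \<psi>_def)
    qed (use key \<phi>_nn in \<open>auto simp: D_def \<psi>_def increment_product_self\<close>)
    moreover have "(\<integral>\<^sup>+z\<in>ball x\<^sub>0 R \<times> ball x\<^sub>0 R. ennreal (increment_product (\<phi> t) (\<phi> t) z) \<partial>joint \<mu>) =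
      2 * (\<integral>\<^sup>+z\<in>ball x\<^sub>0 R \<times> ball x\<^sub>0 R. ennreal (?h z) \<partial>joint \<mu>)"
    proof -
      have [measurable]: "ball x\<^sub>0 R \<times> ball x\<^sub>0 R \<in> sets borel" by (auto intro!: borel_Times)
      have "ennreal (increment_product (\<phi> t) (\<phi> t) z) = 2 * ennreal (?h z)" for z
        by (simp add: ennreal_numeral_mult)
      then show ?thesis by (subst nn_integral_cmult[symmetric]) (auto simp: mult.assoc)
    qed
    ultimately have en: "(\<integral>\<^sup>+z\<in>ball x\<^sub>0 R \<times> ball x\<^sub>0 R. ennreal (increment_product (\<phi> t) (\<phi> t) z) \<partial>joint \<mu>) \<le>
       2 * (ennreal (\<epsilon>\<^sup>2 * energy_const \<alpha> C * R powr - \<alpha>) * emeasure lborel (S t))"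
      by (simp add: mult_left_mono)
    have test: "\<phi> t \<in> test_functions \<mu> E"
      by (rule test_function_lipschitz[OF R ball uH u \<phi>m Sm _ \<phi>_nn _ \<phi>_le])
        (use lip supp in \<open>auto simp: S_def \<psi>_def\<close>)
    have fk: "(\<integral>\<^sup>+x. ennreal ((\<phi> t x)\<^sup>2) \<partial>lborel) \<le> ennreal (6 * C\<^sub>1 * r powr \<alpha>) *
        (\<integral>\<^sup>+z\<in>ball x\<^sub>0 R \<times> ball x\<^sub>0 R. ennreal (increment_product (\<phi> t) (\<phi> t) z) \<partial>joint \<mu>)"
    proof (rule faber_krahn[OF poin C\<^sub>1 test_function_in_H_loc[OF test] \<phi>m R _ r r8 supp])
      show "ball x\<^sub>0 R \<subseteq> E" using ball ball_subset_cball by blast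
      have "measure lborel (ball x\<^sub>0 r) = unit_ball_vol N * r ^ N"
        using r by (simp add: content_ball N_def)
      then show "measure lborel {x. \<phi> t x \<noteq> 0} \<le> measure lborel (ball x\<^sub>0 r) / 2"
        using a_eq[of t] by (simp add: S_eq rN b_eq)
    qed
    \<comment> \<open>Chebyshev: on the next sublevel set the truncation at the old level is at
      least \<open>\<epsilon> * d\<close>.\<close>
    have "ennreal ((\<epsilon> * d)\<^sup>2) * emeasure lborel (S (t + d)) = (\<integral>\<^sup>+x. ennreal ((\<epsilon> * d)\<^sup>2) * indicator (S (t + d)) x \<partial>lborel)"
      by (simp add: nn_integral_cmult_indicator)
    also have "\<dots> \<le> (\<integral>\<^sup>+x. ennreal ((\<phi> t x)\<^sup>2) \<partial>lborel)"
    proof (rule nn_integral_mono)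
      fix x
      have "(\<epsilon> * d)\<^sup>2 \<le> (\<phi> t x)\<^sup>2" if "x \<in> S (t + d)"
      proof (rule power_mono)
        have "max 0 (u x) < \<epsilon> * (\<psi> x - (t + d))" using that S_iff by blast
        then show "\<epsilon> * d \<le> \<phi> t x" by (simp add: \<phi>_def algebra_simps)
      qed (use \<epsilon> d in simp)
      then show "ennreal ((\<epsilon> * d)\<^sup>2) * indicator (S (t + d)) x \<le> ennreal ((\<phi> t x)\<^sup>2)"
        by (auto simp: indicator_def ennreal_leI)
    qed
    also note fk
    also have "ennreal (6 * C\<^sub>1 * r powr \<alpha>) * (\<integral>\<^sup>+z\<in>ball x\<^sub>0 R \<times> ball x\<^sub>0 R. ennreal (increment_product (\<phi> t) (\<phi> t) z) \<partial>joint \<mu>)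
      \<le> ennreal (6 * C\<^sub>1 * r powr \<alpha>) * (2 * (ennreal (\<epsilon>\<^sup>2 * energy_const \<alpha> C * R powr - \<alpha>) * emeasure lborel (S t)))"
      by (rule mult_left_mono[OF en]) simp
    also have "\<dots> = ennreal (6 * C\<^sub>1 * r powr \<alpha> * (2 * (\<epsilon>\<^sup>2 * energy_const \<alpha> C * R powr - \<alpha> * measure lborel (S t))))"
    proof -
      have nn: "0 \<le> 2 * (\<epsilon>\<^sup>2 * energy_const \<alpha> C * R powr - \<alpha> * measure lborel (S t))"
        using energy_const_pos by simp
      show ?thesis
        using Sf[of t] unfolding emeasure_eq_measure2[OF Sf]
        by (simp only: ennreal_mult''[symmetric] measure_nonneg ennreal_numeral_mult nn)
    qed
    finally have "ennreal ((\<epsilon> * d)\<^sup>2 * measure lborel (S (t + d))) \<le>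
       ennreal (6 * C\<^sub>1 * r powr \<alpha> * (2 * (\<epsilon>\<^sup>2 * energy_const \<alpha> C * R powr - \<alpha> * measure lborel (S t))))"
      using Sf by (simp add: emeasure_eq_measure2 ennreal_mult'')
    then have "(\<epsilon> * d)\<^sup>2 * measure lborel (S (t + d)) \<le> 6 * C\<^sub>1 * r powr \<alpha> * (2 * (\<epsilon>\<^sup>2 * energy_const \<alpha> C * R powr - \<alpha> * measure lborel (S t)))"
      using C\<^sub>1 energy_const_pos by (subst (asm) ennreal_le_iff) auto
    then have "(\<epsilon>\<^sup>2 * b) * (d\<^sup>2 * a (t + d)) \<le> (\<epsilon>\<^sup>2 * b) * (12 * C\<^sub>1 * energy_const \<alpha> C * (r powr \<alpha> * R powr - \<alpha>) * a t)"
      by (simp add: a_eq power_mult_distrib mult_ac)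
    then have "d\<^sup>2 * a (t + d) \<le> 12 * C\<^sub>1 * energy_const \<alpha> C * (r powr \<alpha> * R powr - \<alpha>) * a t"
      by (rule mult_left_le_imp_le) (use \<epsilon> b in simp)
    \<comment> \<open>The choice of \<open>r\<close> turns the Poincare factor into a power of the
      measure fraction; this is the superlinear gain \<open>\<sigma> = \<alpha> / N\<close>.\<close>
    also have "r powr \<alpha> * R powr - \<alpha> = 2 powr \<sigma> * a t powr \<sigma>"
      using R at by (simp add: r_def powr_mult powr_powr powr_minus \<sigma>_def field_simps)
    also have "12 * C\<^sub>1 * energy_const \<alpha> C * (2 powr \<sigma> * a t powr \<sigma>) * a t = K * a t powr (1 + \<sigma>)"
      using at by (simp add: K_def powr_add)
    finally show ?thesis .
  qed
  have "a (1/2) = 0"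
  proof (rule de_giorgi_decay[where \<nu> = \<nu> and K = K and \<sigma> = \<sigma>])
    show "0 \<le> a t" for t using b by (simp add: a_def)
    show "0 < \<sigma>" using alpha_pos N by (simp add: \<sigma>_def)
    show "0 \<le> K" using C\<^sub>1 energy_const_pos by (simp add: K_def)
    have "S 0 \<subseteq> {x \<in> D. u x < \<epsilon>}"
    proof
      fix x assume x: "x \<in> S 0"
      then have "max 0 (u x) < \<epsilon> * (\<psi> x - 0)" using S_iff by blast
      then have "max 0 (u x) < \<epsilon> * \<psi> x" by simp
      moreover have "\<epsilon> * \<psi> x \<le> \<epsilon> * 1"
        using \<epsilon> cutoff_le_1[of x\<^sub>0 R x] by (intro mult_left_mono) (auto simp: \<psi>_def)
      ultimately show "x \<in> {x \<in> D. u x < \<epsilon>}" using x SD by auto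
    qed
    then have "measure lborel (S 0) \<le> measure lborel {x \<in> D. u x < \<epsilon>}"
      by (intro measure_mono_fmeasurable fmeasurableI2[OF Df]) auto
    also have "\<dots> \<le> \<nu> * b" using sublevel by (simp add: b_def D_def)
    finally show "a 0 \<le> \<nu>" using b by (simp add: a_def field_simps)
    show "16 * K * \<nu> powr \<sigma> \<le> 4 powr (- 1 / \<sigma>)" using \<nu>_small by (simp add: K_def \<sigma>_def N_def)
  qed (use step a_mono \<nu> in auto)
  then have "emeasure lborel (S (1/2)) = 0"
    using a_eq[of "1/2"] Sf[of "1/2"] by (simp add: emeasure_eq_measure2)
  then have "AE x in lborel. x \<notin> S (1/2)"
    by (intro AE_not_in) (simp add: null_sets_def)
  then show ?thesis
  proof eventually_elim
    case (elim x)
    show ?case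
    proof
      assume x: "x \<in> ball x\<^sub>0 (R/2)"
      then have "x \<in> ball x\<^sub>0 (3/4 * R)" "x \<in> ball x\<^sub>0 R" using R by auto
      \<comment> \<open>The cutoff is 1 on the half ball, so vanishing at level \<open>1/2\<close>
        means that \<open>u\<close> is at least \<open>\<epsilon>/2\<close> there.\<close>
      then have "\<phi> (1/2) x = 0" using elim by (simp add: S_def)
      then show "\<epsilon>/2 \<le> u x"
        using cutoff_eq_1[OF R x] pos[OF \<open>x \<in> ball x\<^sub>0 R\<close>] by (auto simp: \<phi>_def \<psi>_def max_def split: if_splits)
    qed
  qed
qed

end

section \<open>Oscillation decay\<close>

text \<open>With \<open>A\<close> and \<open>B\<close> the square roots of \<open>a \<le> b\<close>,
  the one-sided bound \<open>(B - A) / A\<close> is made symmetric by the factor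
  \<open>(A + B) / B \<ge> 1\<close>: the product is \<open>(b - a) / (A * B)\<close>.\<close>

lemma ln_diff_square_le:
  fixes a b :: real
  assumes "0 < a" "0 < b"
  shows "(ln b - ln a)\<^sup>2 \<le> 4 * ((b - a)\<^sup>2 / (a * b))"
proof -
  have *: "(ln b - ln a)\<^sup>2 \<le> 4 * ((b - a)\<^sup>2 / (a * b))" if "0 < a" "a \<le> b" for a b :: real
  proof -
    define A B where "A = sqrt a" and "B = sqrt b"
    have A: "0 < A" "A \<le> B" "a = A\<^sup>2" "b = B\<^sup>2" using that by (auto simp: A_def B_def)
    have "ln b - ln a = 2 * ln (B / A)" using A by (simp add: ln_div ln_realpow)
    also have "\<dots> \<le> 2 * (B / A - 1)" using A by (intro mult_left_mono ln_le_minus_one) auto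
    also have "\<dots> = 2 * ((B - A) / A)" using A by (simp add: field_simps)
    finally have "(ln b - ln a)\<^sup>2 \<le> (2 * ((B - A) / A))\<^sup>2" using that by (intro power_mono) auto
    also have "\<dots> = 4 * ((B - A) / A)\<^sup>2 * 1" unfolding power_mult_distrib by simp
    also have "\<dots> \<le> 4 * ((B - A) / A)\<^sup>2 * ((A + B) / B)\<^sup>2"
      using A by (intro mult_left_mono) (auto simp: one_le_power)
    also have "\<dots> = 4 * ((b - a)\<^sup>2 / (a * b))"
      using A by (simp add: power2_eq_square field_simps)
    finally show ?thesis .
  qed
  show ?thesis
  proof (cases "a \<le> b")
    case False
    then show ?thesis using *[of b a] assms by (simp add: power2_commute mult.commute)
  qed (use * assms in auto)
qed

lemma abs_ln_diff_le:
  fixes a b :: real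
  assumes "e \<le> a" "e \<le> b" "0 < e"
  shows "\<bar>ln b - ln a\<bar> \<le> \<bar>b - a\<bar> / e"
proof -
  have *: "ln b - ln a \<le> \<bar>b - a\<bar> / e" if "e \<le> a" "e \<le> b" for a b
  proof -
    have "ln b - ln a = ln (b / a)" using that assms by (simp add: ln_div)
    also have "\<dots> \<le> b / a - 1" using that assms by (intro ln_le_minus_one) auto
    also have "\<dots> = (b - a) / a" using that assms by (simp add: field_simps)
    also have "\<dots> \<le> \<bar>b - a\<bar> / a" using that assms by (intro divide_right_mono) auto
    also have "\<dots> \<le> \<bar>b - a\<bar> / e" using that assms by (intro divide_left_mono) auto
    finally show ?thesis .
  qed
  show ?thesis using *[of a b] *[of b a] assms by (auto simp: abs_le_iff abs_minus_commute)
qed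

text \<open>An identity of Picone type. With \<open>a\<close>, \<open>b\<close> the values of
  \<open>u + \<epsilon>\<close> and \<open>p\<close>, \<open>q\<close> those of the cutoff, the
  mixed terms cancel, leaving the increment of the cutoff and a remainder of good sign. Where
  \<open>p = q = 1\<close> the remainder is \<open>(b - a)\<^sup>2 / (a * b)\<close>, which
  dominates the squared increment of the logarithm.\<close>

lemma log_test_identity:
  fixes a b p q :: real
  assumes "0 < a" "0 < b"
  shows "(b - a) * (q\<^sup>2 / b - p\<^sup>2 / a) = (q - p)\<^sup>2 - a * b * (q / b - p / a)\<^sup>2"
  using assms by (simp add: power2_eq_square field_simps)

text \<open>The exponent \<beta> with \<open>q powr \<beta> = 1 - \<delta>\<close>: a radius smaller
  by \<open>q\<close> means an oscillation smaller by \<open>1 - \<delta>\<close>.\<close>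

definition holder_exponent :: "real \<Rightarrow> real \<Rightarrow> real" where
  "holder_exponent \<delta> q = ln (1 - \<delta>) / ln q"

text \<open>\<open>max 2 (2/\<epsilon>)\<close> is the width of the initial bracket relative to the
  data. \<open>8 / (7 * q)\<close> pays for starting at radius \<open>7/8 * R\<close> and for
  replacing a given radius by a neighbouring one of the form
  \<open>q ^ j * (7/8 * R)\<close>.\<close>

definition holder_factor :: "real \<Rightarrow> real \<Rightarrow> real \<Rightarrow> real" where
  "holder_factor \<epsilon> \<delta> q = max 2 (2/\<epsilon>) * (8 / (7 * q)) powr holder_exponent \<delta> q"

context
  fixes \<epsilon> \<delta> q :: real
  assumes delta: "0 < \<delta>" "\<delta> \<le> \<epsilon>/4" and q: "0 < q" "q \<le> 1/4" and eps: "\<epsilon> < 1/2"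
begin

lemma holder_exponent_pos: "0 < holder_exponent \<delta> q"
  using delta q eps by (auto simp: holder_exponent_def intro!: divide_neg_neg)

lemma holder_exponent_less_1: "holder_exponent \<delta> q < 1"
proof -
  have "q < 1 - \<delta>" using q delta eps by auto
  then have "ln q < ln (1 - \<delta>)" using q by auto
  moreover have "ln q < 0" using q by auto
  ultimately show ?thesis by (simp add: holder_exponent_def divide_less_eq)
qed

lemma holder_factor_gt_1: "1 < holder_factor \<epsilon> \<delta> q"
proof -
  have "1 \<le> (8 / (7 * q)) powr holder_exponent \<delta> q"
    using q holder_exponent_pos by (intro ge_one_powr_ge_zero) auto
  then have "2 * 1 \<le> holder_factor \<epsilon> \<delta> q" unfolding holder_factor_def by (intro mult_mono) auto
  then show ?thesis by simp
qed

end

text \<open>\<open>\<nu>\<close> is the density threshold of the De Giorgi iteration, \<open>\<epsilon>\<close> twice the lower bound that the growth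
  lemma produces, \<open>\<delta>\<close> the relative decrease of the oscillation when the radius is multiplied by \<open>q\<close>.\<close>

locale regularity_setting = symmetric_decay_kernel \<mu> \<alpha> C
  for \<mu> :: "'a::euclidean_space \<Rightarrow> 'a measure" and \<alpha> C +
  fixes E :: "'a set" and C\<^sub>1 \<nu> \<epsilon> \<delta> q :: real
  assumes poincare: "poincare_inequality \<alpha> \<mu> E C\<^sub>1" and C1: "1 \<le> C\<^sub>1" and bounded_E: "bounded E"
    and nu: "0 < \<nu>" "2 * \<nu> * 8 ^ DIM('a) \<le> 1"
      "16 * (12 * C\<^sub>1 * energy_const \<alpha> C * 2 powr (\<alpha> / DIM('a))) * \<nu> powr (\<alpha> / DIM('a)) \<le> 4 powr (- 1 / (\<alpha> / DIM('a)))"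
    and eps: "0 < \<epsilon>" "\<epsilon> < 1/2" "24 * C\<^sub>1 * energy_const \<alpha> C * (3/2) ^ DIM('a) \<le> \<nu> * (ln (2 * \<epsilon>))\<^sup>2"
    and delta: "0 < \<delta>" "\<delta> \<le> \<epsilon>/4"
    and q: "0 < q" "q \<le> 1/4" "\<epsilon>/2 * q powr \<alpha> + \<delta> * C * 4 powr \<alpha> \<le> \<epsilon>/2 * (1 - \<delta>)"
begin

text \<open>The truncated logarithm \<open>v\<close> vanishes where \<open>u \<ge> 1\<close>, hence
  on at least half of the ball, so its energy bound becomes a bound on its square integral. Where
  \<open>u < \<epsilon>\<close> it is at least \<open>- ln (2 * \<epsilon>)\<close>, and the third
  condition on \<epsilon> makes this large enough for Chebyshev to give the threshold
  \<open>\<nu>\<close>.\<close>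

lemma small_sublevel:
  assumes R: "0 < R" and ball: "cball x\<^sub>0 R \<subseteq> E" and super: "borel_supersolution \<mu> E u"
    and pos: "\<And>x. x \<in> ball x\<^sub>0 R \<Longrightarrow> 0 \<le> u x"
    and neg: "AE x in lborel. x \<in> ball x\<^sub>0 (3/4 * R) \<longrightarrow>
      (\<integral>\<^sup>+y\<in>- ball x\<^sub>0 R. ennreal (- u y) \<partial>\<mu> x) \<le> ennreal (\<epsilon> * R powr - \<alpha>)"
    and half: "measure lborel {x \<in> ball x\<^sub>0 (R/2). u x < 1} \<le> measure lborel (ball x\<^sub>0 (R/2)) / 2"
  shows "measure lborel {x \<in> ball x\<^sub>0 (R/2). u x < \<epsilon>} \<le> \<nu> * measure lborel (ball x\<^sub>0 (R/2))"
proof -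
  define D where "D = ball x\<^sub>0 R"
  define B where "B = ball x\<^sub>0 (R/2)"
  define S where "S = ball x\<^sub>0 (3/4 * R)"
  define \<psi> where "\<psi> = cutoff x\<^sub>0 R"
  \<comment> \<open>This is \<open>u + \<epsilon>\<close> on the ball; the truncation keeps it at
    least \<open>\<epsilon>\<close> on the whole space, so that quotients by it are harmless
    everywhere.\<close>
  define w where "w x = max 0 (u x) + \<epsilon>" for x
  have u [measurable]: "u \<in> borel_measurable borel" and uH: "u \<in> H_loc \<mu> E"
    using super by (auto simp: borel_supersolution_def)
  have [measurable]: "D \<in> sets borel" "B \<in> sets borel" "S \<in> sets borel" "\<psi> \<in> borel_measurable borel"
    by (auto simp: D_def \<psi>_def B_def S_def)
  have [measurable]: "B \<times> B \<in> sets borel" "D \<times> D \<in> sets borel" by (auto intro!: borel_Times)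
  have [measurable]: "w \<in> borel_measurable borel" unfolding w_def by measurable
  have w: "\<epsilon> \<le> w x" "0 < w x" for x using eps(1) by (simp_all add: w_def add_nonneg_pos)
  have wD: "w x = u x + \<epsilon>" if "x \<in> D" for x using pos that by (simp add: w_def D_def)
  have BS: "B \<subseteq> S" and SD: "S \<subseteq> D" using R by (auto simp: B_def S_def D_def)
  have \<psi>B: "\<psi> x = 1" if "x \<in> B" for x using cutoff_eq_1[OF R] that by (simp add: \<psi>_def B_def)
  have \<psi>S: "\<psi> x = 0" if "x \<notin> S" for x using cutoff_eq_0[OF R] that by (simp add: \<psi>_def S_def)
  have \<psi>01: "0 \<le> \<psi> x" "\<psi> x \<le> 1" for x by (simp_all add: \<psi>_def cutoff_nonneg cutoff_le_1)
  define \<phi> where "\<phi> x = (\<psi> x)\<^sup>2 / w x" for x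
  \<comment> \<open>The remainder in \<open>log_test_identity\<close>, kept only where the cutoff is
    1 at both points.\<close>
  define h where "h z = indicator (B \<times> B) z * ((w (snd z) - w (fst z))\<^sup>2 / (w (fst z) * w (snd z)))" for z
  have [measurable]: "\<phi> \<in> borel_measurable borel" "h \<in> borel_measurable borel"
    unfolding \<phi>_def h_def by measurable
  have \<phi>_w: "w x * \<phi> x \<le> 1" for x
    using w[of x] \<psi>01[of x] by (simp add: \<phi>_def power_le_one)
  have \<phi>_nn: "0 \<le> \<phi> x" for x using w[of x] by (simp add: \<phi>_def)
  have "(\<integral>\<^sup>+z\<in>ball x\<^sub>0 R \<times> ball x\<^sub>0 R. ennreal (h z) \<partial>joint \<mu>) \<le> ennreal (1 * energy_const \<alpha> C * R powr - \<alpha>) * emeasure lborel S"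
  proof (rule energy_estimate[OF R ball super pos eps(1) neg, where L = "2 / \<epsilon> + 1 / \<epsilon>\<^sup>2"])
    show "\<phi> x = 0" if "x \<notin> S" for x using \<psi>S[OF that] by (simp add: \<phi>_def)
    show "\<epsilon> * \<phi> x \<le> 1" for x
      using mult_right_mono[OF w(1)[of x] \<phi>_nn[of x]] \<phi>_w[of x] by simp
    show "u x * \<phi> x \<le> 1" for x
    proof -
      have "u x \<le> w x" using eps(1) by (simp add: w_def)
      then show ?thesis using mult_right_mono[OF _ \<phi>_nn[of x], of "u x" "w x"] \<phi>_w[of x] by simp
    qed
    show "S \<subseteq> ball x\<^sub>0 (3/4 * R)" by (simp add: S_def)
    show "0 \<le> h z" for z using w by (simp add: h_def less_imp_le)
    fix x y assume "x \<in> ball x\<^sub>0 R" "y \<in> ball x\<^sub>0 R"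
    then have xy: "x \<in> D" "y \<in> D" by (simp_all add: D_def)
    have uw: "u y - u x = w y - w x" using xy by (simp add: wD)
    have "\<phi> y - \<phi> x = ((\<psi> y)\<^sup>2 - (\<psi> x)\<^sup>2) / w y - (\<psi> x)\<^sup>2 * ((w y - w x) / (w x * w y))"
      using w(2)[of x] w(2)[of y] by (simp add: \<phi>_def field_simps)
    also have "\<bar>\<dots>\<bar> \<le> \<bar>((\<psi> y)\<^sup>2 - (\<psi> x)\<^sup>2) / w y\<bar> + \<bar>(\<psi> x)\<^sup>2 * ((w y - w x) / (w x * w y))\<bar>"
      by (rule abs_triangle_ineq4)
    also have "\<dots> \<le> 2 / \<epsilon> * \<bar>\<psi> y - \<psi> x\<bar> + 1 / \<epsilon>\<^sup>2 * \<bar>u y - u x\<bar>"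
    proof (rule add_mono)
      have "\<bar>(\<psi> y)\<^sup>2 - (\<psi> x)\<^sup>2\<bar> = (\<psi> y + \<psi> x) * \<bar>\<psi> y - \<psi> x\<bar>"
        using \<psi>01[of x] \<psi>01[of y] by (simp add: power2_eq_square square_diff_square_factored abs_mult)
      also have "\<dots> \<le> 2 * \<bar>\<psi> y - \<psi> x\<bar>"
        using \<psi>01[of x] \<psi>01[of y] by (intro mult_right_mono) auto
      finally have "\<bar>(\<psi> y)\<^sup>2 - (\<psi> x)\<^sup>2\<bar> / w y \<le> 2 * \<bar>\<psi> y - \<psi> x\<bar> / \<epsilon>"
        using w[of y] eps(1) by (intro frac_le) auto
      then show "\<bar>((\<psi> y)\<^sup>2 - (\<psi> x)\<^sup>2) / w y\<bar> \<le> 2 / \<epsilon> * \<bar>\<psi> y - \<psi> x\<bar>"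
        using w(2)[of y] by (simp add: abs_divide)
      have "\<bar>w y - w x\<bar> / (w x * w y) \<le> \<bar>w y - w x\<bar> / (\<epsilon> * \<epsilon>)"
        using w[of x] w[of y] eps(1) by (intro divide_left_mono mult_mono) auto
      then have "(\<psi> x)\<^sup>2 * (\<bar>w y - w x\<bar> / (w x * w y)) \<le> 1 * (\<bar>w y - w x\<bar> / (\<epsilon> * \<epsilon>))"
        using w(2)[of x] w(2)[of y] \<psi>01[of x] by (intro mult_mono) (auto simp: power_le_one)
      then show "\<bar>(\<psi> x)\<^sup>2 * ((w y - w x) / (w x * w y))\<bar> \<le> 1 / \<epsilon>\<^sup>2 * \<bar>u y - u x\<bar>"
        using w(2)[of x] w(2)[of y] by (simp add: uw abs_mult abs_divide power2_eq_square)
    qed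
    also have "\<dots> \<le> (2 / \<epsilon> + 1 / \<epsilon>\<^sup>2) * (\<bar>u y - u x\<bar> + \<bar>\<psi> y - \<psi> x\<bar>)"
      using eps(1) by (simp add: algebra_simps)
    finally show "\<bar>\<phi> y - \<phi> x\<bar> \<le> (2 / \<epsilon> + 1 / \<epsilon>\<^sup>2) * (\<bar>u y - u x\<bar> + \<bar>cutoff x\<^sub>0 R y - cutoff x\<^sub>0 R x\<bar>)"
      by (simp add: \<psi>_def)
    have id: "increment_product u \<phi> (x, y) = (\<psi> y - \<psi> x)\<^sup>2 - w x * w y * (\<psi> y / w y - \<psi> x / w x)\<^sup>2"
      unfolding increment_product_def \<phi>_def fst_conv snd_conv uw by (rule log_test_identity) (rule w)+
    have "h (x, y) \<le> w x * w y * (\<psi> y / w y - \<psi> x / w x)\<^sup>2"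
    proof (cases "x \<in> B \<and> y \<in> B")
      case True
      then show ?thesis using w(2)[of x] w(2)[of y]
        by (simp add: h_def \<psi>B power2_eq_square field_simps)
    next
      case False
      then have "h (x, y) = 0" by (auto simp: h_def)
      then show ?thesis using w(2)[of x] w(2)[of y] by simp
    qed
    moreover have "(\<psi> y - \<psi> x)\<^sup>2 = 1 * (\<psi> y - \<psi> x)\<^sup>2 * of_bool (x \<in> S \<or> y \<in> S)"
      by (auto simp: \<psi>S)
    ultimately show "increment_product u \<phi> (x, y) \<le>
      1 * (cutoff x\<^sub>0 R y - cutoff x\<^sub>0 R x)\<^sup>2 * of_bool (x \<in> S \<or> y \<in> S) - h (x, y)"
      using id unfolding \<psi>_def by linarith
  qed (simp_all add: \<phi>_nn)
  then have hS: "(\<integral>\<^sup>+z\<in>D \<times> D. ennreal (h z) \<partial>joint \<mu>) \<le> ennreal (energy_const \<alpha> C * R powr - \<alpha>) * emeasure lborel S"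
    by (simp add: D_def)
  \<comment> \<open>The logarithm is taken only of numbers at least \<open>\<epsilon>\<close>, so
    \<open>f\<close> is Lipschitz with constant \<open>1 / \<epsilon>\<close>. This puts
    \<open>v\<close> in \<open>H_loc\<close>, where the Poincare inequality is available.\<close>
  define f where "f t = max 0 (- ln (max 0 t + \<epsilon>))" for t :: real
  define v where "v x = f (u x)" for x
  have [measurable]: "f \<in> borel_measurable borel" unfolding f_def by measurable
  have [measurable]: "v \<in> borel_measurable borel" unfolding v_def by measurable
  have vw: "v x = max 0 (- ln (w x))" for x by (simp add: v_def f_def w_def)
  have vH: "v \<in> H_loc \<mu> E"
    unfolding v_def
  proof (rule H_loc_lipschitz[OF uH _ _ _ bounded_E])
    fix s t :: real
    have "\<bar>f s - f t\<bar> \<le> \<bar>ln (max 0 s + \<epsilon>) - ln (max 0 t + \<epsilon>)\<bar>" unfolding f_def by linarith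
    also have "\<dots> \<le> \<bar>(max 0 s + \<epsilon>) - (max 0 t + \<epsilon>)\<bar> / \<epsilon>"
      using eps(1) by (intro abs_ln_diff_le) auto
    also have "\<dots> \<le> \<bar>s - t\<bar> / \<epsilon>" using eps(1) by (intro divide_right_mono) linarith+
    finally show "\<bar>f s - f t\<bar> \<le> (1 / \<epsilon>) * \<bar>s - t\<bar>" by simp
  qed simp_all
  have Bf: "B \<in> fmeasurable lborel"
    using emeasure_lborel_ball_finite by (intro fmeasurableI) (auto simp: B_def)
  have Sf: "S \<in> fmeasurable lborel"
    using emeasure_lborel_ball_finite by (intro fmeasurableI) (auto simp: S_def)
  have "(\<integral>\<^sup>+x\<in>B. ennreal ((v x)\<^sup>2) \<partial>lborel) \<le> ennreal (6 * C\<^sub>1 * (R/2) powr \<alpha>) * energy \<mu> B v"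
    unfolding B_def
  proof (rule poincare_vanishing_half[OF poincare _ vH])
    show "ball x\<^sub>0 (R/2) \<subseteq> E" using ball R by auto
    have "{x \<in> ball x\<^sub>0 (R/2). v x \<noteq> 0} \<subseteq> {x \<in> ball x\<^sub>0 (R/2). u x < 1}"
    proof safe
      fix x assume "v x \<noteq> 0"
      then have "ln (w x) < 0" unfolding vw by linarith
      then have "w x < 1" using w(2)[of x] by simp
      then show "u x < 1" using eps(1) by (simp add: w_def)
    qed
    then have "measure lborel {x \<in> ball x\<^sub>0 (R/2). v x \<noteq> 0} \<le> measure lborel {x \<in> ball x\<^sub>0 (R/2). u x < 1}"
      by (intro measure_mono_fmeasurable fmeasurableI2[OF Bf]) (auto simp: B_def)
    then show "measure lborel {x \<in> ball x\<^sub>0 (R/2). v x \<noteq> 0} \<le> measure lborel (ball x\<^sub>0 (R/2)) / 2"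
      using half by simp
  qed (use C1 R in auto)
  also have "energy \<mu> B v \<le> 4 * (\<integral>\<^sup>+z\<in>D \<times> D. ennreal (h z) \<partial>joint \<mu>)"
  proof -
    have "energy \<mu> B v = (\<integral>\<^sup>+z\<in>B \<times> B. ennreal (increment_product v v z) \<partial>joint \<mu>)" by (simp add: energy_joint)
    also have "\<dots> \<le> (\<integral>\<^sup>+z. 4 * (ennreal (h z) * indicator (D \<times> D) z) \<partial>joint \<mu>)"
    proof (rule nn_integral_mono)
      fix z
      show "ennreal (increment_product v v z) * indicator (B \<times> B) z \<le> 4 * (ennreal (h z) * indicator (D \<times> D) z)"
      proof (cases "z \<in> B \<times> B")
        case True
        then have "z \<in> D \<times> D" using BS SD by blast
        have "increment_product v v z = \<bar>v (snd z) - v (fst z)\<bar>\<^sup>2" by (simp add: increment_product_self)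
        also have "\<dots> \<le> \<bar>ln (w (snd z)) - ln (w (fst z))\<bar>\<^sup>2"
          unfolding vw by (intro power_mono) linarith+
        also have "\<dots> \<le> 4 * h z"
          using ln_diff_square_le[OF w(2)[of "fst z"] w(2)[of "snd z"]] True by (simp add: h_def)
        finally have "ennreal (increment_product v v z) \<le> 4 * ennreal (h z)"
          by (simp add: ennreal_numeral_mult ennreal_leI)
        then show ?thesis using True \<open>z \<in> D \<times> D\<close> by simp
      qed simp
    qed
    also have "\<dots> = 4 * (\<integral>\<^sup>+z\<in>D \<times> D. ennreal (h z) \<partial>joint \<mu>)" by (rule nn_integral_cmult) simp
    finally show ?thesis .
  qed
  also note hS
  finally have vB: "(\<integral>\<^sup>+x\<in>B. ennreal ((v x)\<^sup>2) \<partial>lborel) \<le>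
      ennreal (6 * C\<^sub>1 * (R/2) powr \<alpha>) * (4 * (ennreal (energy_const \<alpha> C * R powr - \<alpha>) * emeasure lborel S))"
    by (simp add: mult_left_mono)
  define A where "A = {x \<in> B. u x < \<epsilon>}"
  have [measurable]: "A \<in> sets borel" unfolding A_def by measurable
  have Af: "A \<in> fmeasurable lborel" by (rule fmeasurableI2[OF Bf]) (auto simp: A_def)
  have "ennreal ((ln (2 * \<epsilon>))\<^sup>2) * emeasure lborel A = (\<integral>\<^sup>+x. ennreal ((ln (2 * \<epsilon>))\<^sup>2) * indicator A x \<partial>lborel)"
    by (simp add: nn_integral_cmult_indicator)
  also have "\<dots> \<le> (\<integral>\<^sup>+x\<in>B. ennreal ((v x)\<^sup>2) \<partial>lborel)"
  proof (rule nn_integral_mono)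
    fix x
    have "(ln (2 * \<epsilon>))\<^sup>2 \<le> (v x)\<^sup>2" if "x \<in> A"
    proof -
      have "w x \<le> 2 * \<epsilon>" using that eps(1) by (auto simp: w_def A_def)
      then have "ln (w x) \<le> ln (2 * \<epsilon>)" using w(2)[of x] eps(1) by simp
      moreover have "ln (2 * \<epsilon>) \<le> 0" using eps by simp
      ultimately have "\<bar>ln (2 * \<epsilon>)\<bar> \<le> \<bar>v x\<bar>" unfolding vw by linarith
      then show ?thesis by (rule abs_le_square_iff[THEN iffD1])
    qed
    then show "ennreal ((ln (2 * \<epsilon>))\<^sup>2) * indicator A x \<le> ennreal ((v x)\<^sup>2) * indicator B x"
      by (auto simp: indicator_def A_def ennreal_leI)
  qed
  also note vB
  also have "ennreal (6 * C\<^sub>1 * (R/2) powr \<alpha>) * (4 * (ennreal (energy_const \<alpha> C * R powr - \<alpha>) * emeasure lborel S))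
    = ennreal (6 * C\<^sub>1 * (R/2) powr \<alpha> * (4 * (energy_const \<alpha> C * R powr - \<alpha> * measure lborel S)))"
  proof -
    have nn: "0 \<le> 4 * (energy_const \<alpha> C * R powr - \<alpha> * measure lborel S)" using energy_const_pos by simp
    show ?thesis
      unfolding emeasure_eq_measure2[OF Sf]
      by (simp only: ennreal_mult''[symmetric] measure_nonneg ennreal_numeral_mult nn)
  qed
  finally have "ennreal ((ln (2 * \<epsilon>))\<^sup>2 * measure lborel A) \<le>
      ennreal (6 * C\<^sub>1 * (R/2) powr \<alpha> * (4 * (energy_const \<alpha> C * R powr - \<alpha> * measure lborel S)))"
    unfolding emeasure_eq_measure2[OF Af] by (simp add: ennreal_mult'')
  then have "(ln (2 * \<epsilon>))\<^sup>2 * measure lborel A \<le> 6 * C\<^sub>1 * (R/2) powr \<alpha> * (4 * (energy_const \<alpha> C * R powr - \<alpha> * measure lborel S))"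
    using C1 energy_const_pos by (subst (asm) ennreal_le_iff) auto
  also have "\<dots> = 24 * C\<^sub>1 * energy_const \<alpha> C * ((R/2) powr \<alpha> * R powr - \<alpha>) * measure lborel S" by simp
  also have "measure lborel S = (3/2) ^ DIM('a) * measure lborel B"
  proof -
    have "(3/4 * R) ^ DIM('a) = (3/2 * (R/2)) ^ DIM('a)" by simp
    also have "\<dots> = (3/2) ^ DIM('a) * (R/2) ^ DIM('a)" by (rule power_mult_distrib)
    finally show ?thesis using R by (simp add: S_def B_def content_ball)
  qed
  also have "24 * C\<^sub>1 * energy_const \<alpha> C * ((R/2) powr \<alpha> * R powr - \<alpha>) * ((3/2) ^ DIM('a) * measure lborel B)
    \<le> 24 * C\<^sub>1 * energy_const \<alpha> C * 1 * ((3/2) ^ DIM('a) * measure lborel B)"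
  proof (intro mult_right_mono mult_left_mono)
    have "(R/2) powr \<alpha> \<le> R powr \<alpha>" using R alpha_pos by (intro powr_mono2) auto
    then show "(R/2) powr \<alpha> * R powr - \<alpha> \<le> 1" using R by (simp add: powr_minus field_simps)
  qed (use C1 energy_const_pos in auto)
  also have "\<dots> = (24 * C\<^sub>1 * energy_const \<alpha> C * (3/2) ^ DIM('a)) * measure lborel B" by simp
  also have "\<dots> \<le> (\<nu> * (ln (2 * \<epsilon>))\<^sup>2) * measure lborel B" by (intro mult_right_mono eps(3)) simp
  finally have "(ln (2 * \<epsilon>))\<^sup>2 * measure lborel A \<le> (ln (2 * \<epsilon>))\<^sup>2 * (\<nu> * measure lborel B)" by (simp add: mult_ac)
  then have "measure lborel A \<le> \<nu> * measure lborel B"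
    by (rule mult_left_le_imp_le) (use eps in auto)
  then show ?thesis by (simp add: A_def B_def)
qed

text \<open>The radius is halved twice: the logarithm controls the sublevel set on the ball of
  radius \<open>R/2\<close>, and the iteration on that ball gives the bound on radius
  \<open>R/4\<close>.\<close>

lemma growth:
  assumes R: "0 < R" and ball: "cball x\<^sub>0 R \<subseteq> E" and super: "borel_supersolution \<mu> E u"
    and pos: "\<And>x. x \<in> ball x\<^sub>0 R \<Longrightarrow> 0 \<le> u x"
    and neg: "AE x in lborel. x \<in> ball x\<^sub>0 (3/4 * R) \<longrightarrow>
      (\<integral>\<^sup>+y\<in>- ball x\<^sub>0 R. ennreal (- u y) \<partial>\<mu> x) \<le> ennreal (\<epsilon> * R powr - \<alpha>)"
    and half: "measure lborel {x \<in> ball x\<^sub>0 (R/2). u x < 1} \<le> measure lborel (ball x\<^sub>0 (R/2)) / 2"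
  shows "AE x in lborel. x \<in> ball x\<^sub>0 (R/4) \<longrightarrow> \<epsilon>/2 \<le> u x"
proof -
  have "AE x in lborel. x \<in> ball x\<^sub>0 (R/2/2) \<longrightarrow> \<epsilon>/2 \<le> u x"
  proof (rule positivity_from_small_sublevel[OF poincare _ _ _ super _ eps(1) _ nu])
    show "cball x\<^sub>0 (R/2) \<subseteq> E" using ball R by (auto intro: order_trans[OF _ ball])
    show "0 \<le> u x" if "x \<in> ball x\<^sub>0 (R/2)" for x using pos[of x] that R by auto
    show "measure lborel {x \<in> ball x\<^sub>0 (R/2). u x < \<epsilon>} \<le> \<nu> * measure lborel (ball x\<^sub>0 (R/2))"
      by (rule small_sublevel[OF R ball super pos neg half])
    \<comment> \<open>Between the two balls \<open>u\<close> is non-negative, so the negative tail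
      does not grow when the radius is halved, while its permitted size does.\<close>
    show "AE x in lborel. x \<in> ball x\<^sub>0 (3/4 * (R/2)) \<longrightarrow>
      (\<integral>\<^sup>+y\<in>- ball x\<^sub>0 (R/2). ennreal (- u y) \<partial>\<mu> x) \<le> ennreal (\<epsilon> * (R/2) powr - \<alpha>)"
      using neg
    proof (eventually_elim, intro impI)
      fix x assume n: "x \<in> ball x\<^sub>0 (3/4 * R) \<longrightarrow> (\<integral>\<^sup>+y\<in>- ball x\<^sub>0 R. ennreal (- u y) \<partial>\<mu> x) \<le> ennreal (\<epsilon> * R powr - \<alpha>)"
        and x: "x \<in> ball x\<^sub>0 (3/4 * (R/2))"
      have "ennreal (- u y) * indicator (- ball x\<^sub>0 (R/2)) y \<le> ennreal (- u y) * indicator (- ball x\<^sub>0 R) y" for y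
        using pos[of y] by (cases "y \<in> ball x\<^sub>0 R") (auto simp: ennreal_neg indicator_def)
      then have "(\<integral>\<^sup>+y\<in>- ball x\<^sub>0 (R/2). ennreal (- u y) \<partial>\<mu> x) \<le> (\<integral>\<^sup>+y\<in>- ball x\<^sub>0 R. ennreal (- u y) \<partial>\<mu> x)"
        by (rule nn_integral_mono)
      also have "\<dots> \<le> ennreal (\<epsilon> * R powr - \<alpha>)" using n x R by auto
      also have "\<dots> \<le> ennreal (\<epsilon> * (R/2) powr - \<alpha>)"
        using R eps(1) alpha_pos by (intro ennreal_leI mult_left_mono powr_mono2') auto
      finally show "(\<integral>\<^sup>+y\<in>- ball x\<^sub>0 (R/2). ennreal (- u y) \<partial>\<mu> x) \<le> ennreal (\<epsilon> * (R/2) powr - \<alpha>)" .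
    qed
  qed (use C1 R in auto)
  then show ?thesis by simp
qed

text \<open>Besides the oscillation on the ball, the induction carries the long-range contribution of the
  part of \<open>u\<close> outside the bracket; it reproduces itself when the radius shrinks.\<close>

definition bracketed :: "('a \<Rightarrow> real) \<Rightarrow> 'a \<Rightarrow> real \<Rightarrow> real \<Rightarrow> real \<Rightarrow> bool" where
  "bracketed u x\<^sub>0 r m w \<longleftrightarrow>
     (AE x in lborel. x \<in> ball x\<^sub>0 r \<longrightarrow> m \<le> u x \<and> u x \<le> m + w) \<and>
     (AE x in lborel. x \<in> ball x\<^sub>0 (3/4 * r) \<longrightarrow>
       (\<integral>\<^sup>+y\<in>- ball x\<^sub>0 r. ennreal (m - u y) \<partial>\<mu> x) \<le> ennreal (\<epsilon>/2 * w * r powr - \<alpha>) \<and>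
       (\<integral>\<^sup>+y\<in>- ball x\<^sub>0 r. ennreal (u y - (m + w)) \<partial>\<mu> x) \<le> ennreal (\<epsilon>/2 * w * r powr - \<alpha>))"

text \<open>The induction knows a solution only through this: every Borel function equal to an
  affine image almost everywhere is a supersolution. Since negative factors are included, the notion
  is symmetric under negation.\<close>

definition borel_solution :: "('a \<Rightarrow> real) \<Rightarrow> bool" where
  "borel_solution u \<longleftrightarrow> u \<in> borel_measurable borel \<and>
     (\<forall>v a b. v \<in> borel_measurable borel \<longrightarrow> (AE x in lborel. v x = a * u x + b) \<longrightarrow>
        borel_supersolution \<mu> E v)"

lemma borel_solutionD:
  "borel_solution u \<Longrightarrow> v \<in> borel_measurable borel \<Longrightarrow> AE x in lborel. v x = a * u x + b \<Longrightarrow>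
    borel_supersolution \<mu> E v"
  unfolding borel_solution_def by blast

lemma bracketed_uminus:
  assumes "bracketed u x\<^sub>0 r m w"
  shows "bracketed (\<lambda>x. - u x) x\<^sub>0 r (- (m + w)) w"
proof -
  have "ennreal (- (m + w) - - u y) = ennreal (u y - (m + w))" for y by (rule arg_cong[where f = ennreal]) simp
  moreover have "ennreal (- u y - (- (m + w) + w)) = ennreal (m - u y)" for y by (rule arg_cong[where f = ennreal]) simp
  moreover have "(- (m + w) \<le> - u x \<and> - u x \<le> - (m + w) + w) = (m \<le> u x \<and> u x \<le> m + w)" for x by auto
  ultimately show ?thesis using assms unfolding bracketed_def by (simp only: conj_commute)
qed

lemma borel_solution_uminus:
  assumes "borel_solution u" shows "borel_solution (\<lambda>x. - u x)"
  unfolding borel_solution_def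
proof (intro conjI allI impI)
  show "(\<lambda>x. - u x) \<in> borel_measurable borel" using assms by (simp add: borel_solution_def)
  fix v a b assume v: "v \<in> borel_measurable borel" and "AE x in lborel. v x = a * - u x + b"
  then have "AE x in lborel. v x = (- a) * u x + b" by simp
  then show "borel_supersolution \<mu> E v" by (rule borel_solutionD[OF assms v])
qed

text \<open>Normalising the bracket to the interval from 0 to 2 puts its midpoint at 1, the level in
  \<open>growth\<close>. The lower end could rise by \<open>\<epsilon>/4 * w\<close>; only
  \<open>\<delta> * w\<close> is taken, to leave room for the tail that the rise creates.\<close>

lemma bracketed_shrink_lower:
  assumes sol: "borel_solution u" and r: "0 < r" and ball: "cball x\<^sub>0 r \<subseteq> E" and w: "0 < w"
    and br: "bracketed u x\<^sub>0 r m w"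
    and half: "measure lborel {x \<in> ball x\<^sub>0 (r/2). u x < m + w/2} \<le> measure lborel (ball x\<^sub>0 (r/2)) / 2"
  shows "bracketed u x\<^sub>0 (q * r) (m + \<delta> * w) ((1 - \<delta>) * w)"
proof -
  define D where "D = ball x\<^sub>0 r"
  define D' where "D' = ball x\<^sub>0 (q * r)"
  have u [measurable]: "u \<in> borel_measurable borel" using sol by (simp add: borel_solution_def)
  have [measurable]: "D \<in> sets borel" "D' \<in> sets borel" by (auto simp: D_def D'_def)
  have in_D: "AE x in lborel. x \<in> D \<longrightarrow> m \<le> u x \<and> u x \<le> m + w"
    and tails: "AE x in lborel. x \<in> ball x\<^sub>0 (3/4 * r) \<longrightarrow>
       (\<integral>\<^sup>+y\<in>- D. ennreal (m - u y) \<partial>\<mu> x) \<le> ennreal (\<epsilon>/2 * w * r powr - \<alpha>) \<and>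
       (\<integral>\<^sup>+y\<in>- D. ennreal (u y - (m + w)) \<partial>\<mu> x) \<le> ennreal (\<epsilon>/2 * w * r powr - \<alpha>)"
    using br by (auto simp: bracketed_def D_def)
  have qr: "q * r \<le> r / 4" using q r by (simp add: mult_left_mono)
  \<comment> \<open>The truncation acts on a null set only, since \<open>m \<le> u x\<close> almost
    everywhere in \<open>D\<close>; it supplies the pointwise positivity that \<open>growth\<close>
    expects. The factor \<open>2 / w\<close> turns the tail allowance
    \<open>\<epsilon>/2 * w\<close> into \<open>\<epsilon>\<close>.\<close>
  define v where "v x = (if x \<in> D then max 0 (2 / w * (u x - m)) else 2 / w * (u x - m))" for x
  have [measurable]: "v \<in> borel_measurable borel" unfolding v_def by measurable
  have "AE x in lborel. v x = (2 / w) * u x + (- 2 * m / w)"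
    using in_D by eventually_elim (use w in \<open>auto simp: v_def field_simps\<close>)
  then have super: "borel_supersolution \<mu> E v" by (rule borel_solutionD[OF sol, rotated]) simp
  have "AE x in lborel. x \<in> ball x\<^sub>0 (r/4) \<longrightarrow> \<epsilon>/2 \<le> v x"
  proof (rule growth[OF r ball super])
    show "0 \<le> v x" if "x \<in> ball x\<^sub>0 r" for x using that by (simp add: v_def D_def)
    have "{x \<in> ball x\<^sub>0 (r/2). v x < 1} = {x \<in> ball x\<^sub>0 (r/2). u x < m + w/2}"
      using r w by (auto simp: v_def D_def field_simps)
    then show "measure lborel {x \<in> ball x\<^sub>0 (r/2). v x < 1} \<le> measure lborel (ball x\<^sub>0 (r/2)) / 2"
      using half by simp
    show "AE x in lborel. x \<in> ball x\<^sub>0 (3/4 * r) \<longrightarrow>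
      (\<integral>\<^sup>+y\<in>- ball x\<^sub>0 r. ennreal (- v y) \<partial>\<mu> x) \<le> ennreal (\<epsilon> * r powr - \<alpha>)"
      using tails
    proof (eventually_elim, intro impI)
      fix x assume t: "x \<in> ball x\<^sub>0 (3/4 * r) \<longrightarrow>
         (\<integral>\<^sup>+y\<in>- D. ennreal (m - u y) \<partial>\<mu> x) \<le> ennreal (\<epsilon>/2 * w * r powr - \<alpha>) \<and>
         (\<integral>\<^sup>+y\<in>- D. ennreal (u y - (m + w)) \<partial>\<mu> x) \<le> ennreal (\<epsilon>/2 * w * r powr - \<alpha>)"
        and x: "x \<in> ball x\<^sub>0 (3/4 * r)"
      have "(\<integral>\<^sup>+y\<in>- ball x\<^sub>0 r. ennreal (- v y) \<partial>\<mu> x) = (\<integral>\<^sup>+y. ennreal (2 / w) * (ennreal (m - u y) * indicator (- D) y) \<partial>\<mu> x)"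
      proof (rule nn_integral_cong)
        fix y
        show "ennreal (- v y) * indicator (- ball x\<^sub>0 r) y = ennreal (2 / w) * (ennreal (m - u y) * indicator (- D) y)"
        proof (cases "y \<in> D")
          case False
          have "ennreal (- v y) = ennreal ((2 / w) * (m - u y))"
            using False by (intro arg_cong[where f = ennreal]) (simp add: v_def algebra_simps diff_divide_distrib)
          also have "\<dots> = ennreal (2 / w) * ennreal (m - u y)" by (rule ennreal_mult') (use w in simp)
          finally show ?thesis using False by (simp add: D_def)
        qed (simp add: D_def)
      qed
      also have "\<dots> = ennreal (2 / w) * (\<integral>\<^sup>+y\<in>- D. ennreal (m - u y) \<partial>\<mu> x)" by (rule nn_integral_cmult) simp
      also have "\<dots> \<le> ennreal (2 / w) * ennreal (\<epsilon>/2 * w * r powr - \<alpha>)" using t x by (intro mult_left_mono) auto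
      also have "\<dots> = ennreal (\<epsilon> * r powr - \<alpha>)" using w eps by (simp flip: ennreal_mult)
      finally show "(\<integral>\<^sup>+y\<in>- ball x\<^sub>0 r. ennreal (- v y) \<partial>\<mu> x) \<le> ennreal (\<epsilon> * r powr - \<alpha>)" .
    qed
  qed
  with in_D have inner: "AE x in lborel. x \<in> D' \<longrightarrow> m + \<delta> * w \<le> u x \<and> u x \<le> m + \<delta> * w + (1 - \<delta>) * w"
  proof (eventually_elim, intro impI)
    fix x assume a: "x \<in> D \<longrightarrow> m \<le> u x \<and> u x \<le> m + w" "x \<in> ball x\<^sub>0 (r/4) \<longrightarrow> \<epsilon>/2 \<le> v x" "x \<in> D'"
    have "dist x\<^sub>0 x < q * r" using a(3) by (simp add: D'_def)
    then have "dist x\<^sub>0 x < r/4" using qr by linarith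
    then have x: "x \<in> D" "x \<in> ball x\<^sub>0 (r/4)" using r by (auto simp: D_def)
    then have "\<epsilon>/2 \<le> max 0 (2 / w * (u x - m))" using a(2) by (simp add: v_def)
    then have "\<epsilon>/2 \<le> 2 / w * (u x - m)" using eps(1) by linarith
    then have "\<epsilon>/4 * w \<le> u x - m" using w by (simp add: field_simps)
    moreover have "\<delta> * w \<le> \<epsilon>/4 * w" using delta w by (intro mult_right_mono) auto
    ultimately show "m + \<delta> * w \<le> u x \<and> u x \<le> m + \<delta> * w + (1 - \<delta>) * w"
      using a(1) x by (auto simp: algebra_simps)
  qed
  \<comment> \<open>Measured in units of the smaller radius, the old tail shrinks by the factor
    \<open>q powr \<alpha>\<close>.\<close>
  have scale: "r powr - \<alpha> = q powr \<alpha> * (q * r) powr - \<alpha>"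
    using q r by (simp add: powr_mult powr_minus field_simps)
  have outer: "AE x in lborel. x \<in> ball x\<^sub>0 (3/4 * (q * r)) \<longrightarrow>
       (\<integral>\<^sup>+y\<in>- D'. ennreal (m + \<delta> * w - u y) \<partial>\<mu> x) \<le> ennreal (\<epsilon>/2 * ((1 - \<delta>) * w) * (q * r) powr - \<alpha>) \<and>
       (\<integral>\<^sup>+y\<in>- D'. ennreal (u y - (m + \<delta> * w + (1 - \<delta>) * w)) \<partial>\<mu> x) \<le> ennreal (\<epsilon>/2 * ((1 - \<delta>) * w) * (q * r) powr - \<alpha>)"
    using tails AE_mu[OF in_D]
  proof (eventually_elim, intro impI)
    fix x assume t: "x \<in> ball x\<^sub>0 (3/4 * r) \<longrightarrow>
         (\<integral>\<^sup>+y\<in>- D. ennreal (m - u y) \<partial>\<mu> x) \<le> ennreal (\<epsilon>/2 * w * r powr - \<alpha>) \<and>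
         (\<integral>\<^sup>+y\<in>- D. ennreal (u y - (m + w)) \<partial>\<mu> x) \<le> ennreal (\<epsilon>/2 * w * r powr - \<alpha>)"
      and ae: "AE y in \<mu> x. y \<in> D \<longrightarrow> m \<le> u y \<and> u y \<le> m + w"
      and x: "x \<in> ball x\<^sub>0 (3/4 * (q * r))"
    have x': "x \<in> ball x\<^sub>0 (3/4 * r)"
    proof -
      have "dist x\<^sub>0 x < 3/4 * (q * r)" using x by simp
      then show ?thesis using qr r unfolding mem_ball by linarith
    qed
    \<comment> \<open>Raising the lower end adds at most \<open>\<delta> * w\<close> at each point
      outside \<open>D'\<close>, and the mass there is bounded by decay at distance
      \<open>q * r / 4\<close>. In \<open>D\<close> this is the only contribution. The last
      condition on \<open>q\<close> says that the old tail and the new term fit the new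
      allowance.\<close>
    have "(\<integral>\<^sup>+y\<in>- D'. ennreal (m + \<delta> * w - u y) \<partial>\<mu> x) \<le>
      (\<integral>\<^sup>+y. ennreal (m - u y) * indicator (- D) y + ennreal (\<delta> * w) * indicator (- D') y \<partial>\<mu> x)"
    proof (rule nn_integral_mono_AE)
      show "AE y in \<mu> x. ennreal (m + \<delta> * w - u y) * indicator (- D') y \<le>
        ennreal (m - u y) * indicator (- D) y + ennreal (\<delta> * w) * indicator (- D') y"
        using ae
      proof eventually_elim
        case (elim y)
        show ?case
        proof (cases "y \<in> D")
          case True
          then have "ennreal (m + \<delta> * w - u y) \<le> ennreal (\<delta> * w)" using elim by (intro ennreal_leI) auto
          then show ?thesis using True by (auto simp: indicator_def)
        next
          case False
          have "ennreal (m + \<delta> * w - u y) \<le> ennreal (max 0 (m - u y) + \<delta> * w)" by (intro ennreal_leI) auto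
          also have "\<dots> = ennreal (m - u y) + ennreal (\<delta> * w)"
            using delta w by (simp add: ennreal_plus ennreal_max_0)
          finally show ?thesis using False by (auto simp: indicator_def)
        qed
      qed
    qed
    also have "\<dots> = (\<integral>\<^sup>+y\<in>- D. ennreal (m - u y) \<partial>\<mu> x) + ennreal (\<delta> * w) * emeasure (\<mu> x) (- D')"
      by (simp add: nn_integral_add nn_integral_cmult_indicator)
    also have "\<dots> \<le> ennreal (\<epsilon>/2 * w * r powr - \<alpha>) + ennreal (\<delta> * w) * ennreal (C * (q * r - 3/4 * (q * r)) powr - \<alpha>)"
      unfolding D'_def using t x' x q r by (intro add_mono mult_left_mono emeasure_mu_ball_complement) auto
    also have "\<dots> = ennreal (\<epsilon>/2 * w * r powr - \<alpha> + \<delta> * w * (C * (q * r - 3/4 * (q * r)) powr - \<alpha>))"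
      using eps w delta C_ge by (simp flip: ennreal_mult ennreal_plus)
    also have "\<dots> \<le> ennreal (\<epsilon>/2 * ((1 - \<delta>) * w) * (q * r) powr - \<alpha>)"
    proof (rule ennreal_leI)
      have "(q * r - 3/4 * (q * r)) powr - \<alpha> = (q * r / 4) powr - \<alpha>" by simp
      also have "\<dots> = 4 powr \<alpha> * (q * r) powr - \<alpha>"
        using q r by (subst powr_divide) (simp_all add: powr_minus field_simps)
      finally have "\<epsilon>/2 * w * r powr - \<alpha> + \<delta> * w * (C * (q * r - 3/4 * (q * r)) powr - \<alpha>)
        = (\<epsilon>/2 * q powr \<alpha> + \<delta> * C * 4 powr \<alpha>) * (w * (q * r) powr - \<alpha>)"
        by (simp add: scale algebra_simps)
      also have "\<dots> \<le> (\<epsilon>/2 * (1 - \<delta>)) * (w * (q * r) powr - \<alpha>)"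
        using w by (intro mult_right_mono q(3)) auto
      finally show "\<epsilon>/2 * w * r powr - \<alpha> + \<delta> * w * (C * (q * r - 3/4 * (q * r)) powr - \<alpha>)
        \<le> \<epsilon>/2 * ((1 - \<delta>) * w) * (q * r) powr - \<alpha>" by (simp add: mult_ac)
    qed
    finally have lower: "(\<integral>\<^sup>+y\<in>- D'. ennreal (m + \<delta> * w - u y) \<partial>\<mu> x) \<le> ennreal (\<epsilon>/2 * ((1 - \<delta>) * w) * (q * r) powr - \<alpha>)" .
    \<comment> \<open>The upper end stays at \<open>m + w\<close>, so only the old tail
      occurs.\<close>
    have "(\<integral>\<^sup>+y\<in>- D'. ennreal (u y - (m + \<delta> * w + (1 - \<delta>) * w)) \<partial>\<mu> x) \<le> (\<integral>\<^sup>+y\<in>- D. ennreal (u y - (m + w)) \<partial>\<mu> x)"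
    proof (rule nn_integral_mono_AE)
      have e: "m + \<delta> * w + (1 - \<delta>) * w = m + w" by (simp add: algebra_simps)
      show "AE y in \<mu> x. ennreal (u y - (m + \<delta> * w + (1 - \<delta>) * w)) * indicator (- D') y \<le> ennreal (u y - (m + w)) * indicator (- D) y"
        unfolding e using ae by eventually_elim (auto simp: indicator_def ennreal_neg)
    qed
    also have "\<dots> \<le> ennreal (\<epsilon>/2 * w * r powr - \<alpha>)" using t x' by auto
    also have "\<dots> \<le> ennreal (\<epsilon>/2 * ((1 - \<delta>) * w) * (q * r) powr - \<alpha>)"
    proof (rule ennreal_leI)
      have "\<epsilon>/2 * w * r powr - \<alpha> = (\<epsilon>/2 * q powr \<alpha>) * (w * (q * r) powr - \<alpha>)" by (simp add: scale)
      also have "\<dots> \<le> (\<epsilon>/2 * (1 - \<delta>)) * (w * (q * r) powr - \<alpha>)"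
      proof (rule mult_right_mono)
        have "0 \<le> \<delta> * C * 4 powr \<alpha>" using delta C_ge by simp
        then show "\<epsilon>/2 * q powr \<alpha> \<le> \<epsilon>/2 * (1 - \<delta>)" using q(3) by linarith
      qed (use w in simp)
      finally show "\<epsilon>/2 * w * r powr - \<alpha> \<le> \<epsilon>/2 * ((1 - \<delta>) * w) * (q * r) powr - \<alpha>" by (simp add: mult_ac)
    qed
    finally show "(\<integral>\<^sup>+y\<in>- D'. ennreal (m + \<delta> * w - u y) \<partial>\<mu> x) \<le> ennreal (\<epsilon>/2 * ((1 - \<delta>) * w) * (q * r) powr - \<alpha>) \<and>
       (\<integral>\<^sup>+y\<in>- D'. ennreal (u y - (m + \<delta> * w + (1 - \<delta>) * w)) \<partial>\<mu> x) \<le> ennreal (\<epsilon>/2 * ((1 - \<delta>) * w) * (q * r) powr - \<alpha>)"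
      using lower by simp
  qed
  show ?thesis using inner outer unfolding bracketed_def D'_def by blast
qed

text \<open>The sets below and above the midpoint are disjoint, so one of them fills at most half of
  the ball. If it is the upper one, the argument is applied to \<open>- u\<close>.\<close>

lemma bracketed_shrink:
  assumes sol: "borel_solution u" and r: "0 < r" and ball: "cball x\<^sub>0 r \<subseteq> E" and w: "0 < w"
    and br: "bracketed u x\<^sub>0 r m w"
  shows "\<exists>m'. bracketed u x\<^sub>0 (q * r) m' ((1 - \<delta>) * w)"
proof (cases "measure lborel {x \<in> ball x\<^sub>0 (r/2). u x < m + w/2} \<le> measure lborel (ball x\<^sub>0 (r/2)) / 2")
  case True
  then show ?thesis using bracketed_shrink_lower[OF sol r ball w br] by blast
next
  case False
  define B where "B = ball x\<^sub>0 (r/2)"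
  have [measurable]: "u \<in> borel_measurable borel" using sol by (simp add: borel_solution_def)
  have [measurable]: "B \<in> sets borel" by (simp add: B_def)
  have Bf: "B \<in> fmeasurable lborel"
    using emeasure_lborel_ball_finite by (intro fmeasurableI) (auto simp: B_def)
  let ?L = "{x \<in> B. u x < m + w/2}" and ?U = "{x \<in> B. - u x < - (m + w) + w/2}"
  have fm: "?L \<in> fmeasurable lborel" "?U \<in> fmeasurable lborel"
    by (rule fmeasurableI2[OF Bf]; auto)+
  have "?L \<inter> ?U = {}" by auto
  then have "measure lborel ?L + measure lborel ?U = measure lborel (?L \<union> ?U)"
    using measure_Un3[OF fm] by simp
  also have "\<dots> \<le> measure lborel B"
    by (rule measure_mono_fmeasurable[OF _ _ Bf]) auto
  finally have "measure lborel ?U \<le> measure lborel B / 2" using False by (simp add: B_def)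
  then have "bracketed (\<lambda>x. - u x) x\<^sub>0 (q * r) (- (m + w) + \<delta> * w) ((1 - \<delta>) * w)"
    by (intro bracketed_shrink_lower[OF borel_solution_uminus[OF sol] r ball w bracketed_uminus[OF br]])
      (simp add: B_def)
  from bracketed_uminus[OF this] show ?thesis by auto
qed

lemma bracketed_iterate:
  assumes sol: "borel_solution u" and r: "0 < r" and ball: "cball x\<^sub>0 r \<subseteq> E" and w: "0 < w"
    and br: "bracketed u x\<^sub>0 r m w"
  shows "\<exists>m'. bracketed u x\<^sub>0 (q ^ j * r) m' ((1 - \<delta>) ^ j * w)"
proof (induction j)
  case 0
  then show ?case using br by auto
next
  case (Suc j)
  then obtain m' where m': "bracketed u x\<^sub>0 (q ^ j * r) m' ((1 - \<delta>) ^ j * w)" by blast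
  have "q ^ j * r \<le> 1 * r" using q r by (intro mult_right_mono power_le_one) auto
  then have "cball x\<^sub>0 (q ^ j * r) \<subseteq> E" using ball by (auto intro: order_trans[OF _ ball])
  then have "\<exists>m''. bracketed u x\<^sub>0 (q * (q ^ j * r)) m'' ((1 - \<delta>) * ((1 - \<delta>) ^ j * w))"
    using q r w delta eps by (intro bracketed_shrink[OF sol _ _ _ m']) auto
  then show ?case by (simp add: mult.assoc)
qed

lemmas holder_exponent_bounds = holder_exponent_pos[OF delta q(1,2) eps(2)] holder_exponent_less_1[OF delta q(1,2) eps(2)]

text \<open>\<open>W\<close> dominates both the size of \<open>u\<close> in the ball and its tail.
  Brackets give the decay along a geometric sequence of radii; the passage to arbitrary
  \<open>\<rho>\<close> is paid for in \<open>holder_factor\<close>.\<close>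

lemma oscillation_decay:
  assumes sol: "borel_solution u" and ball: "ball x\<^sub>0 R \<subseteq> E" and \<rho>: "0 < \<rho>" "\<rho> < R" and W: "0 < W"
    and bd: "AE x in lborel. x \<in> ball x\<^sub>0 R \<longrightarrow> \<bar>u x\<bar> \<le> W"
    and tail: "AE x in lborel. x \<in> ball x\<^sub>0 (7/8 * R) \<longrightarrow>
      (\<integral>\<^sup>+y\<in>- ball x\<^sub>0 R. ennreal \<bar>u y\<bar> \<partial>\<mu> x) \<le> ennreal (W * R powr - \<alpha>)"
  shows "\<exists>m. AE x in lborel. x \<in> ball x\<^sub>0 \<rho> \<longrightarrow>
    m \<le> u x \<and> u x \<le> m + holder_factor \<epsilon> \<delta> q * W * (\<rho> / R) powr holder_exponent \<delta> q"
proof -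
  have R: "0 < R" using \<rho> by simp
  \<comment> \<open>The 2 makes the bracket of width \<open>K * W\<close> around 0 contain all
    values in the ball; the \<open>2/\<epsilon>\<close> makes a tail of size \<open>W\<close> fit
    the allowance of \<open>\<epsilon>/2\<close> times the width.\<close>
  define K where "K = max 2 (2/\<epsilon>)"
  define \<beta> where "\<beta> = holder_exponent \<delta> q"
  define r where "r = 7/8 * R"
  define D where "D = ball x\<^sub>0 R"
  have r: "0 < r" "r < R" using R by (auto simp: r_def)
  have K: "2 \<le> K" "1 \<le> \<epsilon>/2 * K" using eps(1) by (auto simp: K_def field_simps max_def)
  have \<beta>: "0 < \<beta>" "\<beta> < 1" using holder_exponent_bounds by (auto simp: \<beta>_def)
  have [measurable]: "u \<in> borel_measurable borel" using sol by (simp add: borel_solution_def)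
  have factor: "holder_factor \<epsilon> \<delta> q = K * (8 / (7 * q)) powr \<beta>" by (simp add: holder_factor_def K_def \<beta>_def)
  have WK: "2 * W \<le> K * W" using K W by (intro mult_right_mono) auto
  show ?thesis
  proof (cases "\<rho> < r")
    case False
    \<comment> \<open>At radii comparable to \<open>R\<close> the trivial bound \<open>2 * W\<close>
      on the oscillation already implies the claim.\<close>
    have "1 powr \<beta> \<le> (8 / (7 * q) * (\<rho> / R)) powr \<beta>"
    proof (rule powr_mono2)
      have "r * q \<le> \<rho> * 1" using False q r by (intro mult_mono) auto
      then show "1 \<le> 8 / (7 * q) * (\<rho> / R)" using q R by (simp add: r_def field_simps)
    qed (use \<beta> in auto)
    also have "\<dots> = (8 / (7 * q)) powr \<beta> * (\<rho> / R) powr \<beta>"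
      by (rule powr_mult)
    finally have one: "1 \<le> (8 / (7 * q)) powr \<beta> * (\<rho> / R) powr \<beta>" by simp
    have "2 * W \<le> K * W * ((8 / (7 * q)) powr \<beta> * (\<rho> / R) powr \<beta>)"
      using mult_mono[OF WK one] K W by simp
    then have big: "2 * W \<le> holder_factor \<epsilon> \<delta> q * W * (\<rho> / R) powr \<beta>" by (simp add: factor mult_ac)
    have "AE x in lborel. x \<in> ball x\<^sub>0 \<rho> \<longrightarrow> - W \<le> u x \<and> u x \<le> - W + holder_factor \<epsilon> \<delta> q * W * (\<rho> / R) powr \<beta>"
      using bd
    proof (eventually_elim, intro impI)
      fix x assume "x \<in> ball x\<^sub>0 R \<longrightarrow> \<bar>u x\<bar> \<le> W" "x \<in> ball x\<^sub>0 \<rho>"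
      then have "\<bar>u x\<bar> \<le> W" using \<rho> by auto
      then show "- W \<le> u x \<and> u x \<le> - W + holder_factor \<epsilon> \<delta> q * W * (\<rho> / R) powr \<beta>" using big by linarith
    qed
    then show ?thesis unfolding \<beta>_def by blast
  next
    case True
    \<comment> \<open>The growth lemma needs a closed ball inside \<open>E\<close>, hence the start at radius \<open>7/8 * R\<close>.\<close>
    have cb: "cball x\<^sub>0 r \<subseteq> E" using r ball by (auto intro: order_trans[OF _ ball])
    have start: "bracketed u x\<^sub>0 r (- (K * W / 2)) (K * W)"
      unfolding bracketed_def
    proof (intro conjI)
      show "AE x in lborel. x \<in> ball x\<^sub>0 r \<longrightarrow> - (K * W / 2) \<le> u x \<and> u x \<le> - (K * W / 2) + K * W"
        using bd
      proof (eventually_elim, intro impI)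
        fix x assume "x \<in> ball x\<^sub>0 R \<longrightarrow> \<bar>u x\<bar> \<le> W" "x \<in> ball x\<^sub>0 r"
        then have "\<bar>u x\<bar> \<le> W" using r by auto
        then show "- (K * W / 2) \<le> u x \<and> u x \<le> - (K * W / 2) + K * W" using WK by linarith
      qed
      have const: "ennreal (W * R powr - \<alpha>) \<le> ennreal (\<epsilon>/2 * (K * W) * r powr - \<alpha>)"
      proof (rule ennreal_leI)
        have "W * R powr - \<alpha> \<le> W * r powr - \<alpha>"
          using r W alpha_pos by (intro mult_left_mono powr_mono2') auto
        also have "\<dots> \<le> (\<epsilon>/2 * K) * (W * r powr - \<alpha>)"
          using mult_right_mono[OF K(2), of "W * r powr - \<alpha>"] W by simp
        finally show "W * R powr - \<alpha> \<le> \<epsilon>/2 * (K * W) * r powr - \<alpha>" by (simp add: mult_ac)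
      qed
      show "AE x in lborel. x \<in> ball x\<^sub>0 (3/4 * r) \<longrightarrow>
       (\<integral>\<^sup>+y\<in>- ball x\<^sub>0 r. ennreal (- (K * W / 2) - u y) \<partial>\<mu> x) \<le> ennreal (\<epsilon>/2 * (K * W) * r powr - \<alpha>) \<and>
       (\<integral>\<^sup>+y\<in>- ball x\<^sub>0 r. ennreal (u y - (- (K * W / 2) + K * W)) \<partial>\<mu> x) \<le> ennreal (\<epsilon>/2 * (K * W) * r powr - \<alpha>)"
        using tail AE_mu[OF bd]
      proof (eventually_elim, intro impI)
        fix x assume t: "x \<in> ball x\<^sub>0 (7/8 * R) \<longrightarrow> (\<integral>\<^sup>+y\<in>- ball x\<^sub>0 R. ennreal \<bar>u y\<bar> \<partial>\<mu> x) \<le> ennreal (W * R powr - \<alpha>)"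
          and ae: "AE y in \<mu> x. y \<in> ball x\<^sub>0 R \<longrightarrow> \<bar>u y\<bar> \<le> W" and x: "x \<in> ball x\<^sub>0 (3/4 * r)"
        have "x \<in> ball x\<^sub>0 (7/8 * R)" using x R by (auto simp: r_def)
        then have t': "(\<integral>\<^sup>+y\<in>- ball x\<^sub>0 R. ennreal \<bar>u y\<bar> \<partial>\<mu> x) \<le> ennreal (\<epsilon>/2 * (K * W) * r powr - \<alpha>)"
          using t const by (blast intro: order_trans)
        \<comment> \<open>The bracket has half-width at least \<open>W\<close>, so the shell between
          the radii \<open>r\<close> and \<open>R\<close> contributes nothing and the tail beyond
          \<open>r\<close> is bounded by that beyond \<open>R\<close>.\<close>
        have le: "(\<integral>\<^sup>+y\<in>- ball x\<^sub>0 r. ennreal (g y) \<partial>\<mu> x) \<le> (\<integral>\<^sup>+y\<in>- ball x\<^sub>0 R. ennreal \<bar>u y\<bar> \<partial>\<mu> x)"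
          if g: "\<And>y. g y \<le> \<bar>u y\<bar> - K * W / 2" for g
        proof (rule nn_integral_mono_AE)
          show "AE y in \<mu> x. ennreal (g y) * indicator (- ball x\<^sub>0 r) y \<le> ennreal \<bar>u y\<bar> * indicator (- ball x\<^sub>0 R) y"
            using ae
          proof eventually_elim
            case (elim y)
            show ?case
            proof (cases "y \<in> ball x\<^sub>0 R")
              case True
              then have "g y \<le> 0" using g[of y] elim WK by auto
              then show ?thesis by (simp add: ennreal_neg)
            next
              case False
              have "0 \<le> K * W" using K W by simp
              then have "ennreal (g y) \<le> ennreal \<bar>u y\<bar>" using g[of y] by (intro ennreal_leI) linarith
              then show ?thesis using False by (auto simp: indicator_def)
            qed
          qed
        qed
        show "(\<integral>\<^sup>+y\<in>- ball x\<^sub>0 r. ennreal (- (K * W / 2) - u y) \<partial>\<mu> x) \<le> ennreal (\<epsilon>/2 * (K * W) * r powr - \<alpha>) \<and>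
          (\<integral>\<^sup>+y\<in>- ball x\<^sub>0 r. ennreal (u y - (- (K * W / 2) + K * W)) \<partial>\<mu> x) \<le> ennreal (\<epsilon>/2 * (K * W) * r powr - \<alpha>)"
          by (intro conjI order_trans[OF le t']) (auto simp: abs_if)
      qed
    qed
    have KW: "0 < K * W" using K W by simp
    have "\<exists>n. q ^ n < \<rho> / r" using q \<rho> r by (intro real_arch_pow_inv) auto
    then have ex: "\<exists>n. q ^ n * r \<le> \<rho>" using r by (auto simp: field_simps intro: less_imp_le)
    \<comment> \<open>The preceding index still gives a radius above \<open>\<rho>\<close> and is
      the one used; the step from \<open>n\<close> back to \<open>j\<close> is the factor
      \<open>1/q\<close> in \<open>holder_factor\<close>.\<close>
    define n where "n = (LEAST n. q ^ n * r \<le> \<rho>)"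
    have n: "q ^ n * r \<le> \<rho>" unfolding n_def by (rule LeastI_ex[OF ex])
    have "n \<noteq> 0" using n True by (cases n) auto
    then obtain j where j: "n = Suc j" by (cases n) auto
    have less: "\<rho> < q ^ j * r"
      using not_less_Least[of j "\<lambda>n. q ^ n * r \<le> \<rho>", folded n_def] j by auto
    obtain m where "bracketed u x\<^sub>0 (q ^ j * r) m ((1 - \<delta>) ^ j * (K * W))"
      using bracketed_iterate[OF sol r(1) cb KW start] by blast
    then have m: "AE x in lborel. x \<in> ball x\<^sub>0 (q ^ j * r) \<longrightarrow> m \<le> u x \<and> u x \<le> m + (1 - \<delta>) ^ j * (K * W)"
      by (simp add: bracketed_def)
    have "(1 - \<delta>) ^ j = (q ^ j) powr \<beta>"
    proof -
      have "1 - \<delta> = q powr \<beta>"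
        using q delta eps by (simp add: powr_def \<beta>_def holder_exponent_def)
      then have "(1 - \<delta>) ^ j = (q powr \<beta>) powr real j" using q by (simp add: powr_realpow)
      also have "\<dots> = (q powr real j) powr \<beta>" by (simp add: powr_powr mult.commute)
      finally show ?thesis using q by (simp add: powr_realpow)
    qed
    also have "\<dots> \<le> (8 / (7 * q) * (\<rho> / R)) powr \<beta>"
      using n j q R \<beta> by (intro powr_mono2) (auto simp: r_def field_simps)
    also have "\<dots> = (8 / (7 * q)) powr \<beta> * (\<rho> / R) powr \<beta>"
      by (rule powr_mult)
    finally have "(1 - \<delta>) ^ j * (K * W) \<le> (8 / (7 * q)) powr \<beta> * (\<rho> / R) powr \<beta> * (K * W)"
      using KW by (intro mult_right_mono) auto
    then have fin: "(1 - \<delta>) ^ j * (K * W) \<le> holder_factor \<epsilon> \<delta> q * W * (\<rho> / R) powr \<beta>" by (simp add: factor mult_ac)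
    have "AE x in lborel. x \<in> ball x\<^sub>0 \<rho> \<longrightarrow> m \<le> u x \<and> u x \<le> m + holder_factor \<epsilon> \<delta> q * W * (\<rho> / R) powr \<beta>"
      using m by eventually_elim (use fin less in auto)
    then show ?thesis unfolding \<beta>_def by blast
  qed
qed

end

text \<open>The choice is made in the order \<open>\<nu>\<close>, \<open>\<epsilon>\<close>,
  \<open>\<delta>\<close>, \<open>q\<close>, each parameter depending at most on the data and the
  earlier ones. The number \<open>e\<close> stands for
  \<open>energy_const \<alpha> C\<close>.\<close>

lemma regularity_parameters_exist:
  fixes \<alpha> C C\<^sub>1 e :: real and N :: nat
  assumes "0 < \<alpha>" "1 \<le> C" "1 \<le> C\<^sub>1" "0 < e" "0 < N"
  shows "\<exists>\<nu> \<epsilon> \<delta> q. 0 < \<nu> \<and> 2 * \<nu> * 8 ^ N \<le> 1 \<and>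
    16 * (12 * C\<^sub>1 * e * 2 powr (\<alpha> / N)) * \<nu> powr (\<alpha> / N) \<le> 4 powr (- 1 / (\<alpha> / N)) \<and>
    0 < \<epsilon> \<and> \<epsilon> < 1/2 \<and> 24 * C\<^sub>1 * e * (3/2) ^ N \<le> \<nu> * (ln (2 * \<epsilon>))\<^sup>2 \<and> 0 < \<delta> \<and> \<delta> \<le> \<epsilon>/4 \<and>
    0 < q \<and> q \<le> 1/4 \<and> \<epsilon>/2 * q powr \<alpha> + \<delta> * C * 4 powr \<alpha> \<le> \<epsilon>/2 * (1 - \<delta>)"
proof -
  define \<sigma> where "\<sigma> = \<alpha> / N"
  have \<sigma>: "0 < \<sigma>" using assms by (simp add: \<sigma>_def)
  define K where "K = 16 * (12 * C\<^sub>1 * e * 2 powr \<sigma>)"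
  have K: "0 < K" using assms by (simp add: K_def)
  define c where "c = (4::real) powr (- 1 / \<sigma>)"
  have c: "0 < c" by (simp add: c_def)
  define \<nu> where "\<nu> = min (1 / (2 * 8 ^ N)) ((c / K) powr (1 / \<sigma>))"
  have \<nu>: "0 < \<nu>" "2 * \<nu> * 8 ^ N \<le> 1" using c K by (auto simp: \<nu>_def min_def field_simps)
  have "\<nu> powr \<sigma> \<le> ((c / K) powr (1 / \<sigma>)) powr \<sigma>"
    using \<nu> \<sigma> by (intro powr_mono2) (auto simp: \<nu>_def)
  also have "\<dots> = c / K" using \<sigma> c K by (simp add: powr_powr)
  finally have \<nu>3: "K * \<nu> powr \<sigma> \<le> c" using K by (simp add: field_simps)
  define A where "A = 24 * C\<^sub>1 * e * (3/2) ^ N"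
  have A: "0 < A" using assms by (simp add: A_def)
  define l where "l = sqrt (A / \<nu>)"
  have l: "0 < l" using A \<nu> by (simp add: l_def)
  \<comment> \<open>Solves \<open>\<nu> * (ln (2 * \<epsilon>))\<^sup>2 = A\<close>.\<close>
  define \<epsilon> where "\<epsilon> = exp (- l) / 2"
  have \<epsilon>: "0 < \<epsilon>" "\<epsilon> < 1/2" using l by (auto simp: \<epsilon>_def)
  have "\<nu> * (ln (2 * \<epsilon>))\<^sup>2 = A" using A \<nu> by (simp add: \<epsilon>_def l_def)
  then have \<epsilon>3: "A \<le> \<nu> * (ln (2 * \<epsilon>))\<^sup>2" by simp
  have C4: "1 \<le> C * 4 powr \<alpha>"
  proof -
    have "1 \<le> (4::real) powr \<alpha>" using assms by (intro ge_one_powr_ge_zero) auto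
    then have "1 * 1 \<le> C * 4 powr \<alpha>" using assms by (intro mult_mono) auto
    then show ?thesis by simp
  qed
  \<comment> \<open>Makes the tail created by the rise,
    \<open>\<delta> * C * 4 powr \<alpha>\<close>, equal to \<open>\<epsilon>/4\<close>. With
    \<open>q powr \<alpha> \<le> 1/4\<close> the old tail is at most \<open>\<epsilon>/8\<close>,
    and the sum stays below \<open>\<epsilon>/2 * (7/8)\<close>, hence below the allowance because
    \<open>\<delta> < 1/8\<close>.\<close>
  define \<delta> where "\<delta> = \<epsilon> / (4 * (C * 4 powr \<alpha>))"
  have \<delta>: "0 < \<delta>" "\<delta> \<le> \<epsilon>/4" using \<epsilon> C4 frac_le[of \<epsilon> \<epsilon> 4 "4 * (C * 4 powr \<alpha>)"] by (simp_all add: \<delta>_def)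
  have \<delta>C: "\<delta> * C * 4 powr \<alpha> = \<epsilon>/4"
  proof -
    have "\<delta> * C * 4 powr \<alpha> = \<epsilon> * (C * 4 powr \<alpha>) / (4 * (C * 4 powr \<alpha>))" by (simp add: \<delta>_def)
    also have "\<dots> = \<epsilon>/4" using C4 by (subst mult_divide_mult_cancel_right) auto
    finally show ?thesis .
  qed
  define q where "q = min (1/4) ((4::real) powr (- 1 / \<alpha>))"
  have q: "0 < q" "q \<le> 1/4" by (auto simp: q_def)
  have "q powr \<alpha> \<le> (4 powr (- 1 / \<alpha>)) powr \<alpha>" using q assms by (intro powr_mono2) (auto simp: q_def)
  also have "\<dots> = 4 powr - 1" using assms unfolding powr_powr by simp
  also have "\<dots> = 1/4" by (simp add: powr_minus_divide)
  finally have "q powr \<alpha> \<le> 1/4" .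
  then have "\<epsilon>/2 * q powr \<alpha> \<le> \<epsilon>/2 * (1/4)" using \<epsilon> by (intro mult_left_mono) auto
  moreover have "\<epsilon>/2 * (7/8) \<le> \<epsilon>/2 * (1 - \<delta>)" using \<epsilon> \<delta> by (intro mult_left_mono) auto
  ultimately have q3: "\<epsilon>/2 * q powr \<alpha> + \<delta> * C * 4 powr \<alpha> \<le> \<epsilon>/2 * (1 - \<delta>)"
    unfolding \<delta>C using \<epsilon> by linarith
  show ?thesis
    using \<nu> \<nu>3 \<epsilon> \<epsilon>3 \<delta> q q3 unfolding K_def c_def A_def \<sigma>_def by blast
qed

section \<open>The continuous representative\<close>

text \<open>Where the set is non-empty and bounded, this is the limit of essential infima over
  shrinking balls. It is given at every point and depends only on the almost-everywhere class of
  \<open>u\<close>, so it can serve as the continuous representative.\<close>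

definition ess_liminf :: "('a::euclidean_space \<Rightarrow> real) \<Rightarrow> 'a \<Rightarrow> real" where
  "ess_liminf u x = Sup {a. \<exists>\<rho>>0. AE y in lborel. y \<in> ball x \<rho> \<longrightarrow> a \<le> u y}"

lemma ess_liminf_between:
  assumes ae: "AE y in lborel. y \<in> ball z \<rho> \<longrightarrow> m \<le> u y \<and> u y \<le> M" and x: "x \<in> ball z \<rho>"
  shows "m \<le> ess_liminf u x" "ess_liminf u x \<le> M"
proof -
  obtain e where e: "0 < e" "ball x e \<subseteq> ball z \<rho>"
    using x open_ball open_contains_ball by blast
  let ?A = "{a. \<exists>\<rho>>0. AE y in lborel. y \<in> ball x \<rho> \<longrightarrow> a \<le> u y}"
  have "AE y in lborel. y \<in> ball x e \<longrightarrow> m \<le> u y" using ae by eventually_elim (use e(2) in auto)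
  then have m: "m \<in> ?A" using e(1) by auto
  have M: "a \<le> M" if a: "a \<in> ?A" for a
  proof (rule ccontr)
    assume "\<not> a \<le> M"
    obtain r where r: "0 < r" "AE y in lborel. y \<in> ball x r \<longrightarrow> a \<le> u y" using a by blast
    have "AE y in lborel. y \<notin> ball x (min r e)"
      using r(2) ae by eventually_elim (use e(2) \<open>\<not> a \<le> M\<close> in auto)
    then have "emeasure lborel (ball x (min r e)) = 0"
      by (subst (asm) AE_iff_measurable[where N = "ball x (min r e)"]) auto
    then show False
      using r(1) e(1) emeasure_lborel_ball_nonzero[of "min r e" x] by simp
  qed
  show "m \<le> ess_liminf u x" unfolding ess_liminf_def
    by (rule cSup_upper[OF m bdd_aboveI[OF M]])
  show "ess_liminf u x \<le> M" unfolding ess_liminf_def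
    by (rule cSup_least) (use m M in blast)+
qed

text \<open>Countably many statements suffice: balls with centres in a countable dense set and
  reciprocal integer radii, with rational bounds. Off one null set, each of them that holds almost
  everywhere also holds at the point itself, which squeezes \<open>u x\<close> and the essential
  lower limit together.\<close>

lemma ess_liminf_AE_eq:
  fixes u :: "'a::euclidean_space \<Rightarrow> real"
  assumes osc: "\<And>x e. x \<in> E \<Longrightarrow> 0 < e \<Longrightarrow>
    \<exists>\<rho> m. 0 < \<rho> \<and> (AE y in lborel. y \<in> ball x \<rho> \<longrightarrow> m \<le> u y \<and> u y \<le> m + e)"
  shows "AE x in lborel. x \<in> E \<longrightarrow> ess_liminf u x = u x"
proof -
  obtain D :: "'a set" where D: "countable D" "\<And>X. open X \<Longrightarrow> X \<noteq> {} \<Longrightarrow> \<exists>d\<in>D. d \<in> X"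
    using countable_dense_exists by metis
  define I where "I = D \<times> (UNIV :: nat set) \<times> (\<rat> :: real set) \<times> (\<rat> :: real set)"
  define P where "P i y \<longleftrightarrow> (case i of (d, n, a, b) \<Rightarrow>
    y \<in> ball d (inverse (real (Suc n))) \<longrightarrow> a \<le> u y \<and> u y \<le> b)" for i y
  have "countable I" unfolding I_def using D(1) by (intro countable_SIGMA countable_rat) auto
  then have "AE x in lborel. \<forall>i\<in>I. (AE y in lborel. P i y) \<longrightarrow> P i x"
    by (subst AE_ball_countable) (auto intro: AE_I2)
  then show ?thesis
  proof (eventually_elim, intro impI)
    fix x assume ctb: "\<forall>i\<in>I. (AE y in lborel. P i y) \<longrightarrow> P i x" and x: "x \<in> E"
    have "\<bar>ess_liminf u x - u x\<bar> \<le> 0 + e" if e: "0 < e" for e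
    proof -
      obtain \<rho> m where \<rho>: "0 < \<rho>" "AE y in lborel. y \<in> ball x \<rho> \<longrightarrow> m \<le> u y \<and> u y \<le> m + e/3"
        using osc[OF x, of "e/3"] e by auto
      obtain n where n: "inverse (real (Suc n)) < \<rho> / 2" using reals_Archimedean[of "\<rho>/2"] \<rho>(1) by auto
      obtain d where d: "d \<in> D" "d \<in> ball x (inverse (real (Suc n)))"
        using D(2)[of "ball x (inverse (real (Suc n)))"] by auto
      obtain a where a: "a \<in> \<rat>" "m - e/3 < a" "a < m" using Rats_dense_in_real[of "m - e/3" m] e by auto
      obtain b where b: "b \<in> \<rat>" "m + e/3 < b" "b < m + 2*e/3"
        using Rats_dense_in_real[of "m + e/3" "m + 2*e/3"] e by auto
      have xd: "x \<in> ball d (inverse (real (Suc n)))" using d(2) by (simp add: dist_commute)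
      have "ball d (inverse (real (Suc n))) \<subseteq> ball x \<rho>"
      proof
        fix y assume "y \<in> ball d (inverse (real (Suc n)))"
        then show "y \<in> ball x \<rho>" using d(2) n dist_triangle[of x y d] by (simp only: mem_ball)
      qed
      then have ae: "AE y in lborel. y \<in> ball d (inverse (real (Suc n))) \<longrightarrow> a \<le> u y \<and> u y \<le> b"
        using \<rho>(2) by (auto elim!: eventually_mono dest!: subsetD) (use a b in linarith)+
      then have "a \<le> u x \<and> u x \<le> b"
        using ctb[rule_format, of "(d, n, a, b)"] d(1) a(1) b(1) xd by (simp add: I_def P_def)
      then show ?thesis using ess_liminf_between[OF ae xd] a b by auto
    qed
    then have "\<bar>ess_liminf u x - u x\<bar> \<le> 0" by (rule field_le_epsilon)
    then show "ess_liminf u x = u x" by simp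
  qed
qed

section \<open>From local to uniform Holder bounds\<close>

lemma compact_uniform_bound:
  fixes P :: "real \<Rightarrow> 'a::topological_space \<Rightarrow> bool"
  assumes S: "compact S" and loc: "\<And>p. p \<in> S \<Longrightarrow> \<exists>U c. open U \<and> p \<in> U \<and> (\<forall>z\<in>U. P c z)"
    and mono: "\<And>c c' z. P c z \<Longrightarrow> c \<le> c' \<Longrightarrow> P c' z"
  shows "\<exists>c. \<forall>z\<in>S. P c z"
proof -
  obtain U c where U: "\<And>p. p \<in> S \<Longrightarrow> open (U p) \<and> p \<in> U p \<and> (\<forall>z\<in>U p. P (c p) z)"
    using loc by metis
  obtain F where F: "F \<subseteq> S" "finite F" "S \<subseteq> (\<Union>p\<in>F. U p)"
    by (rule compactE_image[OF S, of S U]) (use U in auto)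
  have "P (Max (c ` F)) z" if z: "z \<in> S" for z
  proof -
    obtain p where "p \<in> F" "z \<in> U p" using F(3) z by blast
    then have "P (c p) z" using F(1) U by blast
    moreover have "c p \<le> Max (c ` F)" using F(2) \<open>p \<in> F\<close> by (intro Max_ge) auto
    ultimately show ?thesis by (rule mono)
  qed
  then show ?thesis by blast
qed

text \<open>Compactness is used on \<open>K \<times> K\<close>: near the diagonal the local bound
  applies, and near a pair of distinct points the distance is bounded below, so local boundedness of
  \<open>v\<close> is enough.\<close>

lemma holder_on_compact:
  fixes v :: "'a::euclidean_space \<Rightarrow> real"
  assumes K: "compact K" and \<beta>: "0 < \<beta>"
    and loc: "\<And>z. z \<in> K \<Longrightarrow> \<exists>s c. 0 < s \<and> (\<forall>x\<in>ball z s. \<forall>y\<in>ball z s. \<bar>v x - v y\<bar> \<le> c * dist x y powr \<beta>)"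
  shows "\<exists>c. \<forall>x\<in>K. \<forall>y\<in>K. \<bar>v x - v y\<bar> \<le> c * dist x y powr \<beta>"
proof -
  have "\<exists>c. \<forall>z\<in>K \<times> K. \<bar>v (fst z) - v (snd z)\<bar> \<le> c * dist (fst z) (snd z) powr \<beta>"
  proof (rule compact_uniform_bound)
    show "compact (K \<times> K)" using K by (intro compact_Times)
    show "\<bar>v (fst z) - v (snd z)\<bar> \<le> c' * dist (fst z) (snd z) powr \<beta>"
      if "\<bar>v (fst z) - v (snd z)\<bar> \<le> c * dist (fst z) (snd z) powr \<beta>" "c \<le> c'" for z c c'
      using that(1) mult_right_mono[OF that(2), of "dist (fst z) (snd z) powr \<beta>"] by simp
    fix p :: "'a \<times> 'a" assume p: "p \<in> K \<times> K"
    obtain a b where ab: "p = (a, b)" "a \<in> K" "b \<in> K" using p by auto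
    obtain s c where s: "0 < s" "\<forall>x\<in>ball a s. \<forall>y\<in>ball a s. \<bar>v x - v y\<bar> \<le> c * dist x y powr \<beta>"
      using loc[OF ab(2)] by blast
    obtain s' c' where s': "0 < s'" "\<forall>x\<in>ball b s'. \<forall>y\<in>ball b s'. \<bar>v x - v y\<bar> \<le> c' * dist x y powr \<beta>"
      using loc[OF ab(3)] by blast
    show "\<exists>U c. open U \<and> p \<in> U \<and> (\<forall>z\<in>U. \<bar>v (fst z) - v (snd z)\<bar> \<le> c * dist (fst z) (snd z) powr \<beta>)"
    proof (cases "a = b")
      case True
      then show ?thesis
        using s ab by (intro exI[of _ "ball a s \<times> ball a s"] exI[of _ c]) (auto simp: open_Times)
    next
      case False
      define d where "d = dist a b"
      have d: "0 < d" using False by (simp add: d_def)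
      \<comment> \<open>Bounds the difference by passing through \<open>a\<close> and
        \<open>b\<close>. Dividing by \<open>(d/2) powr \<beta>\<close> suffices because points
        within \<open>d/4\<close> of \<open>a\<close> and \<open>b\<close> stay at least
        \<open>d/2\<close> apart.\<close>
      define B where "B = \<bar>c\<bar> * d powr \<beta> + \<bar>v a - v b\<bar> + \<bar>c'\<bar> * d powr \<beta>"
      have near: "\<bar>v x - v a\<bar> \<le> \<bar>k\<bar> * d powr \<beta>"
        if "0 < r" "\<forall>x\<in>ball a r. \<forall>y\<in>ball a r. \<bar>v x - v y\<bar> \<le> k * dist x y powr \<beta>" "x \<in> ball a (min r (d/4))" for x a r k
      proof -
        have "\<bar>v x - v a\<bar> \<le> k * dist x a powr \<beta>" using that by auto
        also have "\<dots> \<le> \<bar>k\<bar> * dist x a powr \<beta>" by (intro mult_right_mono) auto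
        also have "\<dots> \<le> \<bar>k\<bar> * d powr \<beta>"
          using that(3) \<beta> d by (intro mult_left_mono powr_mono2) (auto simp: dist_commute)
        finally show ?thesis .
      qed
      show ?thesis
      proof (intro exI[of _ "ball a (min s (d/4)) \<times> ball b (min s' (d/4))"] exI[of _ "B / (d/2) powr \<beta>"] conjI ballI)
        show "p \<in> ball a (min s (d/4)) \<times> ball b (min s' (d/4))" using s(1) s'(1) d by (simp add: ab(1))
        fix z assume z: "z \<in> ball a (min s (d/4)) \<times> ball b (min s' (d/4))"
        obtain x y where xy: "z = (x, y)" by (cases z)
        have x: "x \<in> ball a (min s (d/4))" and y: "y \<in> ball b (min s' (d/4))" using z by (auto simp: xy)
        have "\<bar>v x - v y\<bar> \<le> B" using near[OF s x] near[OF s' y] unfolding B_def by linarith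
        also have "B = B / (d/2) powr \<beta> * (d/2) powr \<beta>" using d by simp
        also have "\<dots> \<le> B / (d/2) powr \<beta> * dist x y powr \<beta>"
        proof (intro mult_left_mono powr_mono2)
          have "dist a b \<le> dist a x + dist x y + dist b y"
            using dist_triangle[of a b x] dist_triangle[of x b y] by (simp add: dist_commute)
          then show "d/2 \<le> dist x y" using x y by (simp add: d_def[symmetric])
        qed (use \<beta> d in \<open>auto simp: B_def\<close>)
        finally show "\<bar>v (fst z) - v (snd z)\<bar> \<le> B / (d/2) powr \<beta> * dist (fst z) (snd z) powr \<beta>" by (simp add: xy)
      qed (simp add: open_Times)
    qed
  qed
  then show ?thesis by force
qed

section \<open>Essential oscillation and regularity of solutions\<close>

lemma AE_lebesgue_on_iff:
  assumes "S \<in> sets lebesgue"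
  shows "(AE x in lebesgue_on S. P x) \<longleftrightarrow> (AE x in lborel. x \<in> S \<longrightarrow> P x)"
  using assms by (simp add: AE_restrict_space_iff AE_completion_iff)

lemma ess_osc_on_le:
  assumes u: "u \<in> borel_measurable lebesgue" and S: "S \<in> sets lebesgue"
    and bd: "AE x in lborel. x \<in> S \<longrightarrow> m \<le> u x \<and> u x \<le> m + e"
  shows "ess_osc_on S u \<le> ereal e"
proof -
  have [measurable]: "u \<in> borel_measurable (lebesgue_on S)" using u by (rule measurable_restrict_space1)
  have "ess_sup_on S u \<le> ereal (m + e)"
    unfolding ess_sup_on_def
  proof (rule esssup_I)
    show "AE x in lebesgue_on S. ereal (u x) \<le> ereal (m + e)"
      unfolding AE_lebesgue_on_iff[OF S] using bd by eventually_elim auto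
  qed measurable
  moreover have "ess_sup_on S (\<lambda>x. - u x) \<le> ereal (- m)"
    unfolding ess_sup_on_def
  proof (rule esssup_I)
    show "AE x in lebesgue_on S. ereal (- u x) \<le> ereal (- m)"
      unfolding AE_lebesgue_on_iff[OF S] using bd by eventually_elim auto
  qed measurable
  then have "ereal m \<le> ess_inf_on S u"
    unfolding ess_inf_on_def using ereal_minus_le_minus[of "ereal (- m)"] by (simp add: ereal_uminus_le_reorder)
  ultimately have "ess_osc_on S u \<le> ereal (m + e) - ereal m"
    unfolding ess_osc_on_def by (rule ereal_minus_mono)
  then show ?thesis by simp
qed

context regularity_setting
begin

lemma weak_solution_borel_representative:
  assumes sol: "weak_solution \<mu> E u"
  obtains w where "borel_solution w" "AE x in lborel. u x = w x"
proof -
  have "u \<in> borel_measurable lebesgue"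
    using sol by (simp add: weak_solution_def weak_subsolution_def admissible_def)
  then obtain w where w: "w \<in> borel_measurable lborel" "AE x in lborel. u x = w x"
    using completion_ex_borel_measurable_real by blast
  then have "borel_solution w"
    unfolding borel_solution_def using weak_solution_affine_supersolution[OF sol bounded_E _ w(2)] by auto
  then show thesis using w(2) that by blast
qed

text \<open>One constant has to serve all centres near \<open>z\<close>. The decay is therefore
  recentred at \<open>x\<close> with radius \<open>R/2\<close>, and the tail around \<open>x\<close>
  is compared with the one around \<open>z\<close>.\<close>

lemma solution_locally_holder:
  assumes sol: "borel_solution w" and opn: "open E" and z: "z \<in> E"
    and bd: "\<And>K. compact K \<Longrightarrow> K \<subseteq> E \<Longrightarrow> \<exists>M. AE x in lborel. x \<in> K \<longrightarrow> \<bar>w x\<bar> \<le> M"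
  shows "\<exists>s c. 0 < s \<and> 0 \<le> c \<and> (\<forall>x\<in>ball z s. \<forall>\<rho>. 0 < \<rho> \<and> \<rho> < s \<longrightarrow>
    (\<exists>m. AE y in lborel. y \<in> ball x \<rho> \<longrightarrow> m \<le> w y \<and> w y \<le> m + c * \<rho> powr holder_exponent \<delta> q))"
proof -
  obtain R where R: "0 < R" "cball z R \<subseteq> E" using opn z open_contains_cball by blast
  have [measurable]: "w \<in> borel_measurable borel" using sol by (simp add: borel_solution_def)
  have "borel_supersolution \<mu> E w"
    by (rule borel_solutionD[OF sol, where a = 1 and b = 0]) auto
  then have tf: "tail_finite \<mu> E w" by (simp add: borel_supersolution_def)
  obtain M where M: "AE x in lborel. x \<in> cball z R \<longrightarrow> \<bar>w x\<bar> \<le> M" using bd[OF compact_cball R(2)] by blast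
  have "ball z R \<subseteq> E" using R(2) ball_subset_cball by blast
  then obtain T where T: "AE x in lborel. x \<in> ball z (7/8 * R) \<longrightarrow> (\<integral>\<^sup>+y\<in>- ball z R. ennreal \<bar>w y\<bar> \<partial>\<mu> x) \<le> ennreal T"
    using tf R(1) unfolding tail_finite_def by blast
  define r where "r = R/2"
  have r: "0 < r" using R by (simp add: r_def)
  \<comment> \<open>The tail beyond \<open>ball z R\<close>, plus the bound \<open>M\<close> on the
    points between the two balls, weighted by the decay at distance \<open>r/8\<close>.\<close>
  define T2 where "T2 = max 0 T + \<bar>M\<bar> * (C * (r - 7/8 * r) powr - \<alpha>)"
  define W where "W = max 1 (max M (T2 * r powr \<alpha>))"
  define \<beta> where "\<beta> = holder_exponent \<delta> q"
  define c where "c = holder_factor \<epsilon> \<delta> q * W * (1 / r) powr \<beta>"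
  have W: "0 < W" "M \<le> W" "T2 * r powr \<alpha> \<le> W" by (auto simp: W_def)
  have "1 < holder_factor \<epsilon> \<delta> q" by (rule holder_factor_gt_1[OF delta q(1,2) eps(2)])
  then have c: "0 \<le> c" using W(1) by (simp add: c_def)
  have est: "\<exists>m. AE y in lborel. y \<in> ball x \<rho> \<longrightarrow> m \<le> w y \<and> w y \<le> m + c * \<rho> powr \<beta>"
    if x: "x \<in> ball z (R/8)" and \<rho>: "0 < \<rho>" "\<rho> < R/8" for x \<rho>
  proof -
    have sub: "ball x r \<subseteq> ball z R"
    proof
      fix y assume "y \<in> ball x r"
      then show "y \<in> ball z R" using x R dist_triangle[of z y x] by (simp add: r_def)
    qed
    have "\<exists>m. AE y in lborel. y \<in> ball x \<rho> \<longrightarrow> m \<le> w y \<and> w y \<le> m + holder_factor \<epsilon> \<delta> q * W * (\<rho> / r) powr holder_exponent \<delta> q"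
    proof (rule oscillation_decay[OF sol _ \<rho>(1) _ W(1)])
      show "ball x r \<subseteq> E" using sub \<open>ball z R \<subseteq> E\<close> by blast
      show "\<rho> < r" using \<rho> R by (simp add: r_def)
      show "AE y in lborel. y \<in> ball x r \<longrightarrow> \<bar>w y\<bar> \<le> W"
        using M
      proof (eventually_elim, intro impI)
        fix y assume "y \<in> cball z R \<longrightarrow> \<bar>w y\<bar> \<le> M" "y \<in> ball x r"
        then have "\<bar>w y\<bar> \<le> M" using sub by (auto simp: subset_iff less_imp_le)
        then show "\<bar>w y\<bar> \<le> W" using W(2) by linarith
      qed
      show "AE y in lborel. y \<in> ball x (7/8 * r) \<longrightarrow> (\<integral>\<^sup>+y'\<in>- ball x r. ennreal \<bar>w y'\<bar> \<partial>\<mu> y) \<le> ennreal (W * r powr - \<alpha>)"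
        using T AE_mu[OF M]
      proof (eventually_elim, intro impI)
        fix y assume t: "y \<in> ball z (7/8 * R) \<longrightarrow> (\<integral>\<^sup>+y\<in>- ball z R. ennreal \<bar>w y\<bar> \<partial>\<mu> y) \<le> ennreal T"
          and ae: "AE y' in \<mu> y. y' \<in> cball z R \<longrightarrow> \<bar>w y'\<bar> \<le> M" and y: "y \<in> ball x (7/8 * r)"
        have yz: "y \<in> ball z (7/8 * R)" using y x R(1) dist_triangle[of z y x] by (simp add: r_def)
        have "(\<integral>\<^sup>+y'\<in>- ball x r. ennreal \<bar>w y'\<bar> \<partial>\<mu> y) \<le>
          (\<integral>\<^sup>+y'. ennreal \<bar>w y'\<bar> * indicator (- ball z R) y' + ennreal \<bar>M\<bar> * indicator (- ball x r) y' \<partial>\<mu> y)"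
        proof (rule nn_integral_mono_AE)
          show "AE y' in \<mu> y. ennreal \<bar>w y'\<bar> * indicator (- ball x r) y' \<le>
            ennreal \<bar>w y'\<bar> * indicator (- ball z R) y' + ennreal \<bar>M\<bar> * indicator (- ball x r) y'"
            using ae
          proof eventually_elim
            case (elim y')
            show ?case
            proof (cases "y' \<in> ball z R")
              case True
              then have "ennreal \<bar>w y'\<bar> \<le> ennreal \<bar>M\<bar>" using elim by (intro ennreal_leI) auto
              then show ?thesis using True by (auto simp: indicator_def)
            next
              case False
              then have "y' \<notin> ball x r" using sub by blast
              then show ?thesis using False by simp
            qed
          qed
        qed
        also have "\<dots> = (\<integral>\<^sup>+y'\<in>- ball z R. ennreal \<bar>w y'\<bar> \<partial>\<mu> y) + ennreal \<bar>M\<bar> * emeasure (\<mu> y) (- ball x r)"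
          by (simp add: nn_integral_add nn_integral_cmult_indicator)
        also have "\<dots> \<le> ennreal (max 0 T) + ennreal \<bar>M\<bar> * ennreal (C * (r - 7/8 * r) powr - \<alpha>)"
          using t yz y r by (intro add_mono mult_left_mono emeasure_mu_ball_complement) (auto simp: ennreal_max_0)
        also have "\<dots> = ennreal T2"
          using C_ge by (simp add: T2_def flip: ennreal_mult'' ennreal_plus)
        also have "\<dots> \<le> ennreal (W * r powr - \<alpha>)"
          using W(3) r by (intro ennreal_leI) (simp add: powr_minus field_simps)
        finally show "(\<integral>\<^sup>+y'\<in>- ball x r. ennreal \<bar>w y'\<bar> \<partial>\<mu> y) \<le> ennreal (W * r powr - \<alpha>)" .
      qed
    qed
    moreover have "holder_factor \<epsilon> \<delta> q * W * (\<rho> / r) powr holder_exponent \<delta> q = c * \<rho> powr \<beta>"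
      by (simp add: c_def \<beta>_def powr_divide)
    ultimately show ?thesis by simp
  qed
  show ?thesis
    using R(1) c est unfolding \<beta>_def by (intro exI[of _ "R/8"] exI[of _ c]) auto
qed

text \<open>Both parts use the local oscillation bound at a suitable radius: one so small that the
  oscillation falls below \<open>e\<close>, or twice the distance of two points, so that a ball
  around one contains the other.\<close>

lemma solution_holder_representative:
  assumes sol: "borel_solution w" and opn: "open E"
    and bd: "\<And>K. compact K \<Longrightarrow> K \<subseteq> E \<Longrightarrow> \<exists>M. AE x in lborel. x \<in> K \<longrightarrow> \<bar>w x\<bar> \<le> M"
  shows "AE x in lborel. x \<in> E \<longrightarrow> ess_liminf w x = w x" "locally_holder_on E (ess_liminf w)"
proof -
  define \<beta> where "\<beta> = holder_exponent \<delta> q"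
  have \<beta>: "0 < \<beta>" "\<beta> < 1" using holder_exponent_bounds by (auto simp: \<beta>_def)
  have loc: "\<exists>s c. 0 < s \<and> 0 \<le> c \<and> (\<forall>x\<in>ball z s. \<forall>\<rho>. 0 < \<rho> \<and> \<rho> < s \<longrightarrow>
    (\<exists>m. AE y in lborel. y \<in> ball x \<rho> \<longrightarrow> m \<le> w y \<and> w y \<le> m + c * \<rho> powr \<beta>))" if "z \<in> E" for z
    unfolding \<beta>_def by (rule solution_locally_holder[OF sol opn that bd])
  show "AE x in lborel. x \<in> E \<longrightarrow> ess_liminf w x = w x"
  proof (rule ess_liminf_AE_eq)
    fix x e assume x: "x \<in> E" and e: "(0::real) < e"
    obtain s c where s: "0 < s" "0 \<le> c" "\<forall>x'\<in>ball x s. \<forall>\<rho>. 0 < \<rho> \<and> \<rho> < s \<longrightarrow>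
      (\<exists>m. AE y in lborel. y \<in> ball x' \<rho> \<longrightarrow> m \<le> w y \<and> w y \<le> m + c * \<rho> powr \<beta>)"
      using loc[OF x] by blast
    define \<rho> where "\<rho> = min (s/2) ((e / (c + 1)) powr (1 / \<beta>))"
    have \<rho>: "0 < \<rho>" "\<rho> < s" using s e by (auto simp: \<rho>_def)
    have "\<rho> powr \<beta> \<le> ((e / (c + 1)) powr (1 / \<beta>)) powr \<beta>"
      using \<rho> \<beta> by (intro powr_mono2) (auto simp: \<rho>_def)
    also have "\<dots> = e / (c + 1)" using \<beta> s e by (simp add: powr_powr)
    finally have "c * \<rho> powr \<beta> \<le> c * (e / (c + 1))" using s by (intro mult_left_mono)
    also have "\<dots> \<le> e" using s e by (simp add: field_simps)
    finally have le: "c * \<rho> powr \<beta> \<le> e" .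
    obtain m where m: "AE y in lborel. y \<in> ball x \<rho> \<longrightarrow> m \<le> w y \<and> w y \<le> m + c * \<rho> powr \<beta>"
      using s(3)[rule_format, of x \<rho>] s(1) \<rho> by auto
    have "AE y in lborel. y \<in> ball x \<rho> \<longrightarrow> m \<le> w y \<and> w y \<le> m + e"
      using m by eventually_elim (use le in auto)
    then show "\<exists>\<rho> m. 0 < \<rho> \<and> (AE y in lborel. y \<in> ball x \<rho> \<longrightarrow> m \<le> w y \<and> w y \<le> m + e)"
      using \<rho>(1) by blast
  qed
  have "\<exists>c. \<forall>x\<in>K. \<forall>y\<in>K. \<bar>ess_liminf w x - ess_liminf w y\<bar> \<le> c * dist x y powr \<beta>"
    if K: "compact K" "K \<subseteq> E" for K
  proof (rule holder_on_compact[OF K(1) \<beta>(1)])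
    fix z assume "z \<in> K"
    then obtain s c where s: "0 < s" "0 \<le> c" "\<forall>x\<in>ball z s. \<forall>\<rho>. 0 < \<rho> \<and> \<rho> < s \<longrightarrow>
      (\<exists>m. AE y in lborel. y \<in> ball x \<rho> \<longrightarrow> m \<le> w y \<and> w y \<le> m + c * \<rho> powr \<beta>)"
      using loc[of z] K(2) by blast
    have "\<bar>ess_liminf w x - ess_liminf w y\<bar> \<le> c * 2 powr \<beta> * dist x y powr \<beta>"
      if x: "x \<in> ball z (s/4)" and y: "y \<in> ball z (s/4)" for x y
    proof (cases "x = y")
      case False
      define \<rho> where "\<rho> = 2 * dist x y"
      have d: "0 < dist x y" using False by simp
      have "dist x y < s/2" using x y dist_triangle[of x y z] by (simp add: dist_commute)
      then have \<rho>: "0 < \<rho>" "\<rho> < s" using d by (auto simp: \<rho>_def)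
      have "x \<in> ball z s" using x s(1) by simp
      then obtain m where m: "AE y in lborel. y \<in> ball x \<rho> \<longrightarrow> m \<le> w y \<and> w y \<le> m + c * \<rho> powr \<beta>"
        using s(3)[rule_format, of x \<rho>] \<rho> by auto
      have "x \<in> ball x \<rho>" "y \<in> ball x \<rho>" using d by (auto simp: \<rho>_def)
      from ess_liminf_between[OF m this(1)] ess_liminf_between[OF m this(2)]
      have "\<bar>ess_liminf w x - ess_liminf w y\<bar> \<le> c * \<rho> powr \<beta>" by linarith
      then show ?thesis by (simp add: \<rho>_def powr_mult mult.assoc)
    qed simp
    then show "\<exists>s c. 0 < s \<and> (\<forall>x\<in>ball z s. \<forall>y\<in>ball z s. \<bar>ess_liminf w x - ess_liminf w y\<bar> \<le> c * dist x y powr \<beta>)"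
      using s(1) by (intro exI[of _ "s/4"] exI[of _ "c * 2 powr \<beta>"]) auto
  qed
  then show "locally_holder_on E (ess_liminf w)"
    unfolding locally_holder_on_def using \<beta> by (intro exI[of _ \<beta>]) auto
qed

lemma solution_oscillation_estimate:
  assumes sol: "weak_solution \<mu> E u" and ball: "ball x\<^sub>0 R \<subseteq> E" and \<rho>: "0 < \<rho>" "\<rho> < R"
  shows "ess_osc_on (ball x\<^sub>0 \<rho>) u \<le>
    ereal (holder_factor \<epsilon> \<delta> q) *
    (2 * ess_sup_on (ball x\<^sub>0 R) (\<lambda>x. \<bar>u x\<bar>) +
      enn2ereal (tail \<alpha> \<mu> (\<lambda>y. ennreal \<bar>u y\<bar>) x\<^sub>0 (7/8 * R) R)) *
    ereal ((\<rho> / R) powr holder_exponent \<delta> q)"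
proof -
  define \<gamma> where "\<gamma> = holder_factor \<epsilon> \<delta> q"
  define k where "k = (\<rho> / R) powr holder_exponent \<delta> q"
  define M where "M = ess_sup_on (ball x\<^sub>0 R) (\<lambda>x. \<bar>u x\<bar>)"
  define T where "T = tail \<alpha> \<mu> (\<lambda>y. ennreal \<bar>u y\<bar>) x\<^sub>0 (7/8 * R) R"
  have R: "0 < R" using \<rho> by simp
  have \<gamma>: "0 < \<gamma>" using holder_factor_gt_1[OF delta q(1,2) eps(2)] by (simp add: \<gamma>_def)
  have k: "0 < k" using \<rho> R by (simp add: k_def)
  have u: "u \<in> borel_measurable lebesgue"
    using sol by (simp add: weak_solution_def weak_subsolution_def admissible_def)
  obtain w where w: "borel_solution w" "AE x in lborel. u x = w x"
    using weak_solution_borel_representative[OF sol] by blast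
  have Mae: "AE x in lborel. x \<in> ball x\<^sub>0 R \<longrightarrow> ereal \<bar>u x\<bar> \<le> M"
    using esssup_AE[of "\<lambda>x. ereal \<bar>u x\<bar>" "lebesgue_on (ball x\<^sub>0 R)"]
    by (subst (asm) AE_lebesgue_on_iff) (auto simp: M_def ess_sup_on_def)
  \<comment> \<open>A ball of positive radius is not null. This excludes negative infinity, the
    default-like value of an essential supremum over a null set.\<close>
  have M0: "0 \<le> M"
  proof (rule ccontr)
    assume "\<not> 0 \<le> M"
    have "AE x in lborel. x \<notin> ball x\<^sub>0 R"
      using Mae
    proof eventually_elim
      case (elim x)
      have "0 \<le> ereal \<bar>u x\<bar>" by simp
      then show ?case using elim \<open>\<not> 0 \<le> M\<close> order_trans by blast
    qed
    then have "emeasure lborel (ball x\<^sub>0 R) = 0"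
      by (subst (asm) AE_iff_measurable[where N = "ball x\<^sub>0 R"]) auto
    then show False using emeasure_lborel_ball_nonzero[OF R, of x\<^sub>0] by simp
  qed
  show ?thesis
  proof (cases "M = \<infinity> \<or> T = \<infinity>")
    \<comment> \<open>The supremum may be infinite because the closed ball need not lie in
      \<open>E\<close>; the right-hand side is then infinite.\<close>
    case True
    then have "2 * M + enn2ereal T = \<infinity>" using M0 by auto
    then have "ereal \<gamma> * (2 * M + enn2ereal T) * ereal k = \<infinity>" using \<gamma> k by simp
    then show ?thesis
      unfolding M_def[symmetric] T_def[symmetric] \<gamma>_def[symmetric] k_def[symmetric]
      by (simp only: ereal_less_eq)
  next
    case False
    then obtain M' where M': "M = ereal M'" using M0 by (cases M) auto
    obtain T' where T': "T = ennreal T'" "0 \<le> T'" using False by (cases T) auto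
    have M'0: "0 \<le> M'" using M0 M' by simp
    have bd: "AE x in lborel. x \<in> ball x\<^sub>0 R \<longrightarrow> \<bar>w x\<bar> \<le> M'"
      using Mae w(2) by eventually_elim (auto simp: M')
    have tail: "AE x in lborel. x \<in> ball x\<^sub>0 (7/8 * R) \<longrightarrow> (\<integral>\<^sup>+y\<in>- ball x\<^sub>0 R. ennreal \<bar>w y\<bar> \<partial>\<mu> x) \<le> ennreal (T' * R powr - \<alpha>)"
      using AE_mu[OF w(2)]
    proof (eventually_elim, intro impI)
      fix x assume ae: "AE y in \<mu> x. u y = w y" and x: "x \<in> ball x\<^sub>0 (7/8 * R)"
      define I where "I = (\<integral>\<^sup>+y\<in>- ball x\<^sub>0 R. ennreal \<bar>w y\<bar> \<partial>\<mu> x)"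
      have "I = (\<integral>\<^sup>+y\<in>- ball x\<^sub>0 R. ennreal \<bar>u y\<bar> \<partial>completion (\<mu> x))"
        unfolding I_def nn_integral_completion using ae by (intro nn_integral_cong_AE) auto
      also have "\<dots> \<le> (SUP x\<in>ball x\<^sub>0 (7/8 * R). \<integral>\<^sup>+y\<in>- ball x\<^sub>0 R. ennreal \<bar>u y\<bar> \<partial>completion (\<mu> x))"
        using x by (rule SUP_upper)
      finally have "ennreal (R powr \<alpha>) * I \<le> ennreal T'"
        unfolding T'(1)[symmetric] T_def tail_def by (rule mult_left_mono) simp
      then have "ennreal (R powr - \<alpha>) * (ennreal (R powr \<alpha>) * I) \<le> ennreal (R powr - \<alpha>) * ennreal T'"
        by (rule mult_left_mono) simp
      also have "ennreal (R powr - \<alpha>) * (ennreal (R powr \<alpha>) * I) = I"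
        using R by (simp flip: mult.assoc ennreal_mult powr_add)
      finally show "I \<le> ennreal (T' * R powr - \<alpha>)"
        unfolding I_def using T'(2) by (simp add: mult.commute flip: ennreal_mult)
    qed
    have "ess_osc_on (ball x\<^sub>0 \<rho>) u \<le> ereal (\<gamma> * (2 * M' + T') * k) + ereal e" if e: "0 < e" for e
    proof -
      \<comment> \<open>\<open>oscillation_decay\<close> asks for a positive \<open>W\<close>, while
        supremum and tail may both vanish. The extra term is scaled so that it contributes exactly
        \<open>e\<close> to the result, and \<open>e\<close> then tends to 0.\<close>
      define W where "W = 2 * M' + T' + e / (\<gamma> * k)"
      have "0 < e / (\<gamma> * k)" using e \<gamma> k by simp
      then have W: "0 < W" "M' \<le> W" "T' \<le> W" using M'0 T'(2) by (auto simp: W_def)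
      have "\<exists>m. AE x in lborel. x \<in> ball x\<^sub>0 \<rho> \<longrightarrow> m \<le> w x \<and> w x \<le> m + holder_factor \<epsilon> \<delta> q * W * (\<rho> / R) powr holder_exponent \<delta> q"
      proof (rule oscillation_decay[OF w(1) ball \<rho> W(1)])
        show "AE x in lborel. x \<in> ball x\<^sub>0 R \<longrightarrow> \<bar>w x\<bar> \<le> W" using bd by eventually_elim (use W in auto)
        have le: "ennreal (T' * R powr - \<alpha>) \<le> ennreal (W * R powr - \<alpha>)"
          using W by (intro ennreal_leI mult_right_mono) auto
        show "AE x in lborel. x \<in> ball x\<^sub>0 (7/8 * R) \<longrightarrow> (\<integral>\<^sup>+y\<in>- ball x\<^sub>0 R. ennreal \<bar>w y\<bar> \<partial>\<mu> x) \<le> ennreal (W * R powr - \<alpha>)"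
          using tail by (rule eventually_mono) (meson le order_trans)
      qed
      then obtain m where "AE x in lborel. x \<in> ball x\<^sub>0 \<rho> \<longrightarrow> m \<le> w x \<and> w x \<le> m + \<gamma> * W * k"
        unfolding \<gamma>_def k_def by blast
      then have "AE x in lborel. x \<in> ball x\<^sub>0 \<rho> \<longrightarrow> m \<le> u x \<and> u x \<le> m + \<gamma> * W * k"
        using w(2) by eventually_elim auto
      then have "ess_osc_on (ball x\<^sub>0 \<rho>) u \<le> ereal (\<gamma> * W * k)"
        by (intro ess_osc_on_le[OF u]) auto
      also have "\<gamma> * W * k = \<gamma> * (2 * M' + T') * k + e"
        using \<gamma> k by (simp add: W_def field_simps)
      finally show ?thesis by simp
    qed
    then have "ess_osc_on (ball x\<^sub>0 \<rho>) u \<le> ereal (\<gamma> * (2 * M' + T') * k)"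
      by (rule ereal_le_epsilon2)
    also have "\<dots> = ereal \<gamma> * (2 * M + enn2ereal T) * ereal k"
      using T' by (simp add: M' enn2ereal_ennreal)
    finally show ?thesis by (simp add: M_def T_def \<gamma>_def k_def)
  qed
qed

end

theorem theorem1p1:
  fixes \<alpha> C\<^sub>1 C\<^sub>2 :: real
  assumes "2 \<le> CARD('n::finite)" and "0 < \<alpha>" and "\<alpha> < 2" and "1 \<le> C\<^sub>1" and "1 \<le> C\<^sub>2"
  shows "\<exists>\<gamma> \<alpha>\<^sub>s. 1 < \<gamma> \<and> 0 < \<alpha>\<^sub>s \<and> \<alpha>\<^sub>s < 1 \<and>
    (\<forall>(E :: (real ^ 'n) set) \<mu> u.
       open E \<and> connected E \<and> E \<noteq> {} \<and> bounded E \<and>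
       borel_measure_family \<mu> \<and> symmetric_kernel \<mu> \<and>
       poincare_inequality \<alpha> \<mu> E C\<^sub>1 \<and> decay_estimate \<alpha> \<mu> C\<^sub>2 \<and>
       locally_ess_bounded E u \<and> weak_solution \<mu> E u \<longrightarrow>
       (\<exists>v. (AE x in lebesgue_on E. v x = u x) \<and> locally_holder_on E v) \<and>
       (\<forall>x\<^sub>0 R \<rho>. ball x\<^sub>0 R \<subseteq> E \<and> 0 < \<rho> \<and> \<rho> < R \<longrightarrow>
          ess_osc_on (ball x\<^sub>0 \<rho>) u \<le>
            ereal \<gamma> *
            (2 * ess_sup_on (ball x\<^sub>0 R) (\<lambda>x. \<bar>u x\<bar>) +
             enn2ereal (tail \<alpha> \<mu> (\<lambda>y. ennreal \<bar>u y\<bar>) x\<^sub>0 (7/8 * R) R)) *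
            ereal ((\<rho> / R) powr \<alpha>\<^sub>s)))"
proof -
  have e: "0 < energy_const \<alpha> C\<^sub>2" using energy_const_positive assms by simp
  \<comment> \<open>The parameters are fixed before the domain, the kernel and the solution enter,
    and so depend only on \<open>C\<^sub>1\<close>, \<open>C\<^sub>2\<close>, \<alpha> and the
    dimension.\<close>
  obtain \<nu> \<epsilon> \<delta> q where par: "0 < \<nu>" "2 * \<nu> * 8 ^ DIM(real ^ 'n) \<le> 1"
    "16 * (12 * C\<^sub>1 * energy_const \<alpha> C\<^sub>2 * 2 powr (\<alpha> / DIM(real ^ 'n))) * \<nu> powr (\<alpha> / DIM(real ^ 'n)) \<le> 4 powr (- 1 / (\<alpha> / DIM(real ^ 'n)))"
    "0 < \<epsilon>" "\<epsilon> < 1/2" "24 * C\<^sub>1 * energy_const \<alpha> C\<^sub>2 * (3/2) ^ DIM(real ^ 'n) \<le> \<nu> * (ln (2 * \<epsilon>))\<^sup>2"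
    "0 < \<delta>" "\<delta> \<le> \<epsilon>/4" "0 < q" "q \<le> 1/4" "\<epsilon>/2 * q powr \<alpha> + \<delta> * C\<^sub>2 * 4 powr \<alpha> \<le> \<epsilon>/2 * (1 - \<delta>)"
    using regularity_parameters_exist[OF assms(2,5,4) e DIM_positive[where 'a = "real ^ 'n"]] by blast
  show ?thesis
  proof (rule exI[of _ "holder_factor \<epsilon> \<delta> q"], rule exI[of _ "holder_exponent \<delta> q"], intro conjI allI impI)
    show "1 < holder_factor \<epsilon> \<delta> q" by (rule holder_factor_gt_1[OF par(7,8,9,10,5)])
    show "0 < holder_exponent \<delta> q" by (rule holder_exponent_pos[OF par(7,8,9,10,5)])
    show "holder_exponent \<delta> q < 1" by (rule holder_exponent_less_1[OF par(7,8,9,10,5)])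
    fix E :: "(real ^ 'n) set" and \<mu> u
    assume h: "open E \<and> connected E \<and> E \<noteq> {} \<and> bounded E \<and>
       borel_measure_family \<mu> \<and> symmetric_kernel \<mu> \<and>
       poincare_inequality \<alpha> \<mu> E C\<^sub>1 \<and> decay_estimate \<alpha> \<mu> C\<^sub>2 \<and>
       locally_ess_bounded E u \<and> weak_solution \<mu> E u"
    interpret regularity_setting \<mu> \<alpha> C\<^sub>2 E C\<^sub>1 \<nu> \<epsilon> \<delta> q
      by unfold_locales (use h assms par in auto)
    have sol: "weak_solution \<mu> E u" and opn: "open E" using h by auto
    have EL: "E \<in> sets lebesgue" using opn by auto
    obtain w where w: "borel_solution w" "AE x in lborel. u x = w x"
      using weak_solution_borel_representative[OF sol] by blast
    have bd: "\<exists>M. AE x in lborel. x \<in> K \<longrightarrow> \<bar>w x\<bar> \<le> M" if K: "compact K" "K \<subseteq> E" for K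
    proof -
      obtain M where M: "AE x in lebesgue_on K. \<bar>u x\<bar> \<le> M"
        using h K unfolding locally_ess_bounded_def by blast
      have "K \<in> sets lebesgue" using K(1) by (simp add: borel_compact)
      from M[unfolded AE_lebesgue_on_iff[OF this]] have "AE x in lborel. x \<in> K \<longrightarrow> \<bar>w x\<bar> \<le> M"
        using w(2) by eventually_elim auto
      then show ?thesis by blast
    qed
    have rep: "AE x in lborel. x \<in> E \<longrightarrow> ess_liminf w x = w x" "locally_holder_on E (ess_liminf w)"
      by (rule solution_holder_representative[OF w(1) opn]; rule bd; assumption)+
    have "AE x in lborel. x \<in> E \<longrightarrow> ess_liminf w x = u x"
      using rep(1) w(2) by eventually_elim auto
    then have "AE x in lebesgue_on E. ess_liminf w x = u x" by (simp add: AE_lebesgue_on_iff[OF EL])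
    then show "\<exists>v. (AE x in lebesgue_on E. v x = u x) \<and> locally_holder_on E v"
      using rep(2) by blast
    fix x\<^sub>0 R \<rho> assume b: "ball x\<^sub>0 R \<subseteq> E \<and> 0 < \<rho> \<and> \<rho> < R"
    show "ess_osc_on (ball x\<^sub>0 \<rho>) u \<le> ereal (holder_factor \<epsilon> \<delta> q) *
      (2 * ess_sup_on (ball x\<^sub>0 R) (\<lambda>x. \<bar>u x\<bar>) +
        enn2ereal (tail \<alpha> \<mu> (\<lambda>y. ennreal \<bar>u y\<bar>) x\<^sub>0 (7/8 * R) R)) *
      ereal ((\<rho> / R) powr holder_exponent \<delta> q)"
      using b by (intro solution_oscillation_estimate[OF sol]) auto
  qed
qed

end
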